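(* Fix $1\leq p<\infty$ and $\mathbf{w}\in\mathbb{W}$. Let $(N_k)_{k=1}^\infty$ be an increasing sequence of positive integers such that the closed linear span $Y$ of the block sequence $((d_i^{(k)})_{i=1}^{N_k})_{k=1}^\infty$ is a 1-complemented subspace of $d(\mathbf{w},p)$ which contains no isomorph of $d(\mathbf{w},p)$ and is not isomorphic to $\ell_p$. Let $P_Y\in\mathcal{L}(d(\mathbf{w},p))$ be any continuous linear projection onto $Y$. Then $$P_Y\in\mathcal{S}_{d(\mathbf{w},p)}(d(\mathbf{w},p))\setminus\big(\overline{\mathcal{J}_{\ell_p}}\vee\mathcal{SS}\big)(d(\mathbf{w},p)).$$
   Context: Scalars are $\mathbb{K}\in\{\mathbb{R},\mathbb{C}\}$. $\mathbb{W}$ is the set of all real sequences $\mathbf{w}=(w_n)_{n=1}^\infty\in c_0\setminus\ell_1$ with $1=w_1\geq w_2\geq w_3\geq\cdots>0$. For $1\leq p<\infty$ and $\mathbf{w}\in\mathbb{W}$, the Lorentz sequence space $d(\mathbf{w},p)$ is the space of all scalar sequences $(a_n)_{n=1}^\infty$ with $$\|(a_n)\|_{d(\mathbf{w},p)}:=\sup_{\pi}\Big(\sum_{n=1}^\infty|a_{\pi(n)}|^pw_n\Big)^{1/p}<\infty,$$ the supremum being over all permutations $\pi$ of $\mathbb{N}$; $(d_n)_{n=1}^\infty$ denotes its unit vector basis. Put $W_k:=\sum_{n=1}^kw_n$. The sequence $((d_i^{(k)})_{i=1}^{N_k})_{k=1}^\infty$ denotes the following successive normalized constant-coefficient blocks: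 with $M_0=0$ and $M_k=\sum_{m=1}^k mN_m$, $$d_i^{(k)}=\frac{1}{W_k^{1/p}}\sum_{n=M_{k-1}+(i-1)k+1}^{M_{k-1}+ik}d_n,\qquad 1\leq i\leq N_k,\ k\in\mathbb{N}.$$ A subspace is 1-complemented if it is the range of a linear projection of norm $1$. An isomorph of $Z$ is a space linearly homeomorphic to $Z$. For a Banach space $X$, $\mathcal{L}(X)$ is the algebra of bounded linear operators on $X$; $\mathcal{SS}(X)$ is the ideal of strictly singular operators on $X$ (those not bounded below on any infinite-dimensional closed subspace); $\mathcal{J}_{\ell_p}(X)$ is the ideal of operators $AB$ with $B\in\mathcal{L}(X,\ell_p)$, $A\in\mathcal{L}(\ell_p,X)$, and $\overline{\mathcal{J}_{\ell_p}}(X)$ is its norm closure; $\mathcal{S}_{d(\mathbf{w},p)}(X)$ is the set of operators in $\mathcal{L}(X)$ which fail to be bounded below on every subspace of $X$ isomorphic to $d(\mathbf{w},p)$. $(\overline{\mathcal{J}_{\ell_p}}\vee\mathcal{SS})(X)$ is the smallest closed ideal of $\mathcal{L}(X)$ containing both $\overline{\mathcal{J}_{\ell_p}}(X)$ and $\mathcal{SS}(X)$; equivalently, the norm closure of $\mathcal{J}_{\ell_p}(X)+\mathcal{SS}(X)$. *)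

theory Defs
  imports "HOL-Analysis.Analysis" "HOL-Library.Function_Algebras"
begin

text \<open>
  The scalar field is a type 'k of sort real_normed_field and heine_borel.  Both real and complex
  are instances, and by the Gelfand-Mazur theorem they are the only ones up to isometric
  isomorphism.

  Sequences have type nat => 'k and all indices start at 0, so that the object with subscript
  n + 1 in the usual one-based notation has index n here.  The vector space of all sequences
  carries the pointwise operations (addition from Function_Algebras).
\<close>

definition seq_scale :: "'k::field \<Rightarrow> (nat \<Rightarrow> 'k) \<Rightarrow> nat \<Rightarrow> 'k" where
  "seq_scale c a = (\<lambda>n. c * a n)"

global_interpretation seqs: vector_space "seq_scale :: 'k::field \<Rightarrow> _"
  by unfold_locales (auto simp: seq_scale_def fun_eq_iff algebra_simps)

text \<open>
  A normed space of sequences: a linear subspace of the space of all sequences together with a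
  norm, whose values off that subspace are irrelevant.
\<close>

record 'k seq_space =
  vecs :: "(nat \<Rightarrow> 'k) set"
  vnorm :: "(nat \<Rightarrow> 'k) \<Rightarrow> real"

definition restrict_to :: "'k seq_space \<Rightarrow> (nat \<Rightarrow> 'k) set \<Rightarrow> 'k seq_space" where
  "restrict_to X Z = X\<lparr>vecs := Z\<rparr>"

definition norm_closure :: "'k::real_normed_field seq_space \<Rightarrow> (nat \<Rightarrow> 'k) set \<Rightarrow> (nat \<Rightarrow> 'k) set" where
  "norm_closure X A = {x \<in> vecs X. \<forall>\<epsilon>>0. \<exists>a\<in>A. vnorm X (x - a) < \<epsilon>}"

definition linear_subspace :: "'k::real_normed_field seq_space \<Rightarrow> (nat \<Rightarrow> 'k) set \<Rightarrow> bool" where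
  "linear_subspace X Z \<longleftrightarrow> Z \<subseteq> vecs X \<and> seqs.subspace Z"

definition closed_subspace :: "'k::real_normed_field seq_space \<Rightarrow> (nat \<Rightarrow> 'k) set \<Rightarrow> bool" where
  "closed_subspace X Z \<longleftrightarrow> linear_subspace X Z \<and> norm_closure X Z = Z"

definition closed_span :: "'k::real_normed_field seq_space \<Rightarrow> (nat \<Rightarrow> 'k) set \<Rightarrow> (nat \<Rightarrow> 'k) set" where
  "closed_span X S = norm_closure X (seqs.span S)"

definition infinite_dim :: "(nat \<Rightarrow> 'k::real_normed_field) set \<Rightarrow> bool" where
  "infinite_dim Z \<longleftrightarrow> \<not> (\<exists>B. finite B \<and> Z \<subseteq> seqs.span B)"


text \<open>
  Bounded linear operators from X to Y.  An operator is represented by its extension by 0 to all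
  sequences; in this way equality, sums, scalar multiples and composites of operators are those of
  the representing functions.
\<close>

definition operators ::
    "'k::real_normed_field seq_space \<Rightarrow> 'k seq_space \<Rightarrow> ((nat \<Rightarrow> 'k) \<Rightarrow> (nat \<Rightarrow> 'k)) set" where
  "operators X Y = {T.
     (\<forall>x\<in>vecs X. T x \<in> vecs Y) \<and>
     (\<forall>x\<in>vecs X. \<forall>y\<in>vecs X. T (x + y) = T x + T y) \<and>
     (\<forall>c. \<forall>x\<in>vecs X. T (seq_scale c x) = seq_scale c (T x)) \<and>
     (\<exists>C. \<forall>x\<in>vecs X. vnorm Y (T x) \<le> C * vnorm X x) \<and>
     (\<forall>x. x \<notin> vecs X \<longrightarrow> T x = 0)}"

definition op_norm ::
    "'k::real_normed_field seq_space \<Rightarrow> 'k seq_space \<Rightarrow> ((nat \<Rightarrow> 'k) \<Rightarrow> (nat \<Rightarrow> 'k)) \<Rightarrow> real" where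
  "op_norm X Y T = (SUP x\<in>{x \<in> vecs X. vnorm X x \<le> 1}. vnorm Y (T x))"

definition isomorphic_spaces :: "'k::real_normed_field seq_space \<Rightarrow> 'k seq_space \<Rightarrow> bool" where
  "isomorphic_spaces X Y \<longleftrightarrow>
     (\<exists>T\<in>operators X Y. \<exists>S\<in>operators Y X.
        (\<forall>x\<in>vecs X. S (T x) = x) \<and> (\<forall>y\<in>vecs Y. T (S y) = y))"

definition contains_isomorph ::
    "'k::real_normed_field seq_space \<Rightarrow> 'k seq_space \<Rightarrow> bool" where
  "contains_isomorph X Z \<longleftrightarrow>
     (\<exists>U. linear_subspace X U \<and> isomorphic_spaces (restrict_to X U) Z)"

definition projection_onto ::
    "'k::real_normed_field seq_space \<Rightarrow> (nat \<Rightarrow> 'k) set \<Rightarrow> ((nat \<Rightarrow> 'k) \<Rightarrow> (nat \<Rightarrow> 'k)) \<Rightarrow> bool" where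
  "projection_onto X Z P \<longleftrightarrow> P \<in> operators X X \<and> P \<circ> P = P \<and> P ` vecs X = Z"

definition one_complemented :: "'k::real_normed_field seq_space \<Rightarrow> (nat \<Rightarrow> 'k) set \<Rightarrow> bool" where
  "one_complemented X Z \<longleftrightarrow> (\<exists>P. projection_onto X Z P \<and> op_norm X X P = 1)"

definition bounded_below_on ::
    "'k::real_normed_field seq_space \<Rightarrow> 'k seq_space \<Rightarrow> ((nat \<Rightarrow> 'k) \<Rightarrow> (nat \<Rightarrow> 'k))
      \<Rightarrow> (nat \<Rightarrow> 'k) set \<Rightarrow> bool" where
  "bounded_below_on X Y T Z \<longleftrightarrow> (\<exists>c>0. \<forall>z\<in>Z. c * vnorm X z \<le> vnorm Y (T z))"


definition strictly_singular ::
    "'k::real_normed_field seq_space \<Rightarrow> ((nat \<Rightarrow> 'k) \<Rightarrow> (nat \<Rightarrow> 'k)) set" where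
  "strictly_singular X = {T \<in> operators X X.
     \<not> (\<exists>Z. closed_subspace X Z \<and> infinite_dim Z \<and> bounded_below_on X X T Z)}"

text \<open>The operators on X that are not bounded below on any isomorph of D.\<close>

definition singular_for ::
    "'k::real_normed_field seq_space \<Rightarrow> 'k seq_space \<Rightarrow> ((nat \<Rightarrow> 'k) \<Rightarrow> (nat \<Rightarrow> 'k)) set" where
  "singular_for D X = {T \<in> operators X X.
     \<not> (\<exists>Z. linear_subspace X Z \<and> isomorphic_spaces (restrict_to X Z) D \<and>
            bounded_below_on X X T Z)}"

definition factoring_through ::
    "'k::real_normed_field seq_space \<Rightarrow> 'k seq_space \<Rightarrow> ((nat \<Rightarrow> 'k) \<Rightarrow> (nat \<Rightarrow> 'k)) set" where
  "factoring_through E X = {A \<circ> B |A B. A \<in> operators E X \<and> B \<in> operators X E}"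

definition op_closure ::
    "'k::real_normed_field seq_space \<Rightarrow> ((nat \<Rightarrow> 'k) \<Rightarrow> (nat \<Rightarrow> 'k)) set
      \<Rightarrow> ((nat \<Rightarrow> 'k) \<Rightarrow> (nat \<Rightarrow> 'k)) set" where
  "op_closure X I = {T \<in> operators X X. \<forall>\<epsilon>>0. \<exists>S\<in>I. op_norm X X (T - S) < \<epsilon>}"

definition operator_ideal ::
    "'k::real_normed_field seq_space \<Rightarrow> ((nat \<Rightarrow> 'k) \<Rightarrow> (nat \<Rightarrow> 'k)) set \<Rightarrow> bool" where
  "operator_ideal X I \<longleftrightarrow>
     I \<subseteq> operators X X \<and> 0 \<in> I \<and>
     (\<forall>S\<in>I. \<forall>T\<in>I. S + T \<in> I) \<and>
     (\<forall>c. \<forall>T\<in>I. (\<lambda>x. seq_scale c (T x)) \<in> I) \<and>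
     (\<forall>A\<in>operators X X. \<forall>T\<in>I. A \<circ> T \<in> I \<and> T \<circ> A \<in> I)"

definition closed_operator_ideal ::
    "'k::real_normed_field seq_space \<Rightarrow> ((nat \<Rightarrow> 'k) \<Rightarrow> (nat \<Rightarrow> 'k)) set \<Rightarrow> bool" where
  "closed_operator_ideal X I \<longleftrightarrow> operator_ideal X I \<and> op_closure X I = I"

definition closed_ideal_join ::
    "'k::real_normed_field seq_space \<Rightarrow> ((nat \<Rightarrow> 'k) \<Rightarrow> (nat \<Rightarrow> 'k)) set
      \<Rightarrow> ((nat \<Rightarrow> 'k) \<Rightarrow> (nat \<Rightarrow> 'k)) set \<Rightarrow> ((nat \<Rightarrow> 'k) \<Rightarrow> (nat \<Rightarrow> 'k)) set" where
  "closed_ideal_join X I J = \<Inter> {K. closed_operator_ideal X K \<and> I \<subseteq> K \<and> J \<subseteq> K}"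


definition lp_space :: "real \<Rightarrow> 'k::real_normed_field seq_space" where
  "lp_space p = \<lparr>
     vecs = {a. summable (\<lambda>n. norm (a n) powr p)},
     vnorm = (\<lambda>a. (\<Sum>n. norm (a n) powr p) powr (1 / p))\<rparr>"

definition lorentz_weights :: "(nat \<Rightarrow> real) set" where
  "lorentz_weights = {w. w 0 = 1 \<and> decseq w \<and> (\<forall>n. 0 < w n) \<and> w \<longlonglongrightarrow> 0 \<and> \<not> summable w}"

text \<open>
  Finiteness of the supremum over all permutations amounts to summability for every permutation
  together with boundedness of the resulting family of sums.
\<close>

definition lorentz_space :: "(nat \<Rightarrow> real) \<Rightarrow> real \<Rightarrow> 'k::real_normed_field seq_space" where
  "lorentz_space w p = \<lparr>
     vecs = {a. (\<forall>\<pi>. bij \<pi> \<longrightarrow> summable (\<lambda>n. norm (a (\<pi> n)) powr p * w n)) \<and>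
                bdd_above ((\<lambda>\<pi>. (\<Sum>n. norm (a (\<pi> n)) powr p * w n) powr (1 / p)) ` {\<pi>. bij \<pi>})},
     vnorm = (\<lambda>a. SUP \<pi>\<in>{\<pi>. bij \<pi>}. (\<Sum>n. norm (a (\<pi> n)) powr p * w n) powr (1 / p))\<rparr>"

definition unit_seq :: "nat \<Rightarrow> nat \<Rightarrow> 'k::real_normed_field" where
  "unit_seq n = (\<lambda>m. if m = n then 1 else 0)"

definition weight_sum :: "(nat \<Rightarrow> real) \<Rightarrow> nat \<Rightarrow> real" where
  "weight_sum w k = (\<Sum>n<k. w n)"

text \<open>
  The k-th family consists of N k blocks of length Suc k (k and the block number i both starting
  at 0), and block_start N k is the total length of the preceding families.
\<close>

definition block_start :: "(nat \<Rightarrow> nat) \<Rightarrow> nat \<Rightarrow> nat" where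
  "block_start N k = (\<Sum>m<k. Suc m * N m)"

definition lorentz_block ::
    "(nat \<Rightarrow> real) \<Rightarrow> real \<Rightarrow> (nat \<Rightarrow> nat) \<Rightarrow> nat \<Rightarrow> nat \<Rightarrow> nat \<Rightarrow> 'k::real_normed_field" where
  "lorentz_block w p N k i =
     seq_scale (of_real (1 / weight_sum w (Suc k) powr (1 / p)))
       (\<Sum>n\<in>{block_start N k + i * Suc k ..< block_start N k + Suc i * Suc k}. unit_seq n)"

definition block_span ::
    "(nat \<Rightarrow> real) \<Rightarrow> real \<Rightarrow> (nat \<Rightarrow> nat) \<Rightarrow> (nat \<Rightarrow> 'k::real_normed_field) set" where
  "block_span w p N = closed_span (lorentz_space w p) {lorentz_block w p N k i |k i. i < N k}"

end

theory Submission
  imports Defs "HOL-Complex_Analysis.Great_Picard"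
begin

text \<open>
  Let Y be the closed span of the blocks. If P were bounded below on a copy of the Lorentz space,
  it would carry that copy isomorphically into Y, which is excluded by hypothesis; this is
  \<open>projection_singular_for\<close>. The substance of the theorem is that P lies outside the closed ideal
  generated by the operators that factor through l_p and the strictly singular operators.

  The idea is to look at diagonals. Write y_j for the blocks in their natural order. An operator S
  on Y has diagonal entries given by the j-th coefficient of S y_j, and the identity has constant
  diagonal 1. Let D be the set of sequences s for which the multiplier y_j \<mapsto> s_j y_j factors
  through l_p. Compress an operator on the whole space to Y, with arbitrary operators multiplied in
  from both sides, and ask that its diagonal be a uniform limit of members of D. The operators that
  pass form a closed ideal (\<open>diagonal_ideal\<close>). It contains both kinds of generators, so it is enough
  that P does not pass. If it did, some s in D would satisfy |1 - s_j| \<le> 1/2 for all j; dividing by s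
  shows that the identity of Y factors through l_p, that is, Y is isomorphic to a complemented
  subspace of l_p. Conversely Y contains a complemented copy of l_p, and Pelczynski's decomposition
  method (\<open>decomposition_method\<close>) makes Y isomorphic to l_p, which is excluded by hypothesis.

  Everything rests on one fact about Y (\<open>block_sum_block_gauge\<close>): if the y_j are cut into finite
  consecutive groups whose lengths grow fast enough, then Y is the l_p-sum of the spans of the
  groups, up to a constant. The upper estimate holds in any Lorentz space. For the lower estimate,
  the entries of a vector supported in a late group are constant on long intervals; pushing them back
  behind the supports of the earlier groups costs at most a fixed fraction of the norm.

  The diagonal of an operator A B that factors through l_p belongs to D (\<open>diagonal_factors\<close>): averaging
  A B over changes of sign of the y_j in a finite group kills the entries of the group off the
  diagonal, and averages of operators that factor through l_p factor through l_p with the same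
  constants because the l_p-sum of two copies of l_p is l_p. The groups are then put side by side.

  The diagonal of a strictly singular operator tends to 0, and null sequences are uniform limits of
  finitely supported ones, which belong to D. Indeed, if the diagonal stays away from 0 on a sequence
  of indices, a sparse subsequence of the y_j is equivalent to the basis of l_p, and on the span of
  the differences of its consecutive members the operator is, up to a small perturbation, bounded
  below (\<open>bounded_below_subspace\<close>). Differences are needed only because for p = 1 the rows of the matrix
  of the operator need not tend to 0; they converge after passing to a subsequence.
\<close>

section \<open>Normed sequence spaces given by gauges\<close>

text \<open>
  All norms below have the form F(|x|^p)^(1/p). Letting F act on sequences of extended nonnegative
  reals removes every question of convergence: the vectors are the sequences where F is finite, and
  F turns estimates for infinite sums into finite algebra.
\<close>

definition pw :: "real \<Rightarrow> (nat \<Rightarrow> 'k::real_normed_field) \<Rightarrow> nat \<Rightarrow> ennreal" where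
  "pw p x = (\<lambda>n. ennreal (norm (x n) powr p))"

definition gauge_space :: "real \<Rightarrow> ((nat \<Rightarrow> ennreal) \<Rightarrow> ennreal) \<Rightarrow> 'k::real_normed_field seq_space" where
  "gauge_space p F = \<lparr>vecs = {x. F (pw p x) < top}, vnorm = (\<lambda>x. enn2real (F (pw p x)) powr (1 / p))\<rparr>"

text \<open>
  Countable subadditivity replaces completeness: it bounds vectors that are given as infinite sums
  of disjointly supported pieces.
\<close>

locale gauge =
  fixes F :: "(nat \<Rightarrow> ennreal) \<Rightarrow> ennreal"
  assumes mono: "\<And>a b. (\<And>n. a n \<le> b n) \<Longrightarrow> F a \<le> F b"
    and countably_subadditive: "\<And>a. F (\<lambda>n. \<Sum>m. a m n) \<le> (\<Sum>m. F (a m))"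
    and scale: "\<And>c a. F (\<lambda>n. c * a n) \<le> c * F a"
    and coordinate_le: "\<And>a n. a n \<le> F a"
begin

lemma zero [simp]: "F (\<lambda>n. 0) = 0"
  using scale[of 0 "\<lambda>n. 0"] by simp

lemma subadditive: "F (\<lambda>n. a n + b n) \<le> F a + F b"
proof -
  define c where "c m = (if m = 0 then a else if m = Suc 0 then b else (\<lambda>n. 0))" for m
  have "(\<Sum>m. c m n) = a n + b n" for n
    by (subst suminf_finite[of "{0, Suc 0}"]) (auto simp: c_def)
  moreover have "(\<Sum>m. F (c m)) = F a + F b"
    by (subst suminf_finite[of "{0, Suc 0}"]) (auto simp: c_def)
  ultimately show ?thesis
    using countably_subadditive[of c] by simp
qed

end

lemma le_powr_iff: "a \<le> b powr p \<longleftrightarrow> a powr (1 / p) \<le> b" if "0 \<le> a" "0 \<le> b" "1 \<le> p" for a b p :: real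
proof -
  have "(a powr (1/p)) powr p = a" "(b powr p) powr (1/p) = b"
    using that by (auto simp: powr_powr)
  then show ?thesis
    using that powr_mono2[of p "a powr (1/p)" b] powr_mono2[of "1/p" a "b powr p"] by auto
qed

text \<open>
  Convexity of the power function, written so that s and t can be the norms of the two summands;
  it yields Minkowski's inequality for every gauge at once.
\<close>

lemma powr_add_le:
  fixes u v s t p :: real
  assumes "1 \<le> p" "0 \<le> u" "0 \<le> v" "0 < s" "0 < t"
  shows "(u + v) powr p \<le> (s + t) powr (p - 1) * (s powr (1 - p) * u powr p + t powr (1 - p) * v powr p)"
proof -
  have conv: "convex_on {0..} (\<lambda>x::real. x powr p)"
  proof (rule convex_onI)
    fix r x y :: real assume r: "0 < r" "r < 1" and xy: "x \<in> {0..}" "y \<in> {0..}"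
    have small: "(c * z) powr p \<le> c * z powr p" if "0 < c" "c < 1" "0 \<le> z" for c z :: real
    proof -
      have "c powr p \<le> c powr 1" using that assms(1) by (intro powr_mono') auto
      then show ?thesis using that by (simp add: powr_mult mult_right_mono)
    qed
    show "((1 - r) *\<^sub>R x + r *\<^sub>R y) powr p \<le> (1 - r) * x powr p + r * y powr p"
    proof (cases "x = 0 \<or> y = 0")
      case True
      then show ?thesis using small[of r y] small[of "1-r" x] r xy assms(1) by auto
    next
      case False
      then show ?thesis
        using convex_onD[OF powr_convex[OF assms(1)], of r x y] r xy by auto
    qed
  qed auto
  define r where "r = t / (s + t)"
  have r: "0 \<le> r" "r \<le> 1" "1 - r = s / (s + t)" using assms by (auto simp: r_def field_simps)
  have eq: "(1 - r) * (u / s) + r * (v / t) = (u + v) / (s + t)"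
  proof -
    have "(1 - r) * (u / s) = u / (s + t)" "r * (v / t) = v / (s + t)"
      unfolding r(3) using assms by (auto simp: r_def)
    then show ?thesis by (simp add: add_divide_distrib)
  qed
  have "((u + v) / (s + t)) powr p \<le> s / (s + t) * (u / s) powr p + t / (s + t) * (v / t) powr p"
    using convex_onD[OF conv, of r "u/s" "v/t"] r assms eq
    by (auto simp: r_def)
  then have "(s + t) powr p * ((u + v) / (s + t)) powr p
     \<le> (s + t) powr p * (s / (s + t) * (u / s) powr p + t / (s + t) * (v / t) powr p)"
    by (intro mult_left_mono) auto
  moreover have "(s + t) powr p * ((u + v) / (s + t)) powr p = (u + v) powr p"
    using assms by (subst powr_mult[symmetric]) auto
  moreover have "(s + t) powr p * (s / (s + t) * (u / s) powr p) = (s + t) powr (p - 1) * (s powr (1 - p) * u powr p)"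
    "(s + t) powr p * (t / (s + t) * (v / t) powr p) = (s + t) powr (p - 1) * (t powr (1 - p) * v powr p)"
    using assms by (simp_all add: powr_diff powr_divide)
  ultimately show ?thesis by (simp add: distrib_left)
qed

locale gauge_p = gauge +
  fixes p :: real
  assumes p1: "1 \<le> p"
begin

abbreviation G :: "'k::real_normed_field seq_space" where "G \<equiv> gauge_space p F"

lemma vecs_iff: "x \<in> vecs G \<longleftrightarrow> F (pw p x) < top"
  by (simp add: gauge_space_def)

lemma vnorm_nonneg [simp]: "0 \<le> vnorm G x"
  by (simp add: gauge_space_def)

lemma vnorm_powr: "x \<in> vecs G \<Longrightarrow> ennreal (vnorm G x powr p) = F (pw p x)"
  using p1 by (simp add: gauge_space_def powr_powr)

lemma vnorm_le_iff:
  assumes "0 \<le> t"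
  shows "F (pw p x) \<le> ennreal (t powr p) \<longleftrightarrow> x \<in> vecs G \<and> vnorm G x \<le> t"
proof
  assume le: "F (pw p x) \<le> ennreal (t powr p)"
  then have x: "x \<in> vecs G" unfolding vecs_iff by (rule le_less_trans) simp
  then have "vnorm G x powr p \<le> t powr p"
    using le vnorm_powr[OF x] by (metis ennreal_le_iff powr_ge_zero)
  then show "x \<in> vecs G \<and> vnorm G x \<le> t"
    using x assms p1 le_powr_iff[of "vnorm G x powr p" t p] by (auto simp: powr_powr)
next
  assume "x \<in> vecs G \<and> vnorm G x \<le> t"
  then show "F (pw p x) \<le> ennreal (t powr p)"
    using vnorm_powr[of x] p1 by (metis ennreal_leI powr_mono2 vnorm_nonneg le_numeral_extra(3) order.trans zero_le_one)
qed

lemma norm_coordinate_le: "x \<in> vecs G \<Longrightarrow> norm (x n) \<le> vnorm G x"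
proof -
  assume x: "x \<in> vecs G"
  have "ennreal (norm (x n) powr p) \<le> F (pw p x)"
    using coordinate_le[of "pw p x" n] by (simp add: pw_def)
  then have "norm (x n) powr p \<le> vnorm G x powr p"
    by (simp flip: vnorm_powr[OF x])
  then show ?thesis using p1 by (simp add: le_powr_iff powr_powr)
qed

lemma vnorm_mono:
  assumes "y \<in> vecs G" "\<And>n. norm (x n) \<le> norm (y n)"
  shows "x \<in> vecs G" "vnorm G x \<le> vnorm G y"
proof -
  have "F (pw p x) \<le> F (pw p y)"
    unfolding pw_def using assms(2) p1 by (intro mono ennreal_leI powr_mono2) auto
  then have "F (pw p x) \<le> ennreal (vnorm G y powr p)" by (simp add: vnorm_powr assms)
  then show "x \<in> vecs G" "vnorm G x \<le> vnorm G y"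
    using vnorm_le_iff[of "vnorm G y" x] by auto
qed

lemma vnorm_scale:
  assumes "x \<in> vecs G"
  shows "seq_scale c x \<in> vecs G" "vnorm G (seq_scale c x) \<le> norm c * vnorm G x"
proof -
  have "F (pw p (seq_scale c x)) = F (\<lambda>n. ennreal (norm c powr p) * pw p x n)"
    by (simp add: pw_def seq_scale_def norm_mult powr_mult ennreal_mult)
  also have "\<dots> \<le> ennreal (norm c powr p) * ennreal (vnorm G x powr p)"
    using scale vnorm_powr[OF assms] by metis
  also have "\<dots> = ennreal ((norm c * vnorm G x) powr p)"
    by (simp add: powr_mult ennreal_mult)
  finally show "seq_scale c x \<in> vecs G" "vnorm G (seq_scale c x) \<le> norm c * vnorm G x"
    using vnorm_le_iff[of "norm c * vnorm G x" "seq_scale c x"] by auto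
qed

lemma vnorm_zero [simp]: "(0 :: nat \<Rightarrow> 'k::real_normed_field) \<in> vecs G" "vnorm G (0 :: nat \<Rightarrow> 'k) = 0"
  using p1 by (auto simp: gauge_space_def pw_def)

lemma vnorm_eq_0_imp: "x \<in> vecs G \<Longrightarrow> vnorm G x = 0 \<Longrightarrow> x = 0"
  using norm_coordinate_le[of x] by (auto simp: fun_eq_iff)

lemma vnorm_triangle:
  assumes x: "x \<in> vecs G" and y: "y \<in> vecs G"
  shows "x + y \<in> vecs G" "vnorm G (x + y) \<le> vnorm G x + vnorm G y"
proof -
  define s t where "s = vnorm G x" and "t = vnorm G y"
  have "x + y \<in> vecs G \<and> vnorm G (x + y) \<le> vnorm G x + vnorm G y"
  proof (cases "s = 0 \<or> t = 0")
    case True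
    then have "x = 0 \<or> y = 0" using vnorm_eq_0_imp x y by (auto simp: s_def t_def)
    then show ?thesis using x y by auto
  next
    case False
    then have st: "0 < s" "0 < t" by (auto simp: s_def t_def less_le)
    define A B where "A = (s + t) powr (p - 1) * s powr (1 - p)" and "B = (s + t) powr (p - 1) * t powr (1 - p)"
    have AB: "0 \<le> A" "0 \<le> B" by (auto simp: A_def B_def)
    \<comment> \<open>A and B are chosen so that the bounds for x and y add up to (s + t)^p.\<close>
    have pt: "pw p (x + y) n \<le> ennreal A * pw p x n + ennreal B * pw p y n" for n
    proof -
      have "norm (x n + y n) powr p \<le> (norm (x n) + norm (y n)) powr p"
        using p1 by (intro powr_mono2) (auto intro: norm_triangle_ineq)
      also have "\<dots> \<le> A * norm (x n) powr p + B * norm (y n) powr p"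
        using powr_add_le[OF p1 _ _ st, of "norm (x n)" "norm (y n)"]
        by (simp add: A_def B_def algebra_simps)
      finally show ?thesis using AB
        by (simp add: pw_def ennreal_leI flip: ennreal_mult ennreal_plus)
    qed
    have "F (pw p (x + y)) \<le> F (\<lambda>n. ennreal A * pw p x n + ennreal B * pw p y n)"
      using pt by (rule mono)
    also have "\<dots> \<le> ennreal A * F (pw p x) + ennreal B * F (pw p y)"
      by (rule order_trans[OF subadditive]) (intro add_mono scale)
    also have "\<dots> = ennreal A * ennreal (s powr p) + ennreal B * ennreal (t powr p)"
      by (simp add: s_def t_def vnorm_powr x y)
    also have "\<dots> = ennreal (A * s powr p + B * t powr p)"
      using AB by (simp add: ennreal_mult)
    also have "A * s powr p + B * t powr p = (s + t) powr p"
    proof -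
      have "A * s powr p = (s + t) powr (p - 1) * s" "B * t powr p = (s + t) powr (p - 1) * t"
        using st by (auto simp: A_def B_def simp flip: powr_add)
      then show ?thesis using st by (simp add: powr_diff flip: add_divide_distrib distrib_left)
    qed
    finally have "F (pw p (x + y)) \<le> ennreal ((s + t) powr p)" .
    from iffD1[OF vnorm_le_iff this] st show ?thesis by (simp add: s_def t_def)
  qed
  then show "x + y \<in> vecs G" "vnorm G (x + y) \<le> vnorm G x + vnorm G y" by auto
qed

end

text \<open>
  Homogeneity is required only as an inequality; the reverse inequality follows by scaling back.
  Continuity of the coordinates makes the seminorm a norm.
\<close>

locale normed_sequences =
  fixes X :: "'k::real_normed_field seq_space"
  assumes vecs_zero: "0 \<in> vecs X"
    and vecs_add: "\<And>x y. x \<in> vecs X \<Longrightarrow> y \<in> vecs X \<Longrightarrow> x + y \<in> vecs X"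
    and vecs_scale: "\<And>c x. x \<in> vecs X \<Longrightarrow> seq_scale c x \<in> vecs X"
    and norm_add: "\<And>x y. x \<in> vecs X \<Longrightarrow> y \<in> vecs X \<Longrightarrow> vnorm X (x + y) \<le> vnorm X x + vnorm X y"
    and norm_scale: "\<And>c x. x \<in> vecs X \<Longrightarrow> vnorm X (seq_scale c x) \<le> norm c * vnorm X x"
    and coordinate: "\<And>x n. x \<in> vecs X \<Longrightarrow> norm (x n) \<le> vnorm X x"
begin

lemma norm_nonneg: "x \<in> vecs X \<Longrightarrow> 0 \<le> vnorm X x"
  using coordinate[of x 0] norm_ge_zero order_trans by blast

lemma norm_zero: "vnorm X 0 = 0"
  using norm_scale[OF vecs_zero, of 0] norm_nonneg[OF vecs_zero] by (simp add: seq_scale_def zero_fun_def)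

lemma norm_eq_0: "x \<in> vecs X \<Longrightarrow> vnorm X x \<le> 0 \<Longrightarrow> x = 0"
proof
  fix n assume "x \<in> vecs X" "vnorm X x \<le> 0"
  then have "norm (x n) \<le> 0" using coordinate[of x n] by linarith
  then show "x n = 0 n" by simp
qed

lemma scale_minus: "seq_scale (-1) x = - x"
  by (simp add: seq_scale_def fun_eq_iff)

lemma vecs_diff: "x \<in> vecs X \<Longrightarrow> y \<in> vecs X \<Longrightarrow> x - y \<in> vecs X"
  using vecs_add[of x "- y"] vecs_scale[of y "-1"] by (simp add: scale_minus)

lemma norm_diff: "x \<in> vecs X \<Longrightarrow> y \<in> vecs X \<Longrightarrow> vnorm X (x - y) \<le> vnorm X x + vnorm X y"
  using norm_add[of x "- y"] vecs_scale[of y "-1"] norm_scale[of y "-1"] by (simp add: scale_minus)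

lemma subspace: "seqs.subspace (vecs X)"
  unfolding seqs.subspace_def using vecs_zero vecs_add vecs_scale by auto

lemma vecs_sum: "(\<And>i. i \<in> I \<Longrightarrow> f i \<in> vecs X) \<Longrightarrow> sum f I \<in> vecs X"
  using seqs.subspace_sum[OF subspace] by blast

end

text \<open>
  The values of a norm off its vectors carry no information, so spaces are compared on their vectors.
  Operators between the spaces depend on nothing else.
\<close>

definition same_space :: "'k::real_normed_field seq_space \<Rightarrow> 'k seq_space \<Rightarrow> bool" where
  "same_space X X' \<longleftrightarrow> vecs X = vecs X' \<and> (\<forall>x\<in>vecs X. vnorm X x = vnorm X' x)"

lemma same_space_normed_sequences: "normed_sequences X" if "same_space X X'" "normed_sequences X'"
  using that unfolding same_space_def normed_sequences_def by auto

lemma operators_bound: "T \<in> operators X Y \<Longrightarrow> \<exists>C. \<forall>x\<in>vecs X. vnorm Y (T x) \<le> C * vnorm X x"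
  by (simp add: operators_def)

lemma same_space_operators: "operators X Y = operators X' Y'" if "same_space X X'" "same_space Y Y'"
proof -
  have "operators X Y \<subseteq> operators X' Y'" if "same_space X X'" "same_space Y Y'" for X X' Y Y' :: "'a seq_space"
  proof
    fix T assume T: "T \<in> operators X Y"
    then obtain C where "\<forall>x\<in>vecs X. vnorm Y (T x) \<le> C * vnorm X x" using operators_bound by blast
    then show "T \<in> operators X' Y'" using that T
      unfolding same_space_def operators_def by (intro CollectI conjI exI[of _ C]) simp_all
  qed
  moreover have "same_space X' X" "same_space Y' Y"
    using that by (auto simp: same_space_def)
  ultimately show ?thesis using that by blast
qed

sublocale gauge_p \<subseteq> normed_sequences "gauge_space p F :: 'k::real_normed_field seq_space"
  by unfold_locales (auto intro: vnorm_triangle vnorm_scale norm_coordinate_le)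

subsection \<open>Bounded linear maps\<close>

text \<open>
  In contrast to members of \<^const>\<open>operators\<close>, these maps may take any values off the domain, so
  that they can be composed and restricted freely; \<open>extend_by_zero\<close> leads back to operators.
\<close>

definition bounded_map ::
    "'k::real_normed_field seq_space \<Rightarrow> 'k seq_space \<Rightarrow> real \<Rightarrow> ((nat \<Rightarrow> 'k) \<Rightarrow> (nat \<Rightarrow> 'k)) \<Rightarrow> bool" where
  "bounded_map X Y C T \<longleftrightarrow> 0 \<le> C \<and>
     (\<forall>x\<in>vecs X. T x \<in> vecs Y \<and> vnorm Y (T x) \<le> C * vnorm X x) \<and>
     (\<forall>x\<in>vecs X. \<forall>y\<in>vecs X. T (x + y) = T x + T y) \<and>
     (\<forall>c. \<forall>x\<in>vecs X. T (seq_scale c x) = seq_scale c (T x))"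

lemma bounded_mapI:
  assumes "0 \<le> C" "\<And>x. x \<in> vecs X \<Longrightarrow> T x \<in> vecs Y \<and> vnorm Y (T x) \<le> C * vnorm X x"
    "\<And>x y. x \<in> vecs X \<Longrightarrow> y \<in> vecs X \<Longrightarrow> T (x + y) = T x + T y"
    "\<And>c x. x \<in> vecs X \<Longrightarrow> T (seq_scale c x) = seq_scale c (T x)"
  shows "bounded_map X Y C T"
  using assms by (auto simp: bounded_map_def)

lemma
  assumes "bounded_map X Y C T"
  shows bounded_map_nonneg: "0 \<le> C"
    and bounded_map_vecs: "x \<in> vecs X \<Longrightarrow> T x \<in> vecs Y"
    and bounded_map_norm: "x \<in> vecs X \<Longrightarrow> vnorm Y (T x) \<le> C * vnorm X x"
    and bounded_map_add: "x \<in> vecs X \<Longrightarrow> y \<in> vecs X \<Longrightarrow> T (x + y) = T x + T y"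
    and bounded_map_scale: "x \<in> vecs X \<Longrightarrow> T (seq_scale c x) = seq_scale c (T x)"
  using assms by (auto simp: bounded_map_def)

lemma bounded_map_compose:
  assumes T: "bounded_map X Y C T" and S: "bounded_map Y Z D S"
  shows "bounded_map X Z (D * C) (\<lambda>x. S (T x))"
proof (rule bounded_mapI)
  show "0 \<le> D * C" using T S by (simp add: bounded_map_nonneg)
next
  fix x assume x: "x \<in> vecs X"
  have "vnorm Z (S (T x)) \<le> D * vnorm Y (T x)"
    using bounded_map_norm[OF S] bounded_map_vecs[OF T x] by blast
  also have "\<dots> \<le> D * (C * vnorm X x)"
    using bounded_map_norm[OF T x] bounded_map_nonneg[OF S] by (rule mult_left_mono)
  finally show "S (T x) \<in> vecs Z \<and> vnorm Z (S (T x)) \<le> D * C * vnorm X x"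
    using bounded_map_vecs[OF S bounded_map_vecs[OF T x]] by (simp add: mult.assoc)
qed (use T S in \<open>simp_all add: bounded_map_def\<close>)

context
  fixes X Y :: "'k::real_normed_field seq_space" and C T
  assumes X: "normed_sequences X" and T: "bounded_map X Y C T"
begin

interpretation X: normed_sequences X by (rule X)

lemma bounded_map_zero: "T 0 = 0"
  using bounded_map_scale[OF T X.vecs_zero, of 0] by (simp add: seq_scale_def zero_fun_def)

lemma bounded_map_diff: "x \<in> vecs X \<Longrightarrow> y \<in> vecs X \<Longrightarrow> T (x - y) = T x - T y"
  using bounded_map_add[OF T X.vecs_diff, of x y y] by simp

lemma bounded_map_sum:
  "finite I \<Longrightarrow> (\<And>i. i \<in> I \<Longrightarrow> f i \<in> vecs X) \<Longrightarrow> T (sum f I) = (\<Sum>i\<in>I. T (f i))"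
proof (induction I rule: finite_induct)
  case (insert i I)
  then have "T (f i + sum f I) = T (f i) + T (sum f I)"
    using X.vecs_sum[of I f] by (intro bounded_map_add[OF T]) auto
  moreover have "T (sum f I) = (\<Sum>i\<in>I. T (f i))" using insert by auto
  ultimately show ?case unfolding sum.insert[OF insert(1,2)] by (metis (no_types))
qed (simp add: bounded_map_zero)

lemma bounded_map_subspace: "seqs.subspace H \<Longrightarrow> H \<subseteq> vecs X \<Longrightarrow> seqs.subspace (T ` H)"
proof -
  assume H: "seqs.subspace H" "H \<subseteq> vecs X"
  show "seqs.subspace (T ` H)"
    unfolding seqs.subspace_def
  proof (intro conjI ballI allI)
    show "0 \<in> T ` H" by (rule image_eqI[where x = 0]) (rule bounded_map_zero[symmetric], rule seqs.subspace_0[OF H(1)])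
  next
    fix x y assume "x \<in> T ` H" "y \<in> T ` H"
    then obtain u v where uv: "u \<in> H" "v \<in> H" "x = T u" "y = T v" by blast
    then have "T (u + v) = T u + T v" using H(2) by (intro bounded_map_add[OF T]) auto
    then show "x + y \<in> T ` H"
      unfolding uv(3,4) using seqs.subspace_add[OF H(1) uv(1,2)] by (metis (no_types) imageI)
  next
    fix c x assume "x \<in> T ` H"
    then obtain u where u: "u \<in> H" "x = T u" by blast
    then have "T (seq_scale c u) = seq_scale c (T u)" using H(2) by (intro bounded_map_scale[OF T]) auto
    then show "seq_scale c x \<in> T ` H"
      unfolding u(2) using seqs.subspace_scale[OF H(1) u(1)] by (metis (no_types) imageI)
  qed
qed

end

lemma operators_bounded_map:
  assumes "T \<in> operators X Y" "normed_sequences X"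
  obtains C where "bounded_map X Y C T"
proof -
  interpret X: normed_sequences X by fact
  obtain C where C: "\<And>x. x \<in> vecs X \<Longrightarrow> vnorm Y (T x) \<le> C * vnorm X x"
    using operators_bound[OF assms(1)] by blast
  have "bounded_map X Y (max C 0) T"
  proof (rule bounded_mapI)
    fix x assume x: "x \<in> vecs X"
    have "C * vnorm X x \<le> max C 0 * vnorm X x"
      using X.norm_nonneg[OF x] by (intro mult_right_mono) auto
    then show "T x \<in> vecs Y \<and> vnorm Y (T x) \<le> max C 0 * vnorm X x"
      using C[OF x] assms(1) x by (simp add: operators_def)
  qed (use assms in \<open>simp_all add: operators_def\<close>)
  then show ?thesis by (rule that)
qed

definition extend_by_zero ::
    "'k::real_normed_field seq_space \<Rightarrow> ((nat \<Rightarrow> 'k) \<Rightarrow> (nat \<Rightarrow> 'k)) \<Rightarrow> (nat \<Rightarrow> 'k) \<Rightarrow> (nat \<Rightarrow> 'k)" where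
  "extend_by_zero X T = (\<lambda>x. if x \<in> vecs X then T x else 0)"

lemma extend_by_zero_operators:
  "extend_by_zero X T \<in> operators X Y" if "bounded_map X Y C T" "normed_sequences X"
proof -
  interpret X: normed_sequences X by fact
  show ?thesis
    unfolding operators_def extend_by_zero_def
    using that(1) X.vecs_add X.vecs_scale
    unfolding bounded_map_def by (intro CollectI conjI exI[of _ C]) simp_all
qed

lemma operators_if_bounded_map:
  "T \<in> operators X Y" if "bounded_map X Y C T" "\<And>x. x \<notin> vecs X \<Longrightarrow> T x = 0"
  using that unfolding operators_def bounded_map_def by (intro CollectI conjI exI[of _ C]) simp_all

lemma isomorphic_spacesI:
  assumes "normed_sequences X" "normed_sequences Y" "bounded_map X Y C T" "bounded_map Y X D S"
    "\<And>x. x \<in> vecs X \<Longrightarrow> S (T x) = x" "\<And>y. y \<in> vecs Y \<Longrightarrow> T (S y) = y"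
  shows "isomorphic_spaces X Y"
proof -
  have "extend_by_zero X T \<in> operators X Y" "extend_by_zero Y S \<in> operators Y X"
    by (rule extend_by_zero_operators[OF assms(3) assms(1)], rule extend_by_zero_operators[OF assms(4) assms(2)])
  moreover have "\<forall>x\<in>vecs X. extend_by_zero Y S (extend_by_zero X T x) = x"
  proof
    fix x assume x: "x \<in> vecs X"
    show "extend_by_zero Y S (extend_by_zero X T x) = x"
      unfolding extend_by_zero_def if_P[OF x] if_P[OF bounded_map_vecs[OF assms(3) x]] by (rule assms(5)[OF x])
  qed
  moreover have "\<forall>y\<in>vecs Y. extend_by_zero X T (extend_by_zero Y S y) = y"
  proof
    fix x assume x: "x \<in> vecs Y"
    show "extend_by_zero X T (extend_by_zero Y S x) = x"
      unfolding extend_by_zero_def if_P[OF x] if_P[OF bounded_map_vecs[OF assms(4) x]] by (rule assms(6)[OF x])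
  qed
  ultimately show ?thesis
    unfolding isomorphic_spaces_def
    by (intro bexI[of _ "extend_by_zero X T"] bexI[of _ "extend_by_zero Y S"] conjI)
qed

subsection \<open>The space of p-summable sequences\<close>

lemma suminf_swap_ennreal:
  fixes a :: "nat \<Rightarrow> nat \<Rightarrow> ennreal"
  shows "(\<Sum>n. \<Sum>m. a m n) = (\<Sum>m. \<Sum>n. a m n)"
  using nn_integral_suminf[of a "count_space UNIV"] by (simp add: nn_integral_count_space_nat)

lemma suminf_prod_encode:
  fixes a :: "nat \<Rightarrow> ennreal"
  shows "(\<Sum>i. \<Sum>n. a (prod_encode (i, n))) = (\<Sum>n. a n)"
proof -
  have "(\<Sum>n. a n) = (\<integral>\<^sup>+n. a n \<partial>count_space UNIV)" by (simp add: nn_integral_count_space_nat)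
  also have "\<dots> = (\<integral>\<^sup>+z. a (prod_encode z) \<partial>count_space UNIV)"
    by (rule nn_integral_bij_count_space[symmetric]) (rule bij_prod_encode)
  also have "\<dots> = (\<integral>\<^sup>+i. \<integral>\<^sup>+n. a (prod_encode (i, n)) \<partial>count_space UNIV \<partial>count_space UNIV)"
    by (rule nn_integral_fst_count_space[symmetric])
  finally show ?thesis by (simp add: nn_integral_count_space_nat)
qed

lemma gauge_suminf: "gauge suminf"
proof
  fix a b :: "nat \<Rightarrow> ennreal" and c :: ennreal and n
  show "(\<Sum>n. c * a n) \<le> c * (\<Sum>n. a n)" by simp
  show "a n \<le> (\<Sum>n. a n)" using sum_le_suminf[of a "{n}"] by simp
next
  fix a b :: "nat \<Rightarrow> ennreal" assume "\<And>n. a n \<le> b n"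
  then show "(\<Sum>n. a n) \<le> (\<Sum>n. b n)" by (intro suminf_le) auto
next
  fix a :: "nat \<Rightarrow> nat \<Rightarrow> ennreal"
  show "(\<Sum>n. \<Sum>m. a m n) \<le> (\<Sum>m. \<Sum>n. a m n)" by (rule eq_refl, rule suminf_swap_ennreal)
qed

lemma same_space_lp: "same_space (lp_space p) (gauge_space p suminf)" if "1 \<le> p"
proof -
  have "(\<Sum>n. pw p a n) < top \<longleftrightarrow> summable (\<lambda>n. norm (a n) powr p)" for a :: "nat \<Rightarrow> 'a"
  proof
    assume "(\<Sum>n. pw p a n) < top"
    then show "summable (\<lambda>n. norm (a n) powr p)"
      unfolding pw_def by (intro summable_suminf_not_top) auto
  next
    assume "summable (\<lambda>n. norm (a n) powr p)"
    then have "(\<Sum>n. pw p a n) \<noteq> top"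
      unfolding pw_def by (intro ennreal_suminf_neq_top) auto
    then show "(\<Sum>n. pw p a n) < top" by (simp add: less_top)
  qed
  moreover have "(\<Sum>n. norm (a n) powr p) = enn2real (\<Sum>n. pw p a n)"
    if "summable (\<lambda>n. norm (a n) powr p)" for a :: "nat \<Rightarrow> 'a"
  proof -
    have "(\<Sum>n. pw p a n) = ennreal (\<Sum>n. norm (a n) powr p)"
      unfolding pw_def using that by (intro suminf_ennreal2) auto
    then show ?thesis using that by (simp add: suminf_nonneg)
  qed
  ultimately show ?thesis
    by (simp add: same_space_def lp_space_def gauge_space_def)
qed

subsection \<open>The Lorentz gauge\<close>

text \<open>
  The entries of a at the places listed, weighted in the order of the list. The offset L stands for
  the weights that are already used up by earlier entries.
\<close>

fun list_value :: "(nat \<Rightarrow> real) \<Rightarrow> nat \<Rightarrow> (nat \<Rightarrow> ennreal) \<Rightarrow> nat list \<Rightarrow> ennreal" where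
  "list_value w L a [] = 0"
| "list_value w L a (x # xs) = a x * ennreal (w L) + list_value w (Suc L) a xs"

text \<open>
  Permutations of all indices are replaced by finite lists of distinct indices, which can be filtered
  and concatenated.
\<close>

definition lorentz_gauge :: "(nat \<Rightarrow> real) \<Rightarrow> (nat \<Rightarrow> ennreal) \<Rightarrow> ennreal" where
  "lorentz_gauge w a = (SUP xs\<in>{xs. distinct xs}. list_value w 0 a xs)"

lemma list_value_le_gauge: "distinct xs \<Longrightarrow> list_value w 0 a xs \<le> lorentz_gauge w a"
  unfolding lorentz_gauge_def by (rule SUP_upper) simp

lemma lorentz_gauge_le: "(\<And>xs. distinct xs \<Longrightarrow> list_value w 0 a xs \<le> c) \<Longrightarrow> lorentz_gauge w a \<le> c"
  unfolding lorentz_gauge_def by (rule SUP_least) simp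

lemma list_value_mono: "(\<And>n. a n \<le> b n) \<Longrightarrow> list_value w L a xs \<le> list_value w L b xs"
  by (induction xs arbitrary: L) (auto intro!: add_mono mult_right_mono)

lemma list_value_suminf:
  "list_value w L (\<lambda>n. \<Sum>m. a m n) xs = (\<Sum>m. list_value w L (a m) xs)"
proof (induction xs arbitrary: L)
  case (Cons x xs)
  have "(\<Sum>m. list_value w L (a m) (x # xs)) = (\<Sum>m. a m x * ennreal (w L)) + (\<Sum>m. list_value w (Suc L) (a m) xs)"
    by (simp add: suminf_add[symmetric])
  then show ?case by (simp add: Cons.IH)
qed simp

lemma list_value_scale: "list_value w L (\<lambda>n. c * a n) xs = c * list_value w L a xs"
  by (induction xs arbitrary: L) (simp_all add: distrib_left mult.assoc)

lemma list_value_append: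
  "list_value w L a (xs @ ys) = list_value w L a xs + list_value w (L + length xs) a ys"
  by (induction xs arbitrary: L) (simp_all add: add.assoc)

lemma list_value_conv_sum:
  "list_value w L a xs = (\<Sum>i<length xs. a (xs ! i) * ennreal (w (L + i)))"
proof (induction xs arbitrary: L)
  case (Cons x xs)
  show ?case by (simp add: Cons.IH sum.lessThan_Suc_shift del: sum.lessThan_Suc)
qed simp

lemma gauge_lorentz:
  assumes "w 0 = 1"
  shows "gauge (lorentz_gauge w)"
proof
  fix a b :: "nat \<Rightarrow> ennreal" assume "\<And>n. a n \<le> b n"
  then show "lorentz_gauge w a \<le> lorentz_gauge w b"
    by (intro lorentz_gauge_le order_trans[OF list_value_mono list_value_le_gauge])
next
  fix a :: "nat \<Rightarrow> nat \<Rightarrow> ennreal"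
  show "lorentz_gauge w (\<lambda>n. \<Sum>m. a m n) \<le> (\<Sum>m. lorentz_gauge w (a m))"
  proof (rule lorentz_gauge_le)
    fix xs :: "nat list" assume "distinct xs"
    then show "list_value w 0 (\<lambda>n. \<Sum>m. a m n) xs \<le> (\<Sum>m. lorentz_gauge w (a m))"
      unfolding list_value_suminf by (intro suminf_le list_value_le_gauge) auto
  qed
next
  fix c :: ennreal and a
  show "lorentz_gauge w (\<lambda>n. c * a n) \<le> c * lorentz_gauge w a"
    by (intro lorentz_gauge_le) (auto simp: list_value_scale intro!: mult_left_mono list_value_le_gauge)
next
  fix a :: "nat \<Rightarrow> ennreal" and n
  show "a n \<le> lorentz_gauge w a"
    using list_value_le_gauge[of "[n]" w a] assms by simp
qed

lemma extend_distinct_list_to_bij: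
  fixes xs :: "nat list"
  assumes "distinct xs"
  obtains \<pi> :: "nat \<Rightarrow> nat" where "bij \<pi>" "\<And>i. i < length xs \<Longrightarrow> \<pi> i = xs ! i"
proof -
  let ?A = "{..<length xs}" and ?B = "set xs"
  have AB: "bij_betw ((!) xs) ?A ?B" using assms by (rule bij_betw_nth) auto
  have "card ?A = card ?B" using distinct_card[OF assms] by simp
  then have "card (?B - ?A) = card (?A - ?B)"
    using card_Diff_subset_Int[of ?B ?A] card_Diff_subset_Int[of ?A ?B] by (simp add: Int_commute)
  then obtain g where g: "bij_betw g (?B - ?A) (?A - ?B)"
    by (metis finite_Diff finite_set finite_lessThan finite_same_card_bij)
  \<comment> \<open>The entries of the list that are not below its length are sent to the numbers below its length that are not entries; all other numbers from its length on stay fixed.\<close>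
  define \<pi> where "\<pi> i = (if i \<in> ?A then xs ! i else if i \<in> ?B then g i else i)" for i
  have "bij_betw \<pi> ?A ?B" using AB by (rule bij_betw_cong[THEN iffD1, rotated]) (auto simp: \<pi>_def)
  moreover have "bij_betw \<pi> (?B - ?A) (?A - ?B)" using g by (rule bij_betw_cong[THEN iffD1, rotated]) (auto simp: \<pi>_def)
  ultimately have 1: "bij_betw \<pi> (?A \<union> (?B - ?A)) (?B \<union> (?A - ?B))"
    by (rule bij_betw_combine) auto
  have "bij_betw \<pi> (- (?A \<union> ?B)) (- (?A \<union> ?B))"
    using bij_betw_id by (rule bij_betw_cong[THEN iffD1, rotated]) (auto simp: \<pi>_def)
  then have "bij_betw \<pi> ((?A \<union> (?B - ?A)) \<union> - (?A \<union> ?B)) ((?B \<union> (?A - ?B)) \<union> - (?A \<union> ?B))"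
    by (rule bij_betw_combine[OF 1]) auto
  moreover have "(?A \<union> (?B - ?A)) \<union> - (?A \<union> ?B) = UNIV" "(?B \<union> (?A - ?B)) \<union> - (?A \<union> ?B) = UNIV" by auto
  ultimately have "bij \<pi>" by simp
  then show ?thesis by (rule that) (simp add: \<pi>_def)
qed

lemma lorentz_gauge_conv_bij:
  "lorentz_gauge w a = (SUP \<pi>\<in>{\<pi>. bij \<pi>}. \<Sum>n. a (\<pi> n) * ennreal (w n))"
proof (rule antisym)
  show "lorentz_gauge w a \<le> (SUP \<pi>\<in>{\<pi>. bij \<pi>}. \<Sum>n. a (\<pi> n) * ennreal (w n))"
  proof (rule lorentz_gauge_le)
    fix xs :: "nat list" assume "distinct xs"
    then obtain \<pi> where \<pi>: "bij \<pi>" "\<And>i. i < length xs \<Longrightarrow> \<pi> i = xs ! i"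
      using extend_distinct_list_to_bij by blast
    have "list_value w 0 a xs = (\<Sum>i<length xs. a (\<pi> i) * ennreal (w i))"
      unfolding list_value_conv_sum using \<pi>(2) by (intro sum.cong) auto
    also have "\<dots> \<le> (\<Sum>n. a (\<pi> n) * ennreal (w n))" by (intro sum_le_suminf) auto
    also have "\<dots> \<le> (SUP \<pi>\<in>{\<pi>. bij \<pi>}. \<Sum>n. a (\<pi> n) * ennreal (w n))"
      using \<pi>(1) by (intro SUP_upper) auto
    finally show "list_value w 0 a xs \<le> (SUP \<pi>\<in>{\<pi>. bij \<pi>}. \<Sum>n. a (\<pi> n) * ennreal (w n))" .
  qed
  show "(SUP \<pi>\<in>{\<pi>. bij \<pi>}. \<Sum>n. a (\<pi> n) * ennreal (w n)) \<le> lorentz_gauge w a"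
  proof (rule SUP_least)
    fix \<pi> :: "nat \<Rightarrow> nat" assume "\<pi> \<in> {\<pi>. bij \<pi>}"
    then have d: "distinct (map \<pi> [0..<n])" for n
      by (auto simp: distinct_map bij_def inj_on_def)
    have "(\<Sum>i<n. a (\<pi> i) * ennreal (w i)) \<le> lorentz_gauge w a" for n
      using list_value_le_gauge[OF d[of n], of w a] by (simp add: list_value_conv_sum)
    then show "(\<Sum>n. a (\<pi> n) * ennreal (w n)) \<le> lorentz_gauge w a"
      by (intro suminf_le_const) auto
  qed
qed

lemma same_space_lorentz:
  assumes p: "1 \<le> p" and w: "\<And>n. 0 < w n"
  shows "same_space (lorentz_space w p :: 'a::real_normed_field seq_space) (gauge_space p (lorentz_gauge w))"
proof -
  define S where "S x \<pi> = (\<Sum>n. norm (x (\<pi> n)) powr p * w n)" for x :: "nat \<Rightarrow> 'a" and \<pi> :: "nat \<Rightarrow> nat"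
  define E where "E x \<pi> = (\<Sum>n. pw p x (\<pi> n) * ennreal (w n))" for x :: "nat \<Rightarrow> 'a" and \<pi> :: "nat \<Rightarrow> nat"
  define F where "F x = lorentz_gauge w (pw p x)" for x :: "nat \<Rightarrow> 'a"
  have F: "F x = (SUP \<pi>\<in>{\<pi>. bij \<pi>}. E x \<pi>)" for x
    by (simp add: F_def E_def lorentz_gauge_conv_bij)
  have pos: "0 \<le> norm (x (\<pi> n)) powr p * w n" for x :: "nat \<Rightarrow> 'a" and \<pi> n
    using w[of n] by simp
  have E_alt: "E x \<pi> = (\<Sum>n. ennreal (norm (x (\<pi> n)) powr p * w n))" for x \<pi>
    unfolding E_def pw_def using w by (intro suminf_cong) (simp add: ennreal_mult less_imp_le)
  have ES: "E x \<pi> = ennreal (S x \<pi>)" if "summable (\<lambda>n. norm (x (\<pi> n)) powr p * w n)" for x \<pi>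
    unfolding E_alt S_def using that pos by (intro suminf_ennreal2) auto
  have E_summable: "summable (\<lambda>n. norm (x (\<pi> n)) powr p * w n)" if "E x \<pi> \<noteq> top" for x \<pi>
    using that pos unfolding E_alt by (intro summable_suminf_not_top) auto
  have S0: "0 \<le> S x \<pi>" if "summable (\<lambda>n. norm (x (\<pi> n)) powr p * w n)" for x \<pi>
    unfolding S_def using that pos by (intro suminf_nonneg) auto
  have fin: "(\<forall>\<pi>. bij \<pi> \<longrightarrow> summable (\<lambda>n. norm (x (\<pi> n)) powr p * w n)) \<and>
      (\<forall>\<pi>. bij \<pi> \<longrightarrow> S x \<pi> powr (1 / p) \<le> enn2real (F x) powr (1 / p))" if "F x < top" for x
  proof (intro conjI allI impI)
    fix \<pi> :: "nat \<Rightarrow> nat" assume \<pi>: "bij \<pi>"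
    have le: "E x \<pi> \<le> F x" unfolding F using \<pi> by (intro SUP_upper) auto
    then show sm: "summable (\<lambda>n. norm (x (\<pi> n)) powr p * w n)" using that by (intro E_summable) auto
    have "S x \<pi> \<le> enn2real (F x)"
      using le that S0[of x \<pi>, OF sm] enn2real_mono[OF le that] by (simp add: ES[of x \<pi>, OF sm])
    then show "S x \<pi> powr (1 / p) \<le> enn2real (F x) powr (1 / p)"
      using S0[of x \<pi>, OF sm] p by (intro powr_mono2) auto
  qed
  have conv: "F x \<le> ennreal (M powr p)"
    if "\<forall>\<pi>. bij \<pi> \<longrightarrow> summable (\<lambda>n. norm (x (\<pi> n)) powr p * w n)"
      "\<And>\<pi>. bij \<pi> \<Longrightarrow> S x \<pi> powr (1 / p) \<le> M" for x M
    unfolding F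
  proof (rule SUP_least)
    fix \<pi> :: "nat \<Rightarrow> nat" assume "\<pi> \<in> {\<pi>. bij \<pi>}"
    then have \<pi>: "bij \<pi>" by simp
    have sm: "summable (\<lambda>n. norm (x (\<pi> n)) powr p * w n)" using that(1) \<pi> by blast
    have "0 \<le> M" using that(2)[OF \<pi>] powr_ge_zero order_trans by blast
    then have "S x \<pi> \<le> M powr p"
      using that(2)[OF \<pi>] le_powr_iff[OF S0[of x \<pi>, OF sm] _ p, of M] by simp
    then show "E x \<pi> \<le> ennreal (M powr p)" unfolding ES[of x \<pi>, OF sm] by (rule ennreal_leI)
  qed
  define V where "V x \<longleftrightarrow> (\<forall>\<pi>. bij \<pi> \<longrightarrow> summable (\<lambda>n. norm (x (\<pi> n)) powr p * w n)) \<and>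
      bdd_above ((\<lambda>\<pi>. S x \<pi> powr (1 / p)) ` {\<pi>. bij \<pi>})" for x
  have V: "V x \<longleftrightarrow> F x < top" for x
  proof
    assume x: "V x"
    then obtain M where "\<And>\<pi>. bij \<pi> \<Longrightarrow> S x \<pi> powr (1 / p) \<le> M"
      unfolding V_def bdd_above_def by auto
    then have "F x \<le> ennreal (M powr p)" using x unfolding V_def by (intro conv) auto
    then show "F x < top" by (rule le_less_trans) simp
  next
    assume "F x < top"
    then show "V x" using fin[of x] unfolding V_def by (auto intro!: bdd_aboveI)
  qed
  have N: "(SUP \<pi>\<in>{\<pi>. bij \<pi>}. S x \<pi> powr (1 / p)) = enn2real (F x) powr (1 / p)" if "F x < top" for x
  proof (rule antisym)
    show "(SUP \<pi>\<in>{\<pi>. bij \<pi>}. S x \<pi> powr (1 / p)) \<le> enn2real (F x) powr (1 / p)"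
      using fin[OF that] bij_id by (intro cSUP_least) auto
    let ?M = "SUP \<pi>\<in>{\<pi>. bij \<pi>}. S x \<pi> powr (1 / p)"
    have "V x" using V that by blast
    then have up: "S x \<pi> powr (1 / p) \<le> ?M" if "bij \<pi>" for \<pi>
      using that unfolding V_def by (intro cSUP_upper) auto
    then have M0: "0 \<le> ?M" using bij_id powr_ge_zero order_trans by blast
    have "F x \<le> ennreal (?M powr p)" using fin[OF that] up by (intro conv) auto
    then have "enn2real (F x) \<le> ?M powr p" by (intro enn2real_leI) auto
    then show "enn2real (F x) powr (1 / p) \<le> ?M" using le_powr_iff[OF _ M0 p, of "enn2real (F x)"] by simp
  qed
  show ?thesis
    unfolding same_space_def
  proof (intro conjI ballI)
    show vv: "vecs (lorentz_space w p :: 'a seq_space) = vecs (gauge_space p (lorentz_gauge w))"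
    proof -
      have "vecs (lorentz_space w p :: 'a seq_space) = {x. V x}"
        unfolding V_def S_def lorentz_space_def by simp
      also have "\<dots> = {x. F x < top}" by (rule Collect_cong) (rule V)
      also have "\<dots> = vecs (gauge_space p (lorentz_gauge w) :: 'a seq_space)"
        unfolding F_def gauge_space_def by simp
      finally show ?thesis .
    qed
    fix x :: "nat \<Rightarrow> 'a" assume "x \<in> vecs (lorentz_space w p)"
    then have "F x < top" unfolding vv by (simp add: gauge_space_def F_def)
    then show "vnorm (lorentz_space w p) x = vnorm (gauge_space p (lorentz_gauge w)) x"
      using N[of x] unfolding S_def F_def lorentz_space_def gauge_space_def by simp
  qed
qed

subsection \<open>Bounds on p-th powers\<close>

abbreviation lp_gauged :: "real \<Rightarrow> 'k::real_normed_field seq_space" where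
  "lp_gauged p \<equiv> gauge_space p suminf"

definition linear_between :: "'k::real_normed_field seq_space \<Rightarrow> ((nat \<Rightarrow> 'k) \<Rightarrow> (nat \<Rightarrow> 'k)) \<Rightarrow> bool" where
  "linear_between X T \<longleftrightarrow>
     (\<forall>x\<in>vecs X. \<forall>y\<in>vecs X. T (x + y) = T x + T y) \<and>
     (\<forall>c. \<forall>x\<in>vecs X. T (seq_scale c x) = seq_scale c (T x))"

text \<open>
  Bounding p-th powers instead of norms lets the estimates for infinitely many pieces be added without
  taking roots.
\<close>

definition power_bounded ::
    "real \<Rightarrow> ((nat \<Rightarrow> ennreal) \<Rightarrow> ennreal) \<Rightarrow> ((nat \<Rightarrow> ennreal) \<Rightarrow> ennreal) \<Rightarrow> real
      \<Rightarrow> ((nat \<Rightarrow> 'k::real_normed_field) \<Rightarrow> (nat \<Rightarrow> 'k)) \<Rightarrow> bool" where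
  "power_bounded p F H C T \<longleftrightarrow> 0 \<le> C \<and> linear_between (gauge_space p F) T \<and>
     (\<forall>x\<in>vecs (gauge_space p F). H (pw p (T x)) \<le> ennreal C * F (pw p x))"

lemma power_boundedI:
  assumes "0 \<le> C"
    "\<And>x y. x \<in> vecs (gauge_space p F) \<Longrightarrow> y \<in> vecs (gauge_space p F) \<Longrightarrow> T (x + y) = T x + T y"
    "\<And>c x. x \<in> vecs (gauge_space p F) \<Longrightarrow> T (seq_scale c x) = seq_scale c (T x)"
    "\<And>x. x \<in> vecs (gauge_space p F) \<Longrightarrow> H (pw p (T x)) \<le> ennreal C * F (pw p x)"
  shows "power_bounded p F H C T"
  using assms by (simp add: power_bounded_def linear_between_def)

lemma
  assumes "power_bounded p F H C T"
  shows power_bounded_nonneg: "0 \<le> C"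
    and power_bounded_add: "x \<in> vecs (gauge_space p F) \<Longrightarrow> y \<in> vecs (gauge_space p F) \<Longrightarrow> T (x + y) = T x + T y"
    and power_bounded_scale: "x \<in> vecs (gauge_space p F) \<Longrightarrow> T (seq_scale c x) = seq_scale c (T x)"
    and power_bounded_le: "x \<in> vecs (gauge_space p F) \<Longrightarrow> H (pw p (T x)) \<le> ennreal C * F (pw p x)"
  using assms by (simp_all add: power_bounded_def linear_between_def)

lemma power_bounded_vecs:
  assumes "power_bounded p F H C T" "x \<in> vecs (gauge_space p F)"
  shows "T x \<in> vecs (gauge_space p H)"
proof -
  have "F (pw p x) < top" using assms(2) by (simp add: gauge_space_def)
  then have "ennreal C * F (pw p x) < top" by (simp add: ennreal_mult_less_top)
  then show ?thesis using power_bounded_le[OF assms] by (simp add: gauge_space_def)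
qed

lemma
  fixes T :: "(nat \<Rightarrow> 'k::real_normed_field) \<Rightarrow> nat \<Rightarrow> 'k"
  assumes "gauge_p F p" "gauge_p H p"
  shows power_bounded_imp: "power_bounded p F H C T \<Longrightarrow> bounded_map (gauge_space p F) (gauge_space p H) (C powr (1 / p)) T"
    and power_bounded_if: "bounded_map (gauge_space p F) (gauge_space p H) C T \<Longrightarrow> power_bounded p F H (C powr p) T"
proof -
  interpret F: gauge_p F p by fact
  interpret H: gauge_p H p by fact
  {
    assume T: "power_bounded p F H C T"
    note C = power_bounded_nonneg[OF T]
    show "bounded_map (gauge_space p F) (gauge_space p H) (C powr (1 / p)) T"
    proof (rule bounded_mapI)
      fix x :: "nat \<Rightarrow> 'k" assume x: "x \<in> vecs (gauge_space p F)"
      have "H (pw p (T x)) \<le> ennreal C * ennreal (vnorm (gauge_space p F) x powr p)"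
        using power_bounded_le[OF T x] by (simp only: F.vnorm_powr[OF x])
      also have "\<dots> = ennreal ((C powr (1 / p) * vnorm (gauge_space p F) x) powr p)"
        using C F.p1 by (simp add: powr_mult powr_powr ennreal_mult)
      finally show "T x \<in> vecs (gauge_space p H) \<and> vnorm (gauge_space p H) (T x) \<le> C powr (1 / p) * vnorm (gauge_space p F) x"
        by (subst (asm) H.vnorm_le_iff) auto
    qed (use power_bounded_add[OF T] power_bounded_scale[OF T] in auto)
  next
    assume T: "bounded_map (gauge_space p F) (gauge_space p H) C T"
    note C = bounded_map_nonneg[OF T]
    show "power_bounded p F H (C powr p) T"
    proof (rule power_boundedI)
      fix x :: "nat \<Rightarrow> 'k" assume x: "x \<in> vecs (gauge_space p F)"
      have "H (pw p (T x)) \<le> ennreal ((C * vnorm (gauge_space p F) x) powr p)"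
        using bounded_map_vecs[OF T x] bounded_map_norm[OF T x] C
        by (subst H.vnorm_le_iff) auto
      also have "\<dots> = ennreal (C powr p) * F (pw p x)"
        using C by (simp add: powr_mult ennreal_mult F.vnorm_powr[OF x])
      finally show "H (pw p (T x)) \<le> ennreal (C powr p) * F (pw p x)" .
    qed (use bounded_map_add[OF T] bounded_map_scale[OF T] in auto)
  }
qed

lemma power_bounded_compose:
  fixes T S :: "(nat \<Rightarrow> 'k::real_normed_field) \<Rightarrow> nat \<Rightarrow> 'k"
  assumes T: "power_bounded p F H C T" and S: "power_bounded p H E D S"
  shows "power_bounded p F E (D * C) (\<lambda>x. S (T x))"
proof (rule power_boundedI)
  show "0 \<le> D * C" using power_bounded_nonneg[OF T] power_bounded_nonneg[OF S] by simp
next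
  fix x y :: "nat \<Rightarrow> 'k" assume x: "x \<in> vecs (gauge_space p F)" and y: "y \<in> vecs (gauge_space p F)"
  show "S (T (x + y)) = S (T x) + S (T y)"
    using power_bounded_add[OF T x y] power_bounded_add[OF S power_bounded_vecs[OF T x] power_bounded_vecs[OF T y]]
    by (simp only:)
next
  fix c :: 'k and x :: "nat \<Rightarrow> 'k" assume x: "x \<in> vecs (gauge_space p F)"
  show "S (T (seq_scale c x)) = seq_scale c (S (T x))"
    using power_bounded_scale[OF T x] power_bounded_scale[OF S power_bounded_vecs[OF T x]] by (simp only:)
  have "E (pw p (S (T x))) \<le> ennreal D * (ennreal C * F (pw p x))"
    using power_bounded_le[OF S power_bounded_vecs[OF T x]]
    by (rule order_trans) (intro mult_left_mono power_bounded_le[OF T x], simp)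
  then show "E (pw p (S (T x))) \<le> ennreal (D * C) * F (pw p x)"
    using power_bounded_nonneg[OF T] power_bounded_nonneg[OF S] by (simp add: ennreal_mult mult.assoc)
qed

lemma pw_scale: "pw p (seq_scale c x) = (\<lambda>n. ennreal (norm c powr p) * pw p x n)"
  by (simp add: pw_def seq_scale_def norm_mult powr_mult ennreal_mult)

lemma gauge_scale_le: "F (pw p (seq_scale c x)) \<le> ennreal (norm c powr p) * F (pw p x)" if "gauge F"
  unfolding pw_scale by (rule gauge.scale[OF that])

lemma pw_midpoint_le:
  assumes "1 \<le> p"
  shows "pw p (seq_scale (1/2) (x + y)) n \<le> ennreal (1/2) * pw p x n + ennreal (1/2) * pw p y n"
proof -
  have "norm (1/2 * (x n + y n)) powr p \<le> (norm (x n) / 2 + norm (y n) / 2) powr p"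
    using assms norm_triangle_ineq[of "x n" "y n"]
    by (intro powr_mono2) (auto simp: norm_mult norm_divide)
  also have "\<dots> \<le> (norm (x n) powr p + norm (y n) powr p) / 2"
    using powr_add_le[of p "norm (x n) / 2" "norm (y n) / 2" "1/2" "1/2"] assms
    by (simp add: powr_divide powr_diff field_simps)
  finally have "ennreal (norm (1/2 * (x n + y n)) powr p) \<le> ennreal (1/2 * norm (x n) powr p + 1/2 * norm (y n) powr p)"
    by (intro ennreal_leI) simp
  also have "\<dots> = ennreal (1/2) * pw p x n + ennreal (1/2) * pw p y n"
    by (simp only: pw_def ennreal_plus ennreal_mult powr_ge_zero mult_nonneg_nonneg zero_le_divide_1_iff zero_le_numeral)
  finally show ?thesis by (simp add: pw_def seq_scale_def)
qed

subsection \<open>Slices\<close>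

text \<open>
  A sequence is read as a sequence of sequences by means of the pairing function. This identifies l_p
  isometrically with the l_p-sum of countably many copies of itself (\<open>suminf_slices\<close>).
\<close>

definition slice :: "nat \<Rightarrow> (nat \<Rightarrow> 'k) \<Rightarrow> nat \<Rightarrow> 'k" where
  "slice i s = (\<lambda>n. s (prod_encode (i, n)))"

definition glue :: "(nat \<Rightarrow> nat \<Rightarrow> 'k) \<Rightarrow> nat \<Rightarrow> 'k" where
  "glue c = (\<lambda>n. case prod_decode n of (i, m) \<Rightarrow> c i m)"

lemma slice_glue [simp]: "slice i (glue c) = c i"
  by (simp add: slice_def glue_def)

lemma glue_slice [simp]: "glue (\<lambda>i. slice i s) = s"
  unfolding slice_def glue_def
  by (rule ext) (metis (mono_tags, lifting) case_prod_beta prod.collapse prod_decode_inverse)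

lemma slice_add: "slice i (x + y) = slice i x + slice i y"
  by (rule ext) (simp add: slice_def)

lemma slice_scale: "slice i (seq_scale c x) = seq_scale c (slice i x)"
  by (rule ext) (simp add: slice_def seq_scale_def)

lemma glue_add: "glue (\<lambda>i. x i + y i) = glue x + glue y"
  by (rule ext) (simp add: glue_def split: prod.split)

lemma glue_scale: "glue (\<lambda>i. seq_scale c (x i)) = seq_scale c (glue x)"
  by (rule ext) (simp add: glue_def seq_scale_def split: prod.split)

lemma suminf_slices: "(\<Sum>i. suminf (pw p (slice i s))) = suminf (pw p s)"
  using suminf_prod_encode[of "pw p s"] by (simp add: pw_def slice_def)

lemma suminf_glue: "suminf (pw p (glue c)) = (\<Sum>i. suminf (pw p (c i)))"
  using suminf_slices[of p "glue c"] by simp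

lemma suminf_slice_le: "suminf (pw p (slice i s)) \<le> suminf (pw p s)"
proof -
  have "suminf (pw p (slice i s)) = (\<Sum>i\<in>{i}. suminf (pw p (slice i s)))" by simp
  also have "\<dots> \<le> (\<Sum>i. suminf (pw p (slice i s)))" by (rule sum_le_suminf) auto
  finally show ?thesis by (simp only: suminf_slices)
qed

lemma slice_vecs: "s \<in> vecs (lp_gauged p) \<Longrightarrow> slice i s \<in> vecs (lp_gauged p)"
  unfolding gauge_space_def using le_less_trans[OF suminf_slice_le[of p i s]] by simp

text \<open>
  The l_p-sum of two copies of l_p inside l_p, as the first two slices.
\<close>

definition pair :: "(nat \<Rightarrow> 'k::zero) \<Rightarrow> (nat \<Rightarrow> 'k) \<Rightarrow> nat \<Rightarrow> 'k" where
  "pair x y = glue (\<lambda>i. if i = 0 then x else if i = Suc 0 then y else (\<lambda>n. 0))"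

lemma slice_pair [simp]: "slice 0 (pair x y) = x" "slice (Suc 0) (pair x y) = y"
  by (simp_all add: pair_def)

lemma suminf_pair:
  "suminf (pw p (pair x y)) = suminf (pw p x) + suminf (pw p y)"
proof -
  let ?c = "\<lambda>i::nat. if i = 0 then x else if i = Suc 0 then y else (\<lambda>n. 0)"
  have "suminf (pw p (pair x y)) = (\<Sum>i. suminf (pw p (?c i)))"
    unfolding pair_def by (rule suminf_glue)
  also have "\<dots> = (\<Sum>i\<in>{0, Suc 0}. suminf (pw p (?c i)))"
    by (rule suminf_finite) (auto simp: pw_def)
  finally show ?thesis by simp
qed

lemma pair_add: "pair (x + x') (y + y') = pair x y + pair x' y'"
  for x x' y y' :: "nat \<Rightarrow> 'k::real_normed_field"
  by (rule ext) (auto simp: pair_def glue_def split: prod.split)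

lemma pair_scale: "pair (seq_scale c x) (seq_scale c y) = seq_scale c (pair x y)"
  by (rule ext) (auto simp: pair_def glue_def seq_scale_def split: prod.split)

lemma suminf_slice_pair_le:
  "suminf (pw p (slice 0 s)) + suminf (pw p (slice (Suc 0) s)) \<le> suminf (pw p s)"
proof -
  have "suminf (pw p (slice 0 s)) + suminf (pw p (slice (Suc 0) s)) = (\<Sum>i\<in>{0, Suc 0}. suminf (pw p (slice i s)))"
    by simp
  also have "\<dots> \<le> (\<Sum>i. suminf (pw p (slice i s)))" by (rule sum_le_suminf) auto
  finally show ?thesis by (simp only: suminf_slices)
qed

section \<open>Sequence spaces that are p-sums of finite blocks\<close>

lemma sum_fun_at: "(\<Sum>i\<in>I. f i) j = (\<Sum>i\<in>I. f i j)" for f :: "'i \<Rightarrow> 'a \<Rightarrow> 'b::comm_monoid_add"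
  by (induction I rule: infinite_finite_induct) auto

text \<open>
  Change of sign of one coordinate, an isometry for every gauge. Commuting with it forces the entries of
  a matrix off the diagonal in that row to vanish.
\<close>

definition flip :: "nat \<Rightarrow> (nat \<Rightarrow> 'k::real_normed_field) \<Rightarrow> nat \<Rightarrow> 'k" where
  "flip j c = (\<lambda>i. if i = j then - c i else c i)"

lemma flip_flip [simp]: "flip j (flip j c) = c"
  by (auto simp: flip_def)

lemma flip_commute: "flip i (flip j c) = flip j (flip i c)"
  by (auto simp: flip_def)

lemma flip_add: "flip j (x + y) = flip j x + flip j y"
  by (rule ext) (simp add: flip_def)

lemma flip_scale: "flip j (seq_scale c x) = seq_scale c (flip j x)"
  by (rule ext) (simp add: flip_def seq_scale_def)

lemma pw_flip [simp]: "pw p (flip j c) = pw p c"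
  by (rule ext) (simp add: flip_def pw_def)

lemma scale_add: "seq_scale c (x + y) = seq_scale c x + seq_scale c y"
  by (rule ext) (simp add: seq_scale_def distrib_left)

lemma scale_scale: "seq_scale c (seq_scale d x) = seq_scale (c * d) x"
  by (rule ext) (simp add: seq_scale_def)

lemma scale_one: "seq_scale 1 x = x"
  by (simp add: seq_scale_def)

lemma ennreal_half_add: "ennreal (1/2) * x + ennreal (1/2) * x = x"
proof -
  have "ennreal (1/2) * x + ennreal (1/2) * x = (ennreal (1/2) + ennreal (1/2)) * x"
    by (rule distrib_right[symmetric])
  also have "ennreal (1/2) + ennreal (1/2) = ennreal (1/2 + 1/2)" by (rule ennreal_plus[symmetric]) auto
  finally show ?thesis by simp
qed

lemma ennreal_double_halves: "ennreal 2 * (ennreal (1/2) * x + ennreal (1/2) * y) = x + y"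
proof -
  have "ennreal 2 * ennreal (1/2) = 1"
    by (subst ennreal_mult[symmetric]) auto
  then show ?thesis by (simp only: distrib_left mult.assoc[symmetric] mult_1_left)
qed

text \<open>
  Together with countable subadditivity, \<open>blocks_le\<close> says that the space is, up to the constant K, the
  l_p-sum of the subspaces carried by the finite sets where \<open>grp\<close> is constant; \<open>F_le_suminf\<close> says that
  the unit vectors have norm at most 1. These properties of the span of the blocks are all that the rest of the argument uses.
\<close>

locale block_sum = gauge_p F p for F p +
  fixes grp :: "nat \<Rightarrow> nat" and K :: real
  assumes finite_grp: "\<And>m. finite {n. grp n = m}"
    and surj_grp: "surj grp"
    and F_le_suminf: "\<And>a. F a \<le> (\<Sum>n. a n)"
    and blocks_le: "\<And>a. (\<Sum>m. F (\<lambda>n. if grp n = m then a n else 0)) \<le> ennreal K * F a"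
    and K1: "1 \<le> K"
begin

sublocale lp: gauge_p suminf p
  by (intro gauge_p.intro gauge_suminf gauge_p_axioms.intro p1)

abbreviation block :: "nat \<Rightarrow> (nat \<Rightarrow> 'k::real_normed_field) \<Rightarrow> nat \<Rightarrow> 'k" where
  "block m x \<equiv> (\<lambda>n. if grp n = m then x n else 0)"

lemma pw_block: "pw p (block m x) = (\<lambda>n. if grp n = m then pw p x n else 0)"
  by (rule ext) (simp add: pw_def)

lemma blocks_pw_le: "(\<Sum>m. F (pw p (block m x))) \<le> ennreal K * F (pw p x)"
  unfolding pw_block by (rule blocks_le)

lemma block_vecs: "x \<in> vecs G \<Longrightarrow> block m x \<in> vecs G"
  by (rule vnorm_mono) auto

lemma flip_vecs: "x \<in> vecs G \<Longrightarrow> flip j x \<in> vecs G"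
  by (simp add: vecs_iff)

lemma suminf_pw_unit: "suminf (pw p (unit_seq j :: nat \<Rightarrow> 'k::real_normed_field)) = 1"
proof -
  have "suminf (pw p (unit_seq j :: nat \<Rightarrow> 'k)) = (\<Sum>n\<in>{j}. pw p (unit_seq j :: nat \<Rightarrow> 'k) n)"
    by (rule suminf_finite) (auto simp: pw_def unit_seq_def)
  then show ?thesis by (simp add: pw_def unit_seq_def)
qed

lemma F_pw_unit: "F (pw p (unit_seq j :: nat \<Rightarrow> 'k::real_normed_field)) \<le> 1"
  using F_le_suminf[of "pw p (unit_seq j :: nat \<Rightarrow> 'k)"] by (simp only: suminf_pw_unit)

lemma unit_vecs: "(unit_seq j :: nat \<Rightarrow> 'k::real_normed_field) \<in> vecs G"
  unfolding vecs_iff using le_less_trans[OF F_pw_unit, of top j] by simp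

text \<open>
  The multiplier with symbol s factors through l_p. The symbol is what remains of an operator after
  its entries off the diagonal have been averaged away.
\<close>

definition factors :: "(nat \<Rightarrow> 'k::real_normed_field) \<Rightarrow> bool" where
  "factors s \<longleftrightarrow> (\<exists>\<alpha> \<beta> a b. power_bounded p F suminf b \<beta> \<and> power_bounded p suminf F a \<alpha> \<and>
     (\<forall>c\<in>vecs G. \<alpha> (\<beta> c) = (\<lambda>j. s j * c j)))"

lemma power_bounded_identity: "power_bounded p suminf F 1 (\<lambda>x :: nat \<Rightarrow> 'k::real_normed_field. x)"
  by (rule power_boundedI) (auto simp: F_le_suminf)

lemma factors_add:
  fixes s t :: "nat \<Rightarrow> 'k::real_normed_field"
  assumes "factors s" "factors t"
  shows "factors (\<lambda>j. s j + t j)"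
proof -
  obtain \<alpha> \<beta> a b where \<beta>: "power_bounded p F suminf b \<beta>" and \<alpha>: "power_bounded p suminf F a \<alpha>"
    and s: "\<And>c. c \<in> vecs G \<Longrightarrow> \<alpha> (\<beta> c) = (\<lambda>j. s j * c j)"
    using assms(1) unfolding factors_def by blast
  obtain \<alpha>' \<beta>' a' b' where \<beta>': "power_bounded p F suminf b' \<beta>'" and \<alpha>': "power_bounded p suminf F a' \<alpha>'"
    and t: "\<And>c. c \<in> vecs G \<Longrightarrow> \<alpha>' (\<beta>' c) = (\<lambda>j. t j * c j)"
    using assms(2) unfolding factors_def by blast
  define B where "B c = pair (\<beta> c) (\<beta>' c)" for c
  define A where "A z = \<alpha> (slice 0 z) + \<alpha>' (slice (Suc 0) z)" for z
  have B: "power_bounded p F suminf (b + b') B"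
  proof (rule power_boundedI)
    fix x :: "nat \<Rightarrow> 'k" assume x: "x \<in> vecs G"
    have "suminf (pw p (B x)) \<le> ennreal b * F (pw p x) + ennreal b' * F (pw p x)"
      unfolding B_def suminf_pair by (intro add_mono power_bounded_le[OF \<beta> x] power_bounded_le[OF \<beta>' x])
    also have "\<dots> = ennreal (b + b') * F (pw p x)"
      using power_bounded_nonneg[OF \<beta>] power_bounded_nonneg[OF \<beta>'] by (simp add: distrib_right)
    finally show "suminf (pw p (B x)) \<le> ennreal (b + b') * F (pw p x)" .
  next
    fix x y :: "nat \<Rightarrow> 'k" assume "x \<in> vecs G" "y \<in> vecs G"
    then show "B (x + y) = B x + B y"
      unfolding B_def by (simp only: power_bounded_add[OF \<beta>] power_bounded_add[OF \<beta>'] pair_add)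
  next
    fix c :: 'k and x :: "nat \<Rightarrow> 'k" assume "x \<in> vecs G"
    then show "B (seq_scale c x) = seq_scale c (B x)"
      unfolding B_def by (simp only: power_bounded_scale[OF \<beta>] power_bounded_scale[OF \<beta>'] pair_scale)
  qed (use power_bounded_nonneg[OF \<beta>] power_bounded_nonneg[OF \<beta>'] in simp)
  have A: "bounded_map (lp_gauged p) G (a powr (1/p) + a' powr (1/p)) A"
  proof (rule bounded_mapI)
    fix z :: "nat \<Rightarrow> 'k" assume z: "z \<in> vecs (lp_gauged p)"
    note c = slice_vecs[OF z]
    note ba = power_bounded_imp[OF lp.gauge_p_axioms gauge_p_axioms \<alpha>]
    note ba' = power_bounded_imp[OF lp.gauge_p_axioms gauge_p_axioms \<alpha>']
    have n: "vnorm (lp_gauged p) (slice i z) \<le> vnorm (lp_gauged p) z" for i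
      using suminf_slice_le[of p i z] lp.vnorm_powr[OF z]
        lp.vnorm_le_iff[of "vnorm (lp_gauged p) z" "slice i z"] by simp
    have "vnorm G (A z) \<le> vnorm G (\<alpha> (slice 0 z)) + vnorm G (\<alpha>' (slice (Suc 0) z))"
      unfolding A_def by (intro norm_add bounded_map_vecs[OF ba] bounded_map_vecs[OF ba'] c)
    also have "\<dots> \<le> a powr (1/p) * vnorm (lp_gauged p) (slice 0 z)
        + a' powr (1/p) * vnorm (lp_gauged p) (slice (Suc 0) z)"
      by (intro add_mono bounded_map_norm[OF ba] bounded_map_norm[OF ba'] c)
    also have "\<dots> \<le> a powr (1/p) * vnorm (lp_gauged p) z + a' powr (1/p) * vnorm (lp_gauged p) z"
      by (intro add_mono mult_left_mono n) auto
    also have "\<dots> = (a powr (1/p) + a' powr (1/p)) * vnorm (lp_gauged p) z"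
      by (simp add: distrib_right)
    finally have "vnorm G (A z) \<le> (a powr (1/p) + a' powr (1/p)) * vnorm (lp_gauged p) z" .
    moreover have "A z \<in> vecs G"
      unfolding A_def by (intro vecs_add bounded_map_vecs[OF ba] bounded_map_vecs[OF ba'] c)
    ultimately show "A z \<in> vecs G \<and> vnorm G (A z) \<le> (a powr (1/p) + a' powr (1/p)) * vnorm (lp_gauged p) z"
      by blast
  next
    fix x y :: "nat \<Rightarrow> 'k" assume "x \<in> vecs (lp_gauged p)" "y \<in> vecs (lp_gauged p)"
    then show "A (x + y) = A x + A y"
      unfolding A_def
      by (simp only: slice_add power_bounded_add[OF \<alpha>] power_bounded_add[OF \<alpha>'] slice_vecs add_ac)
  next
    fix c :: 'k and x :: "nat \<Rightarrow> 'k" assume "x \<in> vecs (lp_gauged p)"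
    then show "A (seq_scale c x) = seq_scale c (A x)"
      unfolding A_def
      by (simp only: slice_scale power_bounded_scale[OF \<alpha>] power_bounded_scale[OF \<alpha>'] slice_vecs scale_add)
  qed simp
  have "A (B c) = (\<lambda>j. (s j + t j) * c j)" if "c \<in> vecs G" for c
    using s[OF that] t[OF that] by (auto simp: A_def B_def distrib_right)
  then show ?thesis
    unfolding factors_def using B power_bounded_if[OF lp.gauge_p_axioms gauge_p_axioms A] by blast
qed

lemma factors_finite_support:
  fixes s :: "nat \<Rightarrow> 'k::real_normed_field"
  assumes fin: "finite {j. s j \<noteq> 0}"
  shows "factors s"
proof -
  define C where "C = (\<Sum>j | s j \<noteq> 0. norm (s j) powr p)"
  have "power_bounded p F suminf C (\<lambda>c j. s j * c j)"
  proof (rule power_boundedI)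
    show "0 \<le> C" by (auto simp: C_def intro: sum_nonneg)
  next
    fix x :: "nat \<Rightarrow> 'k"
    have "suminf (pw p (\<lambda>j. s j * x j)) = (\<Sum>j | s j \<noteq> 0. pw p (\<lambda>j. s j * x j) j)"
      by (rule suminf_finite[OF fin]) (auto simp: pw_def)
    also have "\<dots> \<le> (\<Sum>j | s j \<noteq> 0. ennreal (norm (s j) powr p) * F (pw p x))"
    proof (rule sum_mono)
      fix j
      have "pw p (\<lambda>j. s j * x j) j = ennreal (norm (s j) powr p) * pw p x j"
        by (simp add: pw_def norm_mult powr_mult ennreal_mult)
      also have "\<dots> \<le> ennreal (norm (s j) powr p) * F (pw p x)"
        by (intro mult_left_mono coordinate_le) simp
      finally show "pw p (\<lambda>j. s j * x j) j \<le> ennreal (norm (s j) powr p) * F (pw p x)" .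
    qed
    also have "\<dots> = ennreal C * F (pw p x)"
      unfolding C_def by (simp add: sum_distrib_right[symmetric] sum_ennreal)
    finally show "suminf (pw p (\<lambda>j. s j * x j)) \<le> ennreal C * F (pw p x)" .
  qed (auto simp: fun_eq_iff seq_scale_def distrib_left)
  then show ?thesis
    unfolding factors_def using power_bounded_identity by blast
qed

text \<open>
  One step replaces M = \<open>\<alpha> \<beta>\<close> by the mean of M and its conjugate under the change of sign of
  coordinate i. The mean commutes with this change of sign and with all those that M commutes with, has
  the same diagonal, and factors through the l_p-sum of two copies of l_p. Convexity of the p-th power
  gives the same constants as before, which matters because the number of steps is not bounded.
\<close>

lemma average_flips:
  fixes \<alpha> \<beta> :: "(nat \<Rightarrow> 'k::real_normed_field) \<Rightarrow> nat \<Rightarrow> 'k"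
  assumes \<beta>: "power_bounded p F suminf b \<beta>" and \<alpha>: "power_bounded p suminf F a \<alpha>" and fin: "finite J"
  shows "\<exists>\<alpha>' \<beta>'. power_bounded p F suminf b \<beta>' \<and> power_bounded p suminf F a \<alpha>' \<and>
     (\<forall>c\<in>vecs G. \<forall>j\<in>J. \<alpha>' (\<beta>' (flip j c)) = flip j (\<alpha>' (\<beta>' c))) \<and>
     (\<forall>j. \<alpha>' (\<beta>' (unit_seq j)) j = \<alpha> (\<beta> (unit_seq j)) j)"
  using fin
proof (induction J rule: finite_induct)
  case empty
  then show ?case using \<alpha> \<beta> by blast
next
  case (insert i J)
  then obtain \<alpha>1 \<beta>1 where \<beta>1: "power_bounded p F suminf b \<beta>1" and \<alpha>1: "power_bounded p suminf F a \<alpha>1"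
    and comm: "\<And>c j. c \<in> vecs G \<Longrightarrow> j \<in> J \<Longrightarrow> \<alpha>1 (\<beta>1 (flip j c)) = flip j (\<alpha>1 (\<beta>1 c))"
    and diag: "\<And>j. \<alpha>1 (\<beta>1 (unit_seq j)) j = \<alpha> (\<beta> (unit_seq j)) j"
    by blast
  \<comment> \<open>The factor 2^(-1/p) makes the embedding of one copy of l_p into the sum of two copies, both with the same vector, an isometry; its inverse is compensated by the mean in the other map.\<close>
  define e :: 'k where "e = of_real (2 powr (- 1 / p))"
  have ne: "norm e = 2 powr (- 1 / p)" "norm (inverse e) = 2 powr (1 / p)"
    by (simp_all add: e_def norm_divide powr_minus_divide inverse_eq_divide)
  have pp: "- 1 / p * p = - 1" "1 / p * p = 1" using p1 by auto
  have "norm e powr p = 2 powr (- 1)" "norm (inverse e) powr p = 2 powr 1"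
    by (simp_all only: ne powr_powr pp)
  then have e: "norm e powr p = 1 / 2" "norm (inverse e) powr p = 2" "e \<noteq> 0"
    by (auto simp: powr_minus e_def)
  define M where "M c = \<alpha>1 (\<beta>1 c)" for c
  define \<beta>2 where "\<beta>2 c = seq_scale e (pair (\<beta>1 c) (\<beta>1 (flip i c)))" for c
  define \<alpha>2 where "\<alpha>2 z = seq_scale (inverse e) (seq_scale (1/2) (\<alpha>1 (slice 0 z) + flip i (\<alpha>1 (slice (Suc 0) z))))" for z
  have b2: "power_bounded p F suminf b \<beta>2"
  proof (rule power_boundedI)
    show "0 \<le> b" by (rule power_bounded_nonneg[OF \<beta>])
  next
    fix x :: "nat \<Rightarrow> 'k" assume x: "x \<in> vecs G"
    have "suminf (pw p (\<beta>2 x)) \<le> ennreal (1/2) * suminf (pw p (pair (\<beta>1 x) (\<beta>1 (flip i x))))"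
      unfolding \<beta>2_def by (rule order_trans[OF gauge_scale_le[OF gauge_suminf]]) (simp only: e order_refl)
    also have "\<dots> \<le> ennreal (1/2) * (ennreal b * F (pw p x) + ennreal b * F (pw p (flip i x)))"
      unfolding suminf_pair
      by (intro mult_left_mono add_mono power_bounded_le[OF \<beta>1 x] power_bounded_le[OF \<beta>1 flip_vecs[OF x]]) simp
    also have "\<dots> = ennreal b * F (pw p x)"
      by (simp only: pw_flip distrib_left ennreal_half_add)
    finally show "suminf (pw p (\<beta>2 x)) \<le> ennreal b * F (pw p x)" .
  next
    fix x y :: "nat \<Rightarrow> 'k" assume "x \<in> vecs G" "y \<in> vecs G"
    then show "\<beta>2 (x + y) = \<beta>2 x + \<beta>2 y"
      unfolding \<beta>2_def by (simp only: power_bounded_add[OF \<beta>1] flip_vecs flip_add pair_add scale_add)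
  next
    fix c :: 'k and x :: "nat \<Rightarrow> 'k" assume "x \<in> vecs G"
    then show "\<beta>2 (seq_scale c x) = seq_scale c (\<beta>2 x)"
      unfolding \<beta>2_def
      by (simp only: power_bounded_scale[OF \<beta>1] flip_vecs flip_scale pair_scale scale_scale mult.commute)
  qed
  have a2: "power_bounded p suminf F a \<alpha>2"
  proof (rule power_boundedI)
    show "0 \<le> a" by (rule power_bounded_nonneg[OF \<alpha>])
  next
    fix z :: "nat \<Rightarrow> 'k" assume z: "z \<in> vecs (lp_gauged p)"
    let ?u = "\<alpha>1 (slice 0 z)" and ?v = "flip i (\<alpha>1 (slice (Suc 0) z))"
    have "F (pw p (\<alpha>2 z)) \<le> ennreal 2 * F (pw p (seq_scale (1/2) (?u + ?v)))"
      unfolding \<alpha>2_def by (rule order_trans[OF gauge_scale_le[OF gauge_axioms]]) (simp only: e order_refl)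
    also have "\<dots> \<le> ennreal 2 * F (\<lambda>n. ennreal (1/2) * pw p ?u n + ennreal (1/2) * pw p ?v n)"
      by (intro mult_left_mono mono pw_midpoint_le p1) simp
    also have "\<dots> \<le> ennreal 2 * (ennreal (1/2) * F (pw p ?u) + ennreal (1/2) * F (pw p ?v))"
      by (intro mult_left_mono order_trans[OF subadditive] add_mono scale) simp
    also have "\<dots> = F (pw p (\<alpha>1 (slice 0 z))) + F (pw p (\<alpha>1 (slice (Suc 0) z)))"
      by (simp only: ennreal_double_halves pw_flip)
    also have "\<dots> \<le> ennreal a * suminf (pw p (slice 0 z)) + ennreal a * suminf (pw p (slice (Suc 0) z))"
      by (intro add_mono power_bounded_le[OF \<alpha>1] slice_vecs z)
    also have "\<dots> \<le> ennreal a * suminf (pw p z)"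
      unfolding distrib_left[symmetric] by (intro mult_left_mono suminf_slice_pair_le) simp
    finally show "F (pw p (\<alpha>2 z)) \<le> ennreal a * suminf (pw p z)" .
  next
    fix x y :: "nat \<Rightarrow> 'k" assume "x \<in> vecs (lp_gauged p)" "y \<in> vecs (lp_gauged p)"
    then show "\<alpha>2 (x + y) = \<alpha>2 x + \<alpha>2 y"
      unfolding \<alpha>2_def
      by (simp only: power_bounded_add[OF \<alpha>1] slice_vecs slice_add flip_add scale_add add_ac)
  next
    fix c :: 'k and x :: "nat \<Rightarrow> 'k" assume "x \<in> vecs (lp_gauged p)"
    then show "\<alpha>2 (seq_scale c x) = seq_scale c (\<alpha>2 x)"
      unfolding \<alpha>2_def
      by (simp only: power_bounded_scale[OF \<alpha>1] slice_vecs slice_scale flip_scale scale_add scale_scale mult_ac)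
  qed
  have M2: "\<alpha>2 (\<beta>2 c) = seq_scale (1/2) (M c + flip i (M (flip i c)))" if "c \<in> vecs G" for c
  proof -
    have "\<beta>1 c \<in> vecs (lp_gauged p)" "\<beta>1 (flip i c) \<in> vecs (lp_gauged p)"
      using power_bounded_vecs[OF \<beta>1] that flip_vecs by blast+
    then have "\<alpha>2 (\<beta>2 c) = seq_scale (inverse e) (seq_scale (1/2) (seq_scale e (M c + flip i (M (flip i c)))))"
      unfolding \<alpha>2_def \<beta>2_def M_def
      by (simp only: slice_scale slice_pair power_bounded_scale[OF \<alpha>1] flip_scale scale_add)
    also have "\<dots> = seq_scale (inverse e * e * (1/2)) (M c + flip i (M (flip i c)))"
      by (simp only: scale_scale mult_ac)
    finally show ?thesis using e(3) by simp
  qed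
  have "\<alpha>2 (\<beta>2 (flip j c)) = flip j (\<alpha>2 (\<beta>2 c))" if c: "c \<in> vecs G" and j: "j \<in> insert i J" for c j
  proof (cases "j = i")
    case True
    then show ?thesis
      unfolding M2[OF c] M2[OF flip_vecs[OF c]]
      by (simp only: flip_scale flip_add flip_flip add.commute)
  next
    case False
    then have "j \<in> J" using j by blast
    then have "M (flip j c) = flip j (M c)" "M (flip i (flip j c)) = flip j (M (flip i c))"
      unfolding M_def flip_commute[of i j] using c by (auto intro!: comm flip_vecs)
    then show ?thesis
      unfolding M2[OF c] M2[OF flip_vecs[OF c]]
      by (simp only: flip_scale flip_add flip_commute[of i j])
  qed
  moreover have "\<alpha>2 (\<beta>2 (unit_seq j)) j = \<alpha> (\<beta> (unit_seq j)) j" for j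
  proof -
    have "flip i (M (flip i (unit_seq j))) j = M (unit_seq j) j"
    proof (cases "j = i")
      case True
      have "flip i (unit_seq i) = seq_scale (-1) (unit_seq i :: nat \<Rightarrow> 'k)"
        by (auto simp: flip_def unit_seq_def seq_scale_def)
      then have "M (flip i (unit_seq i)) = seq_scale (-1) (M (unit_seq i))"
        unfolding M_def using power_bounded_scale[OF power_bounded_compose[OF \<beta>1 \<alpha>1] unit_vecs[of i], of "-1"]
        by (simp only:)
      then show ?thesis using True by (simp add: flip_def seq_scale_def)
    next
      case False
      then have "flip i (unit_seq j) = (unit_seq j :: nat \<Rightarrow> 'k)"
        by (auto simp: flip_def unit_seq_def)
      then show ?thesis using False by (simp add: flip_def)
    qed
    then show ?thesis
      unfolding M2[OF unit_vecs] by (simp add: seq_scale_def diag flip: M_def) (simp add: M_def diag)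
  qed
  ultimately show ?case using a2 b2 by blast
qed

end

context block_sum
begin

text \<open>
  The averaged maps for the different groups are combined into one: a vector is cut into its pieces on the groups, piece m
  is sent to slice m of l_p, and only the coordinates in group m are kept on the way back. The p-th
  powers of the pieces add up on both sides, so the constants do not depend on the number of groups.
\<close>

lemma diagonal_factors:
  fixes \<alpha> \<beta> :: "(nat \<Rightarrow> 'k::real_normed_field) \<Rightarrow> nat \<Rightarrow> 'k"
  assumes \<beta>: "power_bounded p F suminf b \<beta>" and \<alpha>: "power_bounded p suminf F a \<alpha>"
  shows "factors (\<lambda>j. \<alpha> (\<beta> (unit_seq j)) j)"
proof -
  define t where "t j = \<alpha> (\<beta> (unit_seq j)) j" for j
  have "\<exists>\<alpha>' \<beta>'. power_bounded p F suminf b \<beta>' \<and> power_bounded p suminf F a \<alpha>' \<and>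
     (\<forall>c\<in>vecs G. \<forall>j\<in>{n. grp n = m}. \<alpha>' (\<beta>' (flip j c)) = flip j (\<alpha>' (\<beta>' c))) \<and>
     (\<forall>j. \<alpha>' (\<beta>' (unit_seq j)) j = t j)" for m
    using average_flips[OF \<beta> \<alpha> finite_grp[of m]] unfolding t_def .
  then obtain A B where B: "\<And>m. power_bounded p F suminf b (B m)" and A: "\<And>m. power_bounded p suminf F a (A m)"
    and comm: "\<And>m c j. c \<in> vecs G \<Longrightarrow> grp j = m \<Longrightarrow> A m (B m (flip j c)) = flip j (A m (B m c))"
    and diag: "\<And>m j. A m (B m (unit_seq j)) j = t j"
    by (simp only: mem_Collect_eq ball_simps) metis
  have off: "A m (B m (unit_seq i)) j = 0" if "grp j = m" "i \<noteq> j" for m i j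
  proof -
    have "flip j (unit_seq i) = (unit_seq i :: nat \<Rightarrow> 'k)"
      using that(2) by (auto simp: flip_def unit_seq_def)
    then have "A m (B m (unit_seq i)) j = flip j (A m (B m (unit_seq i))) j"
      using comm[OF unit_vecs[of i] that(1)] by (simp only:)
    then have "A m (B m (unit_seq i)) j + A m (B m (unit_seq i)) j = 0"
      by (simp add: flip_def)
    then show ?thesis by (metis mult_2 mult_eq_0_iff zero_neq_numeral)
  qed
  have on_block: "A m (B m (block m c)) j = t j * c j" if c: "c \<in> vecs G" and j: "grp j = m" for m j c
  proof -
    have M: "bounded_map G G ((a * b) powr (1 / p)) (\<lambda>x. A m (B m x))"
      by (rule power_bounded_imp[OF gauge_p_axioms gauge_p_axioms power_bounded_compose[OF B A]])
    have "block m c = (\<Sum>i | grp i = m. seq_scale (c i) (unit_seq i))"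
    proof
      fix n
      have "(\<Sum>i | grp i = m. seq_scale (c i) (unit_seq i)) n = (\<Sum>i | grp i = m. if i = n then c i else 0)"
        unfolding sum_fun_at by (rule sum.cong) (auto simp: seq_scale_def unit_seq_def)
      then show "block m c n = (\<Sum>i | grp i = m. seq_scale (c i) (unit_seq i)) n"
        using finite_grp[of m] by simp
    qed
    then have "A m (B m (block m c)) = A m (B m (\<Sum>i | grp i = m. seq_scale (c i) (unit_seq i)))"
      by (simp only:)
    also have "\<dots> = (\<Sum>i | grp i = m. A m (B m (seq_scale (c i) (unit_seq i))))"
      by (rule bounded_map_sum[OF normed_sequences_axioms M finite_grp]) (intro vecs_scale unit_vecs)
    also have "\<dots> = (\<Sum>i | grp i = m. seq_scale (c i) (A m (B m (unit_seq i))))"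
      by (rule sum.cong[OF refl]) (rule bounded_map_scale[OF M unit_vecs])
    finally have "A m (B m (block m c)) j = (\<Sum>i | grp i = m. c i * A m (B m (unit_seq i)) j)"
      by (simp only: sum_fun_at seq_scale_def)
    also have "\<dots> = (\<Sum>i | grp i = m. if i = j then c j * t j else 0)"
      by (rule sum.cong) (auto simp: off[OF j] diag)
    finally show ?thesis using finite_grp[of m] j by (simp add: mult.commute)
  qed
  define B' where "B' c = glue (\<lambda>m. B m (block m c))" for c
  define A' where "A' s = (\<lambda>j. A (grp j) (slice (grp j) s) j)" for s
  have b: "power_bounded p F suminf (b * K) B'"
  proof (rule power_boundedI)
    show "0 \<le> b * K" using power_bounded_nonneg[OF \<beta>] K1 by simp
  next
    fix x :: "nat \<Rightarrow> 'k" assume x: "x \<in> vecs G"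
    have "suminf (pw p (B' x)) \<le> (\<Sum>m. ennreal b * F (pw p (block m x)))"
      unfolding B'_def suminf_glue by (intro suminf_le power_bounded_le[OF B] block_vecs x) auto
    also have "\<dots> = ennreal b * (\<Sum>m. F (pw p (block m x)))" by (rule ennreal_suminf_cmult)
    also have "\<dots> \<le> ennreal b * (ennreal K * F (pw p x))" by (intro mult_left_mono blocks_pw_le) simp
    also have "\<dots> = ennreal (b * K) * F (pw p x)"
      using power_bounded_nonneg[OF \<beta>] K1 by (simp add: ennreal_mult mult.assoc)
    finally show "suminf (pw p (B' x)) \<le> ennreal (b * K) * F (pw p x)" .
  next
    fix x y :: "nat \<Rightarrow> 'k" assume x: "x \<in> vecs G" and y: "y \<in> vecs G"
    have "block m (x + y) = block m x + block m y" for m by (rule ext) simp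
    then show "B' (x + y) = B' x + B' y"
      unfolding B'_def by (simp only: power_bounded_add[OF B] block_vecs x y glue_add)
  next
    fix c :: 'k and x :: "nat \<Rightarrow> 'k" assume x: "x \<in> vecs G"
    have "block m (seq_scale c x) = seq_scale c (block m x)" for m by (rule ext) (simp add: seq_scale_def)
    then show "B' (seq_scale c x) = seq_scale c (B' x)"
      unfolding B'_def by (simp only: power_bounded_scale[OF B] block_vecs x glue_scale)
  qed
  have a: "power_bounded p suminf F a A'"
  proof (rule power_boundedI)
    show "0 \<le> a" by (rule power_bounded_nonneg[OF \<alpha>])
  next
    fix s :: "nat \<Rightarrow> 'k" assume s: "s \<in> vecs (lp_gauged p)"
    have "pw p (A' s) n = (\<Sum>m. if grp n = m then pw p (A m (slice m s)) n else 0)" for n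
    proof -
      have "(\<Sum>m. if grp n = m then pw p (A m (slice m s)) n else 0)
          = (\<Sum>m\<in>{grp n}. if grp n = m then pw p (A m (slice m s)) n else 0)"
        by (rule suminf_finite) auto
      then show ?thesis by (simp add: A'_def pw_def)
    qed
    then have "pw p (A' s) = (\<lambda>n. \<Sum>m. if grp n = m then pw p (A m (slice m s)) n else 0)" by (rule ext)
    then have "F (pw p (A' s)) \<le> (\<Sum>m. F (\<lambda>n. if grp n = m then pw p (A m (slice m s)) n else 0))"
      by (simp only: countably_subadditive)
    also have "\<dots> \<le> (\<Sum>m. F (pw p (A m (slice m s))))"
      by (intro suminf_le mono) auto
    also have "\<dots> \<le> (\<Sum>m. ennreal a * suminf (pw p (slice m s)))"
      by (intro suminf_le power_bounded_le[OF A] slice_vecs s) auto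
    also have "\<dots> = ennreal a * suminf (pw p s)"
      by (simp only: ennreal_suminf_cmult suminf_slices)
    finally show "F (pw p (A' s)) \<le> ennreal a * suminf (pw p s)" .
  next
    fix x y :: "nat \<Rightarrow> 'k" assume x: "x \<in> vecs (lp_gauged p)" and y: "y \<in> vecs (lp_gauged p)"
    show "A' (x + y) = A' x + A' y"
      unfolding A'_def
      by (rule ext) (simp only: slice_add power_bounded_add[OF A] slice_vecs x y plus_fun_apply)
  next
    fix c :: 'k and x :: "nat \<Rightarrow> 'k" assume x: "x \<in> vecs (lp_gauged p)"
    show "A' (seq_scale c x) = seq_scale c (A' x)"
      unfolding A'_def
      by (rule ext) (simp only: slice_scale power_bounded_scale[OF A] slice_vecs x, simp only: seq_scale_def)
  qed
  have "A' (B' c) = (\<lambda>j. t j * c j)" if "c \<in> vecs G" for c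
    unfolding A'_def B'_def slice_glue using on_block[OF that] by (intro ext) simp
  then have "factors t" unfolding factors_def using a b by blast
  then show ?thesis unfolding t_def .
qed

end

section \<open>The decomposition method\<close>

definition bounded_linear_map ::
    "'k::real_normed_field seq_space \<Rightarrow> 'k seq_space \<Rightarrow> ((nat \<Rightarrow> 'k) \<Rightarrow> (nat \<Rightarrow> 'k)) \<Rightarrow> bool" where
  "bounded_linear_map X Y T \<longleftrightarrow> (\<exists>C. bounded_map X Y C T)"

lemma bounded_linear_map_compose:
  "bounded_linear_map Y Z S \<Longrightarrow> bounded_linear_map X Y T \<Longrightarrow> bounded_linear_map X Z (\<lambda>x. S (T x))"
  unfolding bounded_linear_map_def by (elim exE) (rule exI, rule bounded_map_compose)

lemma bounded_linear_map_id: "bounded_linear_map X X (\<lambda>x. x)"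
  unfolding bounded_linear_map_def by (rule exI[of _ 1], rule bounded_mapI) auto

lemma bounded_linear_map_add:
  assumes Y: "normed_sequences Y" and "bounded_linear_map X Y S" "bounded_linear_map X Y T"
  shows "bounded_linear_map X Y (\<lambda>x. S x + T x)"
proof -
  interpret Y: normed_sequences Y by (rule Y)
  obtain C D where S: "bounded_map X Y C S" and T: "bounded_map X Y D T"
    using assms unfolding bounded_linear_map_def by blast
  have "bounded_map X Y (C + D) (\<lambda>x. S x + T x)"
  proof (rule bounded_mapI)
    show "0 \<le> C + D" using bounded_map_nonneg[OF S] bounded_map_nonneg[OF T] by simp
  next
    fix x assume x: "x \<in> vecs X"
    have "vnorm Y (S x + T x) \<le> vnorm Y (S x) + vnorm Y (T x)"
      by (intro Y.norm_add bounded_map_vecs[OF S x] bounded_map_vecs[OF T x])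
    then have "vnorm Y (S x + T x) \<le> (C + D) * vnorm X x"
      using bounded_map_norm[OF S x] bounded_map_norm[OF T x] unfolding distrib_right by linarith
    then show "S x + T x \<in> vecs Y \<and> vnorm Y (S x + T x) \<le> (C + D) * vnorm X x"
      using Y.vecs_add[OF bounded_map_vecs[OF S x] bounded_map_vecs[OF T x]] by blast
  next
    fix x y assume "x \<in> vecs X" "y \<in> vecs X"
    then show "S (x + y) + T (x + y) = S x + T x + (S y + T y)"
      by (simp only: bounded_map_add[OF S] bounded_map_add[OF T] add_ac)
  next
    fix c x assume "x \<in> vecs X"
    then show "S (seq_scale c x) + T (seq_scale c x) = seq_scale c (S x + T x)"
      by (simp only: bounded_map_scale[OF S] bounded_map_scale[OF T] scale_add)
  qed
  then show ?thesis unfolding bounded_linear_map_def by blast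
qed

lemma bounded_linear_map_scale:
  assumes Y: "normed_sequences Y"
  shows "bounded_linear_map Y Y (seq_scale d)"
proof -
  interpret Y: normed_sequences Y by (rule Y)
  have "bounded_map Y Y (norm d) (seq_scale d)"
    by (rule bounded_mapI) (auto simp: Y.vecs_scale Y.norm_scale scale_add scale_scale mult.commute simp del: plus_fun_apply)
  then show ?thesis unfolding bounded_linear_map_def by blast
qed

lemma bounded_linear_map_diff:
  assumes Y: "normed_sequences Y" and S: "bounded_linear_map X Y S" and T: "bounded_linear_map X Y T"
  shows "bounded_linear_map X Y (\<lambda>x. S x - T x)"
proof -
  have "(\<lambda>x. S x - T x) = (\<lambda>x. S x + seq_scale (-1) (T x))"
    by (rule ext, rule ext) (simp add: seq_scale_def)
  then show ?thesis
    using bounded_linear_map_add[OF Y S bounded_linear_map_compose[OF bounded_linear_map_scale[OF Y, of "-1"] T]]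
    by (simp only:)
qed

lemma
  assumes "bounded_linear_map X Y T"
  shows bounded_linear_map_vecs: "x \<in> vecs X \<Longrightarrow> T x \<in> vecs Y"
    and bounded_linear_map_plus: "x \<in> vecs X \<Longrightarrow> y \<in> vecs X \<Longrightarrow> T (x + y) = T x + T y"
    and bounded_linear_map_minus: "normed_sequences X \<Longrightarrow> x \<in> vecs X \<Longrightarrow> y \<in> vecs X \<Longrightarrow> T (x - y) = T x - T y"
  using assms bounded_map_vecs bounded_map_add bounded_map_diff unfolding bounded_linear_map_def by blast+

lemma ennreal_suminf_Suc: "(\<Sum>i. f i) = f 0 + (\<Sum>i. f (Suc i))" for f :: "nat \<Rightarrow> ennreal"
  using suminf_offset[of f 1] by (simp add: add.commute)

lemma slice_eqI: "s = t" if "\<And>i. slice i s = slice i t"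
proof -
  have "glue (\<lambda>i. slice i s) = glue (\<lambda>i. slice i t)" using that by simp
  then show ?thesis by simp
qed

lemma slice_diff: "slice i (x - y) = slice i x - slice i y"
  by (rule ext) (simp add: slice_def)

lemma bounded_linear_map_if_power_bounded:
  "gauge_p F p \<Longrightarrow> gauge_p H p \<Longrightarrow> power_bounded p F H C T \<Longrightarrow> bounded_linear_map (gauge_space p F) (gauge_space p H) T"
  unfolding bounded_linear_map_def using power_bounded_imp by blast

definition slice_first :: "(nat \<Rightarrow> 'k::real_normed_field) \<Rightarrow> nat \<Rightarrow> 'k" where
  "slice_first x = glue (\<lambda>i. case i of 0 \<Rightarrow> x | Suc i \<Rightarrow> 0)"

definition slice_shift :: "(nat \<Rightarrow> 'k::real_normed_field) \<Rightarrow> nat \<Rightarrow> 'k" where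
  "slice_shift s = glue (\<lambda>i. case i of 0 \<Rightarrow> 0 | Suc i \<Rightarrow> slice i s)"

definition slice_drop :: "(nat \<Rightarrow> 'k::real_normed_field) \<Rightarrow> nat \<Rightarrow> 'k" where
  "slice_drop s = glue (\<lambda>i. slice (Suc i) s)"

definition slice_map :: "((nat \<Rightarrow> 'k::real_normed_field) \<Rightarrow> nat \<Rightarrow> 'k) \<Rightarrow> (nat \<Rightarrow> 'k) \<Rightarrow> nat \<Rightarrow> 'k" where
  "slice_map T s = glue (\<lambda>i. T (slice i s))"

lemma slice_simps [simp]:
  "slice 0 (slice_first x) = x" "slice (Suc i) (slice_first x) = 0"
  "slice 0 (slice_shift s) = 0" "slice (Suc i) (slice_shift s) = slice i s"
  "slice i (slice_drop s) = slice (Suc i) s" "slice i (slice_map T s) = T (slice i s)"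
  by (simp_all add: slice_first_def slice_shift_def slice_drop_def slice_map_def zero_fun_def)

lemma suminf_pw_zero [simp]: "suminf (pw p (0 :: nat \<Rightarrow> 'k::real_normed_field)) = 0"
  by (simp add: pw_def)

context
  fixes p :: real
  assumes p1: "1 \<le> p"
begin

interpretation lp: gauge_p suminf p
  by (intro gauge_p.intro gauge_suminf gauge_p_axioms.intro p1)

lemma lp_map_if_power_bounded:
  fixes T :: "(nat \<Rightarrow> 'k::real_normed_field) \<Rightarrow> nat \<Rightarrow> 'k"
  shows "power_bounded p suminf suminf C T \<Longrightarrow> bounded_linear_map (lp_gauged p) (lp_gauged p) T"
  by (rule bounded_linear_map_if_power_bounded[OF lp.gauge_p_axioms lp.gauge_p_axioms])

lemma slice_0_map: "bounded_linear_map (lp_gauged p) (lp_gauged p) (slice 0 :: (nat \<Rightarrow> 'k::real_normed_field) \<Rightarrow> _)"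
  by (rule lp_map_if_power_bounded[of 1], rule power_boundedI)
     (simp_all add: suminf_slice_le slice_add slice_scale del: plus_fun_apply)

lemma slice_first_map: "bounded_linear_map (lp_gauged p) (lp_gauged p) (slice_first :: (nat \<Rightarrow> 'k::real_normed_field) \<Rightarrow> _)"
proof (rule lp_map_if_power_bounded[of 1], rule power_boundedI)
  fix x :: "nat \<Rightarrow> 'k"
  have "suminf (pw p (slice_first x)) = suminf (pw p x)"
    unfolding suminf_slices[of p "slice_first x", symmetric] by (subst ennreal_suminf_Suc) simp
  then show "suminf (pw p (slice_first x)) \<le> ennreal 1 * suminf (pw p x)" by simp
next
  fix x y :: "nat \<Rightarrow> 'k"
  show "slice_first (x + y) = slice_first x + slice_first y"
    by (rule ext) (simp add: slice_first_def glue_def split: prod.split nat.split)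
next
  fix c and x :: "nat \<Rightarrow> 'k"
  show "slice_first (seq_scale c x) = seq_scale c (slice_first x)"
    by (rule ext) (simp add: slice_first_def glue_def seq_scale_def split: prod.split nat.split)
qed simp

lemma slice_shift_map: "bounded_linear_map (lp_gauged p) (lp_gauged p) (slice_shift :: (nat \<Rightarrow> 'k::real_normed_field) \<Rightarrow> _)"
proof (rule lp_map_if_power_bounded[of 1], rule power_boundedI)
  fix x :: "nat \<Rightarrow> 'k"
  have "suminf (pw p (slice_shift x)) = suminf (pw p x)"
    unfolding suminf_slices[of p "slice_shift x", symmetric] suminf_slices[of p x, symmetric]
    by (subst ennreal_suminf_Suc) simp
  then show "suminf (pw p (slice_shift x)) \<le> ennreal 1 * suminf (pw p x)" by simp
next
  fix x y :: "nat \<Rightarrow> 'k"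
  show "slice_shift (x + y) = slice_shift x + slice_shift y"
    by (rule ext) (simp add: slice_shift_def glue_def slice_def split: prod.split nat.split)
next
  fix c and x :: "nat \<Rightarrow> 'k"
  show "slice_shift (seq_scale c x) = seq_scale c (slice_shift x)"
    by (rule ext) (simp add: slice_shift_def glue_def slice_def seq_scale_def split: prod.split nat.split)
qed simp

lemma slice_drop_map: "bounded_linear_map (lp_gauged p) (lp_gauged p) (slice_drop :: (nat \<Rightarrow> 'k::real_normed_field) \<Rightarrow> _)"
proof (rule lp_map_if_power_bounded[of 1], rule power_boundedI)
  fix x :: "nat \<Rightarrow> 'k"
  have "suminf (pw p (slice_drop x)) = (\<Sum>i. suminf (pw p (slice (Suc i) x)))"
    unfolding slice_drop_def by (rule suminf_glue)
  also have "\<dots> \<le> (\<Sum>i. suminf (pw p (slice i x)))"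
    by (subst (2) ennreal_suminf_Suc) (rule add_increasing, simp_all)
  finally show "suminf (pw p (slice_drop x)) \<le> ennreal 1 * suminf (pw p x)" by (simp add: suminf_slices)
next
  fix x y :: "nat \<Rightarrow> 'k"
  show "slice_drop (x + y) = slice_drop x + slice_drop y"
    by (rule ext) (simp add: slice_drop_def glue_def slice_def split: prod.split)
next
  fix c and x :: "nat \<Rightarrow> 'k"
  show "slice_drop (seq_scale c x) = seq_scale c (slice_drop x)"
    by (rule ext) (simp add: slice_drop_def glue_def slice_def seq_scale_def split: prod.split)
qed simp

lemma slice_map_map:
  fixes T :: "(nat \<Rightarrow> 'k::real_normed_field) \<Rightarrow> nat \<Rightarrow> 'k"
  assumes "bounded_linear_map (lp_gauged p) (lp_gauged p) T"
  shows "bounded_linear_map (lp_gauged p) (lp_gauged p) (slice_map T)"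
proof -
  obtain C0 where "bounded_map (lp_gauged p) (lp_gauged p) C0 T"
    using assms unfolding bounded_linear_map_def by blast
  then obtain C where T: "power_bounded p suminf suminf C T"
    using power_bounded_if[OF lp.gauge_p_axioms lp.gauge_p_axioms] by blast
  have "power_bounded p suminf suminf C (slice_map T)"
  proof (rule power_boundedI)
    show "0 \<le> C" by (rule power_bounded_nonneg[OF T])
  next
    fix x :: "nat \<Rightarrow> 'k" assume x: "x \<in> vecs (lp_gauged p)"
    have "suminf (pw p (slice_map T x)) \<le> (\<Sum>i. ennreal C * suminf (pw p (slice i x)))"
      unfolding slice_map_def suminf_glue by (intro suminf_le power_bounded_le[OF T] slice_vecs x) auto
    then show "suminf (pw p (slice_map T x)) \<le> ennreal C * suminf (pw p x)"
      by (simp only: ennreal_suminf_cmult suminf_slices)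
  next
    fix x y :: "nat \<Rightarrow> 'k" assume x: "x \<in> vecs (lp_gauged p)" and y: "y \<in> vecs (lp_gauged p)"
    show "slice_map T (x + y) = slice_map T x + slice_map T y"
      unfolding slice_map_def by (simp only: slice_add power_bounded_add[OF T] slice_vecs x y glue_add)
  next
    fix c :: 'k and x :: "nat \<Rightarrow> 'k" assume x: "x \<in> vecs (lp_gauged p)"
    show "slice_map T (seq_scale c x) = seq_scale c (slice_map T x)"
      unfolding slice_map_def by (simp only: slice_scale power_bounded_scale[OF T] slice_vecs x glue_scale)
  qed
  then show ?thesis by (rule lp_map_if_power_bounded)
qed

text \<open>
  Pelczynski's decomposition method with explicit maps. Let L = l_p, which is the l_p-sum of its slices,
  and let \<open>\<pi> = \<beta> \<alpha>\<close> be the projection of L onto the copy of X. Since L is complemented in X, X is isomorphic to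
  X \<oplus> L: the coefficient sequence \<open>\<rho> c\<close> is split into its slice 0, which stays in X, and the others, which
  make up the second summand. On the other hand X \<oplus> L is isomorphic to L: every slice of L is the sum of
  its images under \<open>\<pi>\<close> and under \<open>1 - \<pi>\<close>, and moving all the parts of the first kind up by one slice
  makes room for X as the part of the first kind in slice 0.
\<close>

lemma decomposition_method:
  fixes X :: "'k::real_normed_field seq_space"
  assumes X: "normed_sequences X"
    and \<beta>: "bounded_linear_map X (lp_gauged p) \<beta>" and \<alpha>: "bounded_linear_map (lp_gauged p) X \<alpha>"
    and \<alpha>\<beta>: "\<And>x. x \<in> vecs X \<Longrightarrow> \<alpha> (\<beta> x) = x"
    and \<rho>: "bounded_linear_map X (lp_gauged p) \<rho>" and \<iota>: "bounded_linear_map (lp_gauged p) X \<iota>"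
    and \<rho>\<iota>: "\<And>z. z \<in> vecs (lp_gauged p) \<Longrightarrow> \<rho> (\<iota> z) = z"
  shows "isomorphic_spaces X (lp_gauged p)"
proof -
  let ?L = "lp_gauged p :: 'k seq_space"
  have L: "normed_sequences ?L" by (rule lp.normed_sequences_axioms)
  interpret X: normed_sequences X by (rule X)
  define \<pi> where "\<pi> z = \<beta> (\<alpha> z)" for z
  have \<pi>: "bounded_linear_map ?L ?L \<pi>"
    unfolding \<pi>_def by (rule bounded_linear_map_compose[OF \<beta> \<alpha>])
  have \<alpha>\<pi>: "\<alpha> (\<pi> z) = \<alpha> z" if "z \<in> vecs ?L" for z
    unfolding \<pi>_def by (rule \<alpha>\<beta>[OF bounded_linear_map_vecs[OF \<alpha> that]])
  have \<pi>\<pi>: "\<pi> (\<pi> z) = \<pi> z" if "z \<in> vecs ?L" for z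
    using \<alpha>\<pi>[OF that] unfolding \<pi>_def[of "\<pi> z"] \<pi>_def[of z] by (simp only: \<pi>_def)
  have \<pi>\<beta>: "\<pi> (\<beta> x) = \<beta> x" if "x \<in> vecs X" for x
    unfolding \<pi>_def by (simp only: \<alpha>\<beta>[OF that])
  note vs = bounded_linear_map_vecs[OF \<alpha>] bounded_linear_map_vecs[OF \<beta>] bounded_linear_map_vecs[OF \<rho>]
    bounded_linear_map_vecs[OF \<iota>] bounded_linear_map_vecs[OF \<pi>] bounded_linear_map_vecs[OF slice_map_map[OF \<pi>]]
    bounded_linear_map_vecs[OF slice_first_map] bounded_linear_map_vecs[OF slice_shift_map]
    bounded_linear_map_vecs[OF slice_drop_map] slice_vecs X.vecs_add X.vecs_diff lp.vecs_add lp.vecs_diff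
  \<comment> \<open>\<open>r c\<close> and \<open>D c\<close> are the components of c in X \<open>\<oplus>\<close> L, and \<open>\<phi>\<close> continues with the shift; \<open>\<alpha> (slice 0 z)\<close> and \<open>d z\<close> undo the shift, and \<open>\<psi>\<close> reassembles c.\<close>
  define r where "r c = c - \<iota> (\<rho> c) + \<iota> (slice 0 (\<rho> c))" for c
  define D where "D c = slice_drop (\<rho> c)" for c
  define \<phi> where "\<phi> c = slice_first (\<beta> (r c)) + (D c - slice_map \<pi> (D c)) + slice_shift (slice_map \<pi> (D c))" for c
  define d where "d z = z - slice_map \<pi> z + slice_map \<pi> (slice_drop z)" for z
  define s where "s z = slice_first (\<rho> (\<alpha> (slice 0 z))) + slice_shift (d z)" for z
  define \<psi> where "\<psi> z = \<alpha> (slice 0 z) - \<iota> (\<rho> (\<alpha> (slice 0 z))) + \<iota> (s z)" for z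
  have rm: "bounded_linear_map X X r"
    unfolding r_def
    by (intro bounded_linear_map_add[OF X] bounded_linear_map_diff[OF X] bounded_linear_map_id
        bounded_linear_map_compose[OF \<iota>] bounded_linear_map_compose[OF slice_0_map] \<rho>)
  have Dm: "bounded_linear_map X ?L D"
    unfolding D_def by (intro bounded_linear_map_compose[OF slice_drop_map] \<rho>)
  have \<phi>m: "bounded_linear_map X ?L \<phi>"
    unfolding \<phi>_def
    by (intro bounded_linear_map_add[OF L] bounded_linear_map_diff[OF L] Dm
        bounded_linear_map_compose[OF slice_shift_map] bounded_linear_map_compose[OF slice_map_map[OF \<pi>]]
        bounded_linear_map_compose[OF slice_first_map] bounded_linear_map_compose[OF \<beta>] rm)
  have dm: "bounded_linear_map ?L ?L d"
    unfolding d_def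
    by (intro bounded_linear_map_add[OF L] bounded_linear_map_diff[OF L] bounded_linear_map_id
        slice_map_map[OF \<pi>] bounded_linear_map_compose[OF slice_map_map[OF \<pi>]] slice_drop_map)
  have am: "bounded_linear_map ?L X (\<lambda>z. \<alpha> (slice 0 z))"
    by (intro bounded_linear_map_compose[OF \<alpha>] slice_0_map)
  have sm: "bounded_linear_map ?L ?L s"
    unfolding s_def
    by (intro bounded_linear_map_add[OF L] bounded_linear_map_compose[OF slice_first_map]
        bounded_linear_map_compose[OF \<rho>] am bounded_linear_map_compose[OF slice_shift_map] dm)
  have \<psi>m: "bounded_linear_map ?L X \<psi>"
    unfolding \<psi>_def
    by (intro bounded_linear_map_add[OF X] bounded_linear_map_diff[OF X] bounded_linear_map_compose[OF \<iota>]
        bounded_linear_map_compose[OF \<rho>] am sm)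
  have g1: "a - b + c - c + b = a" for a b c :: "nat \<Rightarrow> 'k" by (rule ext) simp
  have g2: "a - a + b = b" "a + 0 = a" "0 + a = a" "a + (b - b) = a" for a b :: "nat \<Rightarrow> 'k" by (rule ext, simp)+
  have g3: "a + (b - c) + 0 - (a + (c - c)) + c = b" for a b c :: "nat \<Rightarrow> 'k" by (rule ext) simp
  have g4: "0 + (b - c) + e - (c - c + e) + c = b" for b c e :: "nat \<Rightarrow> 'k" by (rule ext) simp
  have \<psi>\<phi>: "\<psi> (\<phi> c) = c" if c: "c \<in> vecs X" for c
  proof -
    note m = bounded_linear_map_vecs[OF rm c] bounded_linear_map_vecs[OF Dm c]
    note [simp del] = plus_fun_apply
    have sl: "slice 0 (\<phi> c) = \<beta> (r c) + (slice 0 (D c) - \<pi> (slice 0 (D c))) + 0"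
      "slice (Suc i) (\<phi> c) = 0 + (slice (Suc i) (D c) - \<pi> (slice (Suc i) (D c))) + \<pi> (slice i (D c))" for i
      unfolding \<phi>_def slice_add slice_diff slice_simps by (rule refl)+
    have \<pi>0: "\<pi> (slice 0 (\<phi> c)) = \<beta> (r c) + (\<pi> (slice 0 (D c)) - \<pi> (slice 0 (D c)))"
      unfolding sl g2(2) by (simp only: bounded_linear_map_plus[OF \<pi>] bounded_linear_map_minus[OF \<pi> L] vs m \<pi>\<pi> \<pi>\<beta>)
    have \<pi>S: "\<pi> (slice (Suc i) (\<phi> c)) = (\<pi> (slice (Suc i) (D c)) - \<pi> (slice (Suc i) (D c))) + \<pi> (slice i (D c))" for i
      unfolding sl g2(3) by (simp only: bounded_linear_map_plus[OF \<pi>] bounded_linear_map_minus[OF \<pi> L] vs m \<pi>\<pi>)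
    have a0: "\<alpha> (slice 0 (\<phi> c)) = r c"
    proof -
      have "\<alpha> (slice 0 (\<phi> c)) = r c + (\<alpha> (slice 0 (D c)) - \<alpha> (slice 0 (D c)))"
        unfolding sl g2(2) by (simp only: bounded_linear_map_plus[OF \<alpha>] bounded_linear_map_minus[OF \<alpha> L] vs m \<alpha>\<pi> \<alpha>\<beta>)
      then show ?thesis by (simp only: g2)
    qed
    have d0: "d (\<phi> c) = D c"
    proof (rule slice_eqI)
      fix i
      show "slice i (d (\<phi> c)) = slice i (D c)"
      proof (cases i)
        case 0
        have "slice 0 (d (\<phi> c)) = slice 0 (\<phi> c) - \<pi> (slice 0 (\<phi> c)) + \<pi> (slice (Suc 0) (\<phi> c))"
          unfolding d_def slice_add slice_diff slice_simps by (rule refl)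
        also have "\<dots> = slice 0 (D c)"
          unfolding \<pi>0 \<pi>S g2(1) unfolding sl by (rule g3)
        finally show ?thesis using 0 by (simp only:)
      next
        case (Suc k)
        have "slice (Suc k) (d (\<phi> c)) = slice (Suc k) (\<phi> c) - \<pi> (slice (Suc k) (\<phi> c)) + \<pi> (slice (Suc (Suc k)) (\<phi> c))"
          unfolding d_def slice_add slice_diff slice_simps by (rule refl)
        also have "\<dots> = slice (Suc k) (D c)"
          unfolding \<pi>S[of "Suc k"] g2(1) unfolding \<pi>S[of k] unfolding sl by (rule g4)
        finally show ?thesis using Suc by (simp only:)
      qed
    qed
    have \<rho>r: "\<rho> (r c) = slice 0 (\<rho> c)"
    proof -
      have "\<rho> (r c) = \<rho> c - \<rho> c + slice 0 (\<rho> c)"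
        unfolding r_def
        by (simp only: bounded_linear_map_plus[OF \<rho>] bounded_linear_map_minus[OF \<rho> X] vs c \<rho>\<iota>)
      then show ?thesis by (simp only: g2)
    qed
    have s0: "s (\<phi> c) = \<rho> c"
      unfolding s_def a0 d0 \<rho>r
    proof (rule slice_eqI)
      fix i
      show "slice i (slice_first (slice 0 (\<rho> c)) + slice_shift (D c)) = slice i (\<rho> c)"
        by (cases i) (simp_all only: slice_add slice_simps D_def g2)
    qed
    show ?thesis
      unfolding \<psi>_def s0 a0 \<rho>r unfolding r_def by (rule g1)
  qed
  have \<phi>\<psi>: "\<phi> (\<psi> z) = z" if z: "z \<in> vecs ?L" for z
  proof -
    let ?a = "\<alpha> (slice 0 z)"
    note m = bounded_linear_map_vecs[OF dm z] bounded_linear_map_vecs[OF sm z]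
    have \<rho>\<psi>: "\<rho> (\<psi> z) = s z"
    proof -
      have "\<rho> (\<psi> z) = \<rho> ?a - \<rho> ?a + s z"
        unfolding \<psi>_def
        by (simp only: bounded_linear_map_plus[OF \<rho>] bounded_linear_map_minus[OF \<rho> X] vs z m \<rho>\<iota>)
      then show ?thesis by (simp only: g2)
    qed
    have s0: "slice 0 (s z) = \<rho> ?a" and D0: "D (\<psi> z) = d z"
    proof -
      show "slice 0 (s z) = \<rho> ?a" unfolding s_def by (simp only: slice_add slice_simps g2)
      show "D (\<psi> z) = d z"
        unfolding D_def \<rho>\<psi>
        by (rule slice_eqI) (simp only: s_def slice_add slice_simps g2)
    qed
    have r0: "r (\<psi> z) = ?a"
      unfolding r_def \<rho>\<psi> s0 unfolding \<psi>_def by (rule g1)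
    have \<pi>d: "\<pi> (slice i (d z)) = \<pi> (slice (Suc i) z)" for i
    proof -
      have "slice i (d z) = slice i z - \<pi> (slice i z) + \<pi> (slice (Suc i) z)"
        unfolding d_def slice_add slice_diff slice_simps by (rule refl)
      then have "\<pi> (slice i (d z)) = \<pi> (slice i z) - \<pi> (slice i z) + \<pi> (slice (Suc i) z)"
        by (simp only: bounded_linear_map_plus[OF \<pi>] bounded_linear_map_minus[OF \<pi> L] vs z \<pi>\<pi>)
      then show ?thesis by (simp only: g2)
    qed
    have g5: "a + (b - a + c - c) + 0 = b" "0 + (b - a + c - c) + a = b" for a b c :: "nat \<Rightarrow> 'k" by (rule ext, simp)+
    have sd: "slice i (d z) = slice i z - \<pi> (slice i z) + \<pi> (slice (Suc i) z)" for i
      unfolding d_def slice_add slice_diff slice_simps by (rule refl)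
    show ?thesis
      unfolding \<phi>_def r0 D0
    proof (rule slice_eqI)
      fix i
      show "slice i (slice_first (\<beta> ?a) + (d z - slice_map \<pi> (d z)) + slice_shift (slice_map \<pi> (d z))) = slice i z"
      proof (cases i)
        case 0
        then show ?thesis
          unfolding slice_add slice_diff slice_simps 0 \<pi>d unfolding sd unfolding \<pi>_def[symmetric] by (simp only: g5)
      next
        case (Suc k)
        then show ?thesis
          unfolding slice_add slice_diff slice_simps Suc \<pi>d unfolding sd by (simp only: g5)
      qed
    qed
  qed
  obtain C1 C2 where "bounded_map X ?L C1 \<phi>" "bounded_map ?L X C2 \<psi>"
    using \<phi>m \<psi>m unfolding bounded_linear_map_def by blast
  then show ?thesis
    by (rule isomorphic_spacesI[OF X L _ _ \<psi>\<phi> \<phi>\<psi>])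
qed

end

section \<open>Copies of l_p inside an l_p-sum of finite blocks\<close>

context block_sum
begin

text \<open>
  For an injective b, \<open>spread b\<close> embeds l_p along the unit vectors with indices b 0, b 1, ... If these lie in
  different groups, \<open>sample b\<close> is bounded and inverts it, so that the copy of l_p is complemented.
\<close>

definition spread :: "(nat \<Rightarrow> nat) \<Rightarrow> (nat \<Rightarrow> 'k::real_normed_field) \<Rightarrow> nat \<Rightarrow> 'k" where
  "spread b z = (\<lambda>j. if j \<in> range b then z (inv b j) else 0)"

definition sample :: "(nat \<Rightarrow> nat) \<Rightarrow> (nat \<Rightarrow> 'k) \<Rightarrow> nat \<Rightarrow> 'k" where
  "sample b x = (\<lambda>m. x (b m))"

lemma spread_power_bounded:
  fixes b :: "nat \<Rightarrow> nat"
  assumes b: "inj b"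
  shows "power_bounded p suminf F 1 (spread b :: (nat \<Rightarrow> 'k::real_normed_field) \<Rightarrow> _)"
proof (rule power_boundedI)
  fix z :: "nat \<Rightarrow> 'k"
  have "pw p (spread b z) j = (\<Sum>m. if j = b m then pw p z m else 0)" for j
  proof (cases "j \<in> range b")
    case True
    then obtain m where m: "j = b m" by blast
    have "(\<Sum>m. if j = b m then pw p z m else 0) = (\<Sum>m\<in>{m}. if j = b m then pw p z m else 0)"
      by (rule suminf_finite) (use m b in \<open>auto dest: injD\<close>)
    then show ?thesis using m b by (simp add: spread_def pw_def)
  next
    case False
    then have "(\<lambda>m. if j = b m then pw p z m else 0) = (\<lambda>m. 0)" by (intro ext) auto
    then show ?thesis using False by (simp add: spread_def pw_def)
  qed
  then have "pw p (spread b z) = (\<lambda>j. \<Sum>m. if j = b m then pw p z m else 0)" by (rule ext)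
  then have "F (pw p (spread b z)) \<le> (\<Sum>m. F (\<lambda>j. if j = b m then pw p z m else 0))"
    by (simp only: countably_subadditive)
  also have "\<dots> \<le> (\<Sum>m. pw p z m)"
  proof (intro suminf_le)
    fix m
    have "F (\<lambda>j. if j = b m then pw p z m else 0) \<le> (\<Sum>j. if j = b m then pw p z m else 0)"
      by (rule F_le_suminf)
    also have "\<dots> = (\<Sum>j\<in>{b m}. if j = b m then pw p z m else 0)" by (rule suminf_finite) auto
    finally show "F (\<lambda>j. if j = b m then pw p z m else 0) \<le> pw p z m" by simp
  qed auto
  finally show "F (pw p (spread b z)) \<le> ennreal 1 * suminf (pw p z)" by simp
qed (auto simp: spread_def seq_scale_def)

lemma sample_power_bounded:
  fixes b :: "nat \<Rightarrow> nat"
  assumes b: "inj (grp \<circ> b)"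
  shows "power_bounded p F suminf K (sample b :: (nat \<Rightarrow> 'k::real_normed_field) \<Rightarrow> _)"
proof (rule power_boundedI)
  fix x :: "nat \<Rightarrow> 'k"
  have "(\<Sum>m<n. pw p (sample b x) m) \<le> ennreal K * F (pw p x)" for n
  proof -
    have "(\<Sum>m<n. pw p (sample b x) m) \<le> (\<Sum>m<n. F (pw p (block (grp (b m)) x)))"
    proof (rule sum_mono)
      fix m
      show "pw p (sample b x) m \<le> F (pw p (block (grp (b m)) x))"
        using coordinate_le[of "pw p (block (grp (b m)) x)" "b m"] by (simp add: sample_def pw_def)
    qed
    also have "\<dots> = (\<Sum>i\<in>(grp \<circ> b) ` {..<n}. F (pw p (block i x)))"
      using b by (subst sum.reindex) (auto intro: inj_on_subset)
    also have "\<dots> \<le> (\<Sum>i. F (pw p (block i x)))" by (intro sum_le_suminf) auto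
    also have "\<dots> \<le> ennreal K * F (pw p x)" by (rule blocks_pw_le)
    finally show ?thesis .
  qed
  then show "suminf (pw p (sample b x)) \<le> ennreal K * F (pw p x)"
    by (intro suminf_le_const) auto
next
  show "0 \<le> K" using K1 by simp
qed (auto simp: sample_def seq_scale_def)

text \<open>
  Division by s shows that the identity factors through l_p, so the space is complemented in l_p.
  One unit vector from every group spans a complemented copy of l_p. The decomposition method applies.
\<close>

lemma isomorphic_lp_if_factors_near_one:
  fixes s :: "nat \<Rightarrow> 'k::real_normed_field"
  assumes "factors s" and near: "\<And>j. norm (1 - s j) \<le> 1 / 2"
  shows "isomorphic_spaces (G :: 'k seq_space) (lp_gauged p)"
proof -
  obtain \<alpha> \<beta> a b where \<beta>: "power_bounded p F suminf b \<beta>" and \<alpha>: "power_bounded p suminf F a \<alpha>"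
    and \<alpha>\<beta>: "\<And>c. c \<in> vecs G \<Longrightarrow> \<alpha> (\<beta> c) = (\<lambda>j. s j * c j)"
    using assms(1) unfolding factors_def by blast
  have s: "1 / 2 \<le> norm (s j)" for j
    using near[of j] norm_triangle_ineq2[of 1 "1 - s j"] by simp
  have s0: "s j \<noteq> 0" for j using s[of j] by auto
  define m where "m c = (\<lambda>j. inverse (s j) * c j)" for c
  have m: "power_bounded p F F (2 powr p) m"
  proof (rule power_boundedI)
    fix x :: "nat \<Rightarrow> 'k"
    have "F (pw p (m x)) \<le> F (\<lambda>n. ennreal (2 powr p) * pw p x n)"
    proof (rule mono)
      fix n
      have "norm (inverse (s n)) \<le> 2"
        using s[of n] s0[of n] by (simp add: norm_divide inverse_eq_divide field_simps)
      then have "norm (m x n) \<le> 2 * norm (x n)"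
        by (simp add: m_def norm_mult mult_right_mono)
      then have "norm (m x n) powr p \<le> (2 * norm (x n)) powr p"
        using p1 by (intro powr_mono2) auto
      then show "pw p (m x) n \<le> ennreal (2 powr p) * pw p x n"
        by (simp add: pw_def powr_mult flip: ennreal_mult)
    qed
    then show "F (pw p (m x)) \<le> ennreal (2 powr p) * F (pw p x)"
      using scale order_trans by blast
  qed (auto simp: m_def seq_scale_def fun_eq_iff distrib_left)
  have "\<alpha> (\<beta> (m c)) = c" if "c \<in> vecs G" for c
    using \<alpha>\<beta>[OF power_bounded_vecs[OF m that]] s0 by (simp add: m_def mult.assoc[symmetric])
  moreover have r: "grp (inv grp j) = j" for j
    using surj_grp by (simp add: surj_f_inv_f)
  then have inj: "inj (grp \<circ> inv grp)" "inj (inv grp)"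
    by (auto simp: inj_def) metis
  moreover have "sample (inv grp) (spread (inv grp) z) = z" for z :: "nat \<Rightarrow> 'k"
    using inj(2) by (simp add: sample_def spread_def)
  ultimately show ?thesis
    using decomposition_method[OF p1 normed_sequences_axioms
        bounded_linear_map_if_power_bounded[OF gauge_p_axioms lp.gauge_p_axioms power_bounded_compose[OF m \<beta>]]
        bounded_linear_map_if_power_bounded[OF lp.gauge_p_axioms gauge_p_axioms \<alpha>] _
        bounded_linear_map_if_power_bounded[OF gauge_p_axioms lp.gauge_p_axioms sample_power_bounded[OF inj(1)]]
        bounded_linear_map_if_power_bounded[OF lp.gauge_p_axioms gauge_p_axioms spread_power_bounded[OF inj(2)]]]
    by blast
qed

text \<open>
  The p-th powers of the pieces of x on the groups are summable, so they tend to 0, and every group is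
  finite.
\<close>

lemma coordinates_vanish:
  fixes x :: "nat \<Rightarrow> 'k::real_normed_field"
  assumes x: "x \<in> vecs G" and e: "0 < e"
  shows "finite {i. e \<le> norm (x i)}"
proof -
  define f where "f m = enn2real (F (pw p (block m x)))" for m
  have "F (pw p (block m x)) < top" for m
    using block_vecs[OF x] by (simp add: vecs_iff)
  then have f: "ennreal (f m) = F (pw p (block m x))" for m by (simp add: f_def)
  have "ennreal K * F (pw p x) < top" using x by (simp add: vecs_iff ennreal_mult_less_top)
  then have "(\<Sum>m. ennreal (f m)) \<noteq> top"
    unfolding f using le_less_trans[OF blocks_pw_le[of x]] by auto
  then have "summable f" by (intro summable_suminf_not_top) (auto simp: f_def)
  then have "f \<longlonglongrightarrow> 0" by (rule summable_LIMSEQ_zero)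
  then have "\<forall>\<^sub>F m in sequentially. f m < e powr p"
    using e by (intro order_tendstoD(2)) auto
  then obtain M where M: "\<And>m. M \<le> m \<Longrightarrow> f m < e powr p" by (auto simp: eventually_sequentially)
  have "grp i < M" if i: "e \<le> norm (x i)" for i
  proof (rule ccontr)
    assume "\<not> grp i < M"
    then have "f (grp i) < e powr p" using M by simp
    moreover have "ennreal (norm (x i) powr p) \<le> ennreal (f (grp i))"
      using coordinate_le[of "pw p (block (grp i) x)" i] unfolding f by (simp add: pw_def)
    then have "norm (x i) powr p \<le> f (grp i)" by (simp add: f_def)
    moreover have "e powr p \<le> norm (x i) powr p" using i e p1 by (intro powr_mono2) auto
    ultimately show False by linarith
  qed
  then have "{i. e \<le> norm (x i)} \<subseteq> (\<Union>m<M. {i. grp i = m})" by auto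
  then show ?thesis by (rule finite_subset) (auto intro: finite_grp)
qed

end

text \<open>
  A finite spanning set of the image could be chosen as a basis inside the image; preimages of its
  members would span H.
\<close>

lemma infinite_dim_image:
  assumes X: "normed_sequences X" and T: "bounded_map X Y C T"
    and H: "seqs.subspace H" "H \<subseteq> vecs X" "infinite_dim H"
    and inj: "\<And>h. h \<in> H \<Longrightarrow> T h = 0 \<Longrightarrow> h = 0"
  shows "infinite_dim (T ` H)"
  unfolding infinite_dim_def
proof
  assume "\<exists>B. finite B \<and> T ` H \<subseteq> seqs.span B"
  then obtain B where B: "finite B" "T ` H \<subseteq> seqs.span B" by blast
  obtain B' where B': "B' \<subseteq> T ` H" "\<not> seqs.dependent B'" "T ` H \<subseteq> seqs.span B'"
    using seqs.maximal_independent_subset by blast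
  have fin: "finite B'"
    using seqs.independent_span_bound[OF B(1) B'(2)] B(2) B'(1) by blast
  define g where "g b = (SOME h. h \<in> H \<and> T h = b)" for b
  have g: "g b \<in> H" "T (g b) = b" if "b \<in> B'" for b
  proof -
    have "\<exists>h. h \<in> H \<and> T h = b" using B'(1) that by auto
    then show "g b \<in> H" "T (g b) = b" unfolding g_def by (rule someI2_ex, blast)+
  qed
  have "H \<subseteq> seqs.span (g ` B')"
  proof
    fix h assume h: "h \<in> H"
    then have "T h \<in> seqs.span B'" using B'(3) by blast
    then obtain r where r: "T h = (\<Sum>b\<in>B'. seq_scale (r b) b)"
      unfolding seqs.span_finite[OF fin] by blast
    define h' where "h' = (\<Sum>b\<in>B'. seq_scale (r b) (g b))"
    have h': "h' \<in> H"
      unfolding h'_def using g(1) H(1) by (intro seqs.subspace_sum seqs.subspace_scale)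
    have "T h' = (\<Sum>b\<in>B'. T (seq_scale (r b) (g b)))"
      unfolding h'_def
      by (rule bounded_map_sum[OF X T fin]) (use g(1) H(2) normed_sequences.vecs_scale[OF X] in blast)
    also have "\<dots> = T h"
      unfolding r
    proof (rule sum.cong[OF refl])
      fix b assume b: "b \<in> B'"
      then have "T (seq_scale (r b) (g b)) = seq_scale (r b) (T (g b))"
        using g(1) H(2) by (intro bounded_map_scale[OF T]) auto
      then show "T (seq_scale (r b) (g b)) = seq_scale (r b) b" by (simp only: g(2)[OF b])
    qed
    finally have "T (h - h') = 0"
      using bounded_map_diff[OF X T, of h h'] h h' H(2) by auto
    then have "h - h' = 0"
      using inj[OF seqs.subspace_diff[OF H(1) h h']] by blast
    then have "h = h'" by simp
    moreover have "h' \<in> seqs.span (g ` B')"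
      unfolding h'_def by (intro seqs.span_sum seqs.span_scale seqs.span_base imageI)
    ultimately show "h \<in> seqs.span (g ` B')" by simp
  qed
  then show False using H(3) fin unfolding infinite_dim_def by blast
qed

lemma infinite_dim_finite_support: "infinite_dim {f :: nat \<Rightarrow> 'k::real_normed_field. finite {l. f l \<noteq> 0}}"
  unfolding infinite_dim_def
proof
  let ?FS = "{f :: nat \<Rightarrow> 'k. finite {l. f l \<noteq> 0}}"
  assume "\<exists>B. finite B \<and> ?FS \<subseteq> seqs.span B"
  then obtain B where B: "finite B" "?FS \<subseteq> seqs.span B" by blast
  define S where "S = (unit_seq :: nat \<Rightarrow> nat \<Rightarrow> 'k) ` {..card B}"
  have inj: "inj_on (unit_seq :: nat \<Rightarrow> nat \<Rightarrow> 'k) A" for A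
    by (rule inj_onI) (metis unit_seq_def zero_neq_one)
  have "\<not> seqs.dependent S"
  proof
    assume "seqs.dependent S"
    then obtain u v where v: "v \<in> S" "u v \<noteq> 0" and u: "(\<Sum>v\<in>S. seq_scale (u v) v) = 0"
      using seqs.dependent_finite[of S] by (auto simp: S_def)
    then obtain j where j: "j \<le> card B" "v = unit_seq j" by (auto simp: S_def)
    have "0 = (\<Sum>v\<in>S. seq_scale (u v) v) j" unfolding u by simp
    also have "\<dots> = (\<Sum>i\<le>card B. seq_scale (u (unit_seq i)) (unit_seq i) j)"
      unfolding sum_fun_at S_def by (simp only: sum.reindex[OF inj] comp_def)
    also have "\<dots> = (\<Sum>i\<le>card B. if i = j then u (unit_seq j) else 0)"
      by (rule sum.cong) (auto simp: seq_scale_def unit_seq_def)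
    also have "\<dots> = u v" using j by simp
    finally show False using v by simp
  qed
  moreover have "S \<subseteq> ?FS"
  proof
    fix v assume "v \<in> S"
    then obtain j where "v = unit_seq j" by (auto simp: S_def)
    then have "{l. v l \<noteq> 0} \<subseteq> {j}" by (auto simp: unit_seq_def)
    then show "v \<in> ?FS" using finite_subset by blast
  qed
  ultimately have "card S \<le> card B" using seqs.independent_span_bound[OF B(1)] B(2) by blast
  moreover have "card S = Suc (card B)" unfolding S_def by (subst card_image[OF inj]) simp
  ultimately show False by simp
qed

section \<open>Operators whose diagonal does not tend to zero\<close>

context block_sum
begin

text \<open>
  A subsequence along which the matrix of S is nearly diagonal, apart from constant rows. The columns
  tend to 0 by \<open>coordinates_vanish\<close>. The rows converge, with limits l, after passing to a subsequence of
  the indices with large diagonal entry, by compactness of bounded sets of scalars and a diagonal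
  argument. Each new index is chosen so late that all the entries shared with the preceding indices are
  within the required tolerance of their limits.
\<close>

lemma sparse_indices:
  fixes S :: "(nat \<Rightarrow> 'k::{real_normed_field,heine_borel}) \<Rightarrow> nat \<Rightarrow> 'k"
  assumes S: "bounded_map G G C S" and nz: "\<not> (\<lambda>j. S (unit_seq j) j) \<longlonglongrightarrow> 0" and \<epsilon>: "\<And>n. 0 < \<epsilon> n"
  obtains \<delta> and q :: "nat \<Rightarrow> nat" and l where "0 < \<delta>" "\<And>n. \<delta> \<le> norm (S (unit_seq (q n)) (q n))"
    "\<And>i m. i < m \<Longrightarrow> norm (S (unit_seq (q i)) (q m)) \<le> \<delta> * \<epsilon> m"
    "\<And>i m. i < m \<Longrightarrow> norm (S (unit_seq (q m)) (q i) - l (q i)) \<le> \<delta> * \<epsilon> m"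
    "inj (grp \<circ> q)"
proof -
  define T where "T j i = S (unit_seq j) i" for j i
  have Tvec: "T j \<in> vecs G" for j
  proof -
    have "T j = S (unit_seq j)" unfolding T_def by (rule refl)
    then show ?thesis using bounded_map_vecs[OF S unit_vecs[of j]] by (simp only:)
  qed
  have bound: "norm (T j i) \<le> C" for j i
  proof -
    have "vnorm G (unit_seq j :: nat \<Rightarrow> 'k) \<le> 1"
      using vnorm_le_iff[of 1 "unit_seq j :: nat \<Rightarrow> 'k"] F_pw_unit[of j, where 'k = 'k] by simp
    then have "C * vnorm G (unit_seq j :: nat \<Rightarrow> 'k) \<le> C"
      using bounded_map_nonneg[OF S] by (simp add: mult_left_le)
    then show ?thesis
      unfolding T_def using coordinate[OF bounded_map_vecs[OF S unit_vecs], of j i] bounded_map_norm[OF S unit_vecs, of j]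
      by linarith
  qed
  obtain \<delta> where \<delta>: "0 < \<delta>" "\<And>N. \<exists>j\<ge>N. \<delta> \<le> norm (T j j)"
  proof -
    have "\<exists>e>0. \<forall>N. \<exists>j\<ge>N. e \<le> norm (T j j)"
      using nz unfolding LIMSEQ_iff T_def by (simp only: not_all not_imp not_ex not_less diff_zero)
    then show ?thesis using that by blast
  qed
  define Bad where "Bad = {j. \<delta> \<le> norm (T j j)}"
  have "infinite Bad"
    unfolding infinite_nat_iff_unbounded_le Bad_def using \<delta>(2) by auto
  then have r0: "strict_mono (enumerate Bad)" "\<And>n. enumerate Bad n \<in> Bad"
    by (auto intro: strict_mono_enumerate enumerate_in_set)
  obtain k l where k: "strict_mono (k :: nat \<Rightarrow> nat)" and l: "\<And>i. (\<lambda>n. T (enumerate Bad (k n)) i) \<longlonglongrightarrow> l i"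
  proof -
    obtain k where k: "strict_mono (k :: nat \<Rightarrow> nat)"
      "\<And>i. i \<in> UNIV \<Longrightarrow> \<exists>l. (\<lambda>n. T (enumerate Bad (k n)) i) \<longlonglongrightarrow> l"
      by (rule function_convergent_subsequence[of UNIV "\<lambda>n. T (enumerate Bad n)" C])
        (auto simp: bound)
    then have "\<forall>i. \<exists>l. (\<lambda>n. T (enumerate Bad (k n)) i) \<longlonglongrightarrow> l" by blast
    then obtain l where "\<forall>i. (\<lambda>n. T (enumerate Bad (k n)) i) \<longlonglongrightarrow> l i" by metis
    then show ?thesis using that k(1) by blast
  qed
  define r where "r n = enumerate Bad (k n)" for n
  have r: "strict_mono r" "\<And>n. \<delta> \<le> norm (T (r n) (r n))" "\<And>i. (\<lambda>n. T (r n) i) \<longlonglongrightarrow> l i"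
  proof -
    show "strict_mono r" using strict_mono_o[OF r0(1) k] unfolding r_def comp_def .
    show "\<delta> \<le> norm (T (r n) (r n))" for n using r0(2)[of "k n"] unfolding r_def Bad_def by blast
    show "(\<lambda>n. T (r n) i) \<longlonglongrightarrow> l i" for i unfolding r_def by (rule l)
  qed
  have avoid: "\<forall>\<^sub>F n in sequentially. r n \<notin> A" if A: "finite A" for A
  proof -
    obtain M where M: "\<And>a. a \<in> A \<Longrightarrow> a \<le> M" using A unfolding finite_nat_set_iff_bounded_le by blast
    have "r n \<notin> A" if n: "Suc M \<le> n" for n
    proof
      assume "r n \<in> A"
      then show False using seq_suble[OF r(1), of n] n M[of "r n"] by linarith
    qed
    then show ?thesis by (auto simp: eventually_sequentially)
  qed
  \<comment> \<open>The conditions are imposed for all indices up to the last one chosen, so the next choice depends only on that index. The last condition also forces x < y.\<close>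
  define Q where "Q n x y \<longleftrightarrow> (\<forall>j\<le>x. norm (T j y) \<le> \<delta> * \<epsilon> (Suc n)) \<and>
      (\<forall>i\<le>x. norm (T y i - l i) \<le> \<delta> * \<epsilon> (Suc n)) \<and> (\<forall>i\<le>x. grp i \<noteq> grp y)" for n x y
  have pos: "0 < \<delta> * \<epsilon> n" for n using \<delta>(1) \<epsilon> by simp
  have "\<exists>q. \<forall>n. q n \<in> range r \<and> Q n (q n) (q (Suc n))"
  proof (rule dependent_nat_choice)
    show "\<exists>x. x \<in> range r" by blast
  next
    fix x n
    have "\<forall>\<^sub>F m in sequentially. norm (T j (r m)) \<le> \<delta> * \<epsilon> (Suc n)" for j
      using avoid[OF coordinates_vanish[OF Tvec[of j] pos[of "Suc n"]]]
      by eventually_elim (simp add: not_le)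
    then have 1: "\<forall>\<^sub>F m in sequentially. \<forall>j\<in>{..x}. norm (T j (r m)) \<le> \<delta> * \<epsilon> (Suc n)"
      by (intro eventually_ball_finite) auto
    have "\<forall>\<^sub>F m in sequentially. norm (T (r m) i - l i) \<le> \<delta> * \<epsilon> (Suc n)" for i
      using tendstoD[OF r(3)[of i] pos[of "Suc n"]]
      by eventually_elim (simp add: dist_norm)
    then have 2: "\<forall>\<^sub>F m in sequentially. \<forall>i\<in>{..x}. norm (T (r m) i - l i) \<le> \<delta> * \<epsilon> (Suc n)"
      by (intro eventually_ball_finite) auto
    have "\<forall>\<^sub>F m in sequentially. r m \<notin> (\<Union>i\<le>x. {j. grp j = grp i})"
      by (rule avoid) (auto intro: finite_grp)
    then have 3: "\<forall>\<^sub>F m in sequentially. \<forall>i\<le>x. grp i \<noteq> grp (r m)"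
      by eventually_elim (metis (mono_tags, lifting) UN_I atMost_iff mem_Collect_eq)
    have "\<forall>\<^sub>F m in sequentially. Q n x (r m)"
      using 1 2 3 by eventually_elim (simp add: Q_def)
    then obtain m where "Q n x (r m)" by (auto simp: eventually_sequentially)
    then show "\<exists>y. y \<in> range r \<and> Q n x y" by blast
  qed
  then obtain q where q: "\<And>n. q n \<in> range r" "\<And>n. Q n (q n) (q (Suc n))" by blast
  have "q n < q (Suc n)" for n
    using q(2)[of n] unfolding Q_def by (metis not_less)
  then have mono_q: "strict_mono q" by (rule strict_mono_Suc_iff[THEN iffD2, rule_format])
  have step: "Q (m - 1) (q (m - 1)) (q m) \<and> q i \<le> q (m - 1) \<and> Suc (m - 1) = m" if "i < m" for i m
    using that q(2)[of "m - 1"] strict_mono_less_eq[OF mono_q, of i "m - 1"] by auto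
  show ?thesis
  proof (rule that[of \<delta> q l])
    show "0 < \<delta>" by (rule \<delta>(1))
    show "\<delta> \<le> norm (S (unit_seq (q n)) (q n))" for n
      using q(1)[of n] r(2) by (auto simp: T_def)
    show "norm (S (unit_seq (q i)) (q m)) \<le> \<delta> * \<epsilon> m" if "i < m" for i m
      using step[OF that] unfolding Q_def T_def by auto
    show "norm (S (unit_seq (q m)) (q i) - l (q i)) \<le> \<delta> * \<epsilon> m" if "i < m" for i m
      using step[OF that] unfolding Q_def T_def by auto
    have ne: "grp (q i) \<noteq> grp (q m)" if "i < m" for i m
      using step[OF that] unfolding Q_def by auto
    show "inj (grp \<circ> q)"
    proof (rule injI)
      fix i m assume "(grp \<circ> q) i = (grp \<circ> q) m"
      then show "i = m" using ne[of i m] ne[of m i] by (cases i m rule: linorder_cases) auto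
    qed
  qed
qed

text \<open>
  The majorant of the error in the next lemma.
\<close>

lemma geometric_lp:
  "(\<lambda>m. of_real ((1/2) ^ m) :: 'k::real_normed_field) \<in> vecs (lp_gauged p)"
  "vnorm (lp_gauged p) (\<lambda>m. of_real ((1/2) ^ m) :: 'k::real_normed_field) \<le> 2"
proof -
  let ?g = "\<lambda>m. of_real ((1/2) ^ m) :: 'k"
  have "suminf (pw p ?g) \<le> (\<Sum>m. ennreal ((1/2) ^ m))"
  proof (rule suminf_le)
    fix m
    have "((1/2::real) ^ m) powr p \<le> ((1/2) ^ m) powr 1"
      using p1 by (intro powr_mono') (auto simp: power_le_one)
    then show "pw p ?g m \<le> ennreal ((1/2) ^ m)"
      by (simp add: pw_def norm_power norm_divide ennreal_leI)
  qed auto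
  also have "\<dots> = ennreal (\<Sum>m. (1/2) ^ m)" by (intro suminf_ennreal2) auto
  also have "(\<Sum>m. (1/2) ^ m) = (2::real)" by (subst suminf_geometric) auto
  also have "ennreal 2 \<le> ennreal (2 powr p)"
    using powr_mono[of 1 p "2::real"] p1 by (intro ennreal_leI) simp
  finally show "?g \<in> vecs (lp_gauged p)" "vnorm (lp_gauged p) ?g \<le> 2"
    by (subst (asm) lp.vnorm_le_iff; simp)+
qed

text \<open>
  The map \<open>\<upsilon>\<close> sends the unit vectors of l_p to the differences of the unit vectors with consecutive
  sparse indices b l < a l. The limits of the rows cancel in the differences, so the entries of the image at
  the indices a m form the product of f with a diagonal bounded away from 0, plus a small error. Since
  the a m lie in different groups, the norm of the image controls the l_p-norm of these entries.
\<close>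

lemma bounded_below_on_finite_support:
  fixes S :: "(nat \<Rightarrow> 'k::{real_normed_field,heine_borel}) \<Rightarrow> nat \<Rightarrow> 'k"
  assumes S: "bounded_map G G C S" and nz: "\<not> (\<lambda>j. S (unit_seq j) j) \<longlonglongrightarrow> 0"
  obtains \<upsilon> c D where "bounded_map (lp_gauged p) G D \<upsilon>" "0 < c"
    "\<And>f. finite {l. f l \<noteq> 0} \<Longrightarrow> c * vnorm (lp_gauged p) f \<le> vnorm G (S (\<upsilon> f))"
proof -
  obtain \<delta> and lm :: "nat \<Rightarrow> 'k" and q :: "nat \<Rightarrow> nat" where \<delta>: "0 < \<delta>" and qd: "\<And>n. \<delta> \<le> norm (S (unit_seq (q n)) (q n))"
    and col: "\<And>i m. i < m \<Longrightarrow> norm (S (unit_seq (q i)) (q m)) \<le> \<delta> * ((1/4) ^ m / 32)"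
    and row: "\<And>i m. i < m \<Longrightarrow> norm (S (unit_seq (q m)) (q i) - lm (q i)) \<le> \<delta> * ((1/4) ^ m / 32)"
    and inj: "inj (grp \<circ> q)"
  proof (rule sparse_indices[OF S nz, of "\<lambda>n. (1/4) ^ n / 32"])
    show "0 < (1/4::real) ^ n / 32" for n by simp
  qed (rule that)
  \<comment> \<open>With this value the error has norm at most \<open>8 \<eta> = \<delta> / 4\<close> times the norm of f, half of the lower bound \<open>\<delta> / 2\<close> for the diagonal.\<close>
  define \<eta> where "\<eta> = \<delta> / 32"
  have col: "norm (S (unit_seq (q i)) (q m)) \<le> \<eta> * (1/4) ^ m" if "i < m" for i m
    using col[OF that] by (simp add: \<eta>_def)
  have row: "norm (S (unit_seq (q m)) (q i) - lm (q i)) \<le> \<eta> * (1/4) ^ m" if "i < m" for i m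
    using row[OF that] by (simp add: \<eta>_def)
  have \<eta>0: "0 < \<eta>" using \<delta> by (simp add: \<eta>_def)
  \<comment> \<open>The index a l at which the image is read comes after b l, so that the column of b l is already small there and the diagonal entry of a l prevails.\<close>
  define a b where "a l = q (2 * l + 1)" and "b l = q (2 * l)" for l
  have gq: "x = y" if "grp (q x) = grp (q y)" for x y
    using that injD[OF inj, of x y] by simp
  have q_eq: "x = y" if "q x = q y" for x y using gq[of x y] that by simp
  have ab: "inj a" "inj b" "inj (grp \<circ> a)"
    by (auto simp: inj_def a_def b_def dest!: gq q_eq)
  let ?L = "lp_gauged p :: 'k seq_space"
  have "bounded_linear_map ?L G (\<lambda>f. spread b f - spread a f)"
    by (intro bounded_linear_map_diff[OF normed_sequences_axioms]
        bounded_linear_map_if_power_bounded[OF lp.gauge_p_axioms gauge_p_axioms spread_power_bounded] ab)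
  then obtain D where \<upsilon>: "bounded_map ?L G D (\<lambda>f. spread b f - spread a f)"
    unfolding bounded_linear_map_def by blast
  define \<upsilon> where "\<upsilon> f = spread b f - spread a f" for f :: "nat \<Rightarrow> 'k"
  have \<upsilon>: "bounded_map ?L G D \<upsilon>" using \<upsilon> unfolding \<upsilon>_def .
  have S\<upsilon>: "bounded_map ?L G (C * D) (\<lambda>f. S (\<upsilon> f))" by (rule bounded_map_compose[OF \<upsilon> S])
  have unit_lp: "(unit_seq l :: nat \<Rightarrow> 'k) \<in> vecs ?L" for l
    unfolding lp.vecs_iff suminf_pw_unit by simp
  define M where "M l = S (\<upsilon> (unit_seq l))" for l
  have M: "M l = S (unit_seq (b l)) - S (unit_seq (a l))" for l
  proof -
    have sp: "spread g (unit_seq l) = (unit_seq (g l) :: nat \<Rightarrow> 'k)" if "inj g" for g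
      using that by (auto simp: spread_def unit_seq_def fun_eq_iff)
    show ?thesis
      unfolding M_def \<upsilon>_def sp[OF ab(1)] sp[OF ab(2)]
      by (rule bounded_map_diff[OF normed_sequences_axioms S unit_vecs unit_vecs])
  qed
  have off: "norm (M l (a m)) \<le> 2 * \<eta> * (1/2) ^ l * (1/2) ^ m" if "l \<noteq> m" for l m
  proof (cases "l < m")
    case True
    have "norm (M l (a m)) \<le> norm (S (unit_seq (b l)) (a m)) + norm (S (unit_seq (a l)) (a m))"
      unfolding M by (simp add: norm_triangle_ineq4)
    also have "\<dots> \<le> \<eta> * (1/4) ^ (2 * m + 1) + \<eta> * (1/4) ^ (2 * m + 1)"
      unfolding a_def b_def using True by (intro add_mono col) auto
    also have "\<dots> = 2 * \<eta> * (1/4) ^ (2 * m + 1)" by simp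
    also have "\<dots> \<le> 2 * \<eta> * ((1/4) ^ m)"
      using \<eta>0 by (intro mult_left_mono power_decreasing) auto
    also have "(1/4::real) ^ m = (1/2) ^ m * (1/2) ^ m" by (simp flip: power_mult_distrib)
    also have "2 * \<eta> * ((1/2) ^ m * (1/2) ^ m) \<le> 2 * \<eta> * ((1/2) ^ l * (1/2) ^ m)"
      using \<eta>0 True by (intro mult_left_mono mult_right_mono power_decreasing) auto
    finally show ?thesis by (simp add: mult.assoc)
  next
    case False
    then have ml: "m < l" using that by simp
    have "M l (a m) = (S (unit_seq (b l)) (a m) - lm (a m)) - (S (unit_seq (a l)) (a m) - lm (a m))"
      unfolding M by simp
    then have "norm (M l (a m)) \<le> norm (S (unit_seq (b l)) (a m) - lm (a m)) + norm (S (unit_seq (a l)) (a m) - lm (a m))"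
      by (simp only: norm_triangle_ineq4)
    also have "\<dots> \<le> \<eta> * (1/4) ^ (2 * l) + \<eta> * (1/4) ^ (2 * l + 1)"
      unfolding a_def b_def using ml by (intro add_mono row) auto
    also have "\<dots> \<le> \<eta> * (1/4) ^ l + \<eta> * (1/4) ^ l"
      using \<eta>0 by (intro add_mono mult_left_mono power_decreasing) auto
    also have "\<dots> = 2 * \<eta> * (1/4) ^ l" by simp
    also have "(1/4::real) ^ l = (1/2) ^ l * (1/2) ^ l" by (simp flip: power_mult_distrib)
    also have "2 * \<eta> * ((1/2) ^ l * (1/2) ^ l) \<le> 2 * \<eta> * ((1/2) ^ l * (1/2) ^ m)"
      using \<eta>0 ml by (intro mult_left_mono power_decreasing) auto
    finally show ?thesis by (simp add: mult.assoc)
  qed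
  have diag: "\<delta> / 2 \<le> norm (M m (a m))" for m
  proof -
    have "norm (S (unit_seq (b m)) (a m)) \<le> \<eta> * (1/4) ^ (2 * m + 1)"
      unfolding a_def b_def by (intro col) simp
    also have "\<dots> \<le> \<eta> * 1" using \<eta>0 by (intro mult_left_mono power_le_one) auto
    also have "\<dots> \<le> \<delta> / 2" using \<delta> by (simp add: \<eta>_def)
    finally have "norm (S (unit_seq (b m)) (a m)) \<le> \<delta> / 2" .
    moreover have "\<delta> \<le> norm (S (unit_seq (a m)) (a m))" unfolding a_def by (rule qd)
    ultimately show ?thesis
      unfolding M using norm_triangle_ineq3[of "S (unit_seq (b m)) (a m)" "S (unit_seq (a m)) (a m)"] by simp
  qed
  define K' where "K' = K powr (1 / p)"
  have sam: "bounded_map G ?L K' (sample a)"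
    unfolding K'_def by (rule power_bounded_imp[OF gauge_p_axioms lp.gauge_p_axioms sample_power_bounded[OF ab(3)]])
  have K': "0 < K'" using K1 by (simp add: K'_def)
  have main: "\<delta> / (4 * K') * vnorm ?L f \<le> vnorm G (S (\<upsilon> f))" if fin: "finite {l. f l \<noteq> 0}" for f :: "nat \<Rightarrow> 'k"
  proof -
    let ?A = "{l. f l \<noteq> 0}"
    have f_sum: "f = (\<Sum>l\<in>?A. seq_scale (f l) (unit_seq l))"
    proof
      fix n
      have "(\<Sum>l\<in>?A. seq_scale (f l) (unit_seq l)) n = (\<Sum>l\<in>?A. if l = n then f l else 0)"
        unfolding sum_fun_at by (rule sum.cong) (auto simp: seq_scale_def unit_seq_def)
      then show "f n = (\<Sum>l\<in>?A. seq_scale (f l) (unit_seq l)) n" using fin by simp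
    qed
    have fL: "f \<in> vecs ?L"
      by (subst f_sum) (intro lp.vecs_sum lp.vecs_scale unit_lp)
    define nf where "nf = vnorm ?L f"
    have nf: "norm (f l) \<le> nf" "0 \<le> nf" for l
      unfolding nf_def using lp.coordinate[OF fL] lp.norm_nonneg[OF fL] by blast+
    have "S (\<upsilon> f) = S (\<upsilon> (\<Sum>l\<in>?A. seq_scale (f l) (unit_seq l)))" using f_sum by (simp only:)
    also have "\<dots> = (\<Sum>l\<in>?A. S (\<upsilon> (seq_scale (f l) (unit_seq l))))"
      by (rule bounded_map_sum[OF lp.normed_sequences_axioms S\<upsilon> fin]) (intro lp.vecs_scale unit_lp)
    also have "\<dots> = (\<Sum>l\<in>?A. seq_scale (f l) (M l))"
      unfolding M_def by (rule sum.cong[OF refl]) (rule bounded_map_scale[OF S\<upsilon> unit_lp])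
    finally have Sf: "S (\<upsilon> f) j = (\<Sum>l\<in>?A. f l * M l j)" for j
      by (simp only: sum_fun_at seq_scale_def)
    define y where "y = sample a (S (\<upsilon> f))"
    define E where "E m = (\<Sum>l\<in>?A - {m}. f l * M l (a m))" for m
    define Dg where "Dg m = f m * M m (a m)" for m
    have y: "y m = Dg m + E m" for m
    proof (cases "m \<in> ?A")
      case True
      then show ?thesis using fin by (simp add: y_def sample_def Sf E_def Dg_def sum.remove)
    next
      case False
      then show ?thesis by (simp add: y_def sample_def Sf E_def Dg_def)
    qed
    have E_le: "norm (E m) \<le> norm (of_real (4 * \<eta> * nf) * (of_real ((1/2) ^ m) :: 'k))" for m
    proof -
      have "norm (E m) \<le> (\<Sum>l\<in>?A - {m}. nf * (2 * \<eta> * (1/2) ^ l * (1/2) ^ m))"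
        unfolding E_def
        by (rule sum_norm_le) (auto simp: norm_mult intro!: mult_mono nf off)
      also have "\<dots> = (nf * 2 * \<eta> * (1/2) ^ m) * (\<Sum>l\<in>?A - {m}. (1/2) ^ l)"
        by (simp add: sum_distrib_left mult_ac)
      also have "\<dots> \<le> (nf * 2 * \<eta> * (1/2) ^ m) * 2"
      proof (rule mult_left_mono)
        have "(\<Sum>l\<in>?A - {m}. (1/2::real) ^ l) \<le> (\<Sum>l. (1/2) ^ l)"
          using fin by (intro sum_le_suminf) auto
        also have "\<dots> = 2" by (subst suminf_geometric) auto
        finally show "(\<Sum>l\<in>?A - {m}. (1/2::real) ^ l) \<le> 2" .
      qed (use nf(2) \<eta>0 in simp)
      also have "\<dots> = norm (of_real (4 * \<eta> * nf) * (of_real ((1/2) ^ m) :: 'k))"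
        using nf(2) \<eta>0 unfolding norm_mult norm_of_real by simp
      finally show ?thesis .
    qed
    have gs: "seq_scale (of_real (4 * \<eta> * nf)) (\<lambda>m. of_real ((1/2) ^ m)) \<in> vecs ?L"
      by (rule lp.vecs_scale[OF geometric_lp(1)])
    have EL: "E \<in> vecs ?L"
      by (rule lp.vnorm_mono(1)[OF gs]) (use E_le in \<open>simp only: seq_scale_def\<close>)
    have "vnorm ?L E \<le> vnorm ?L (seq_scale (of_real (4 * \<eta> * nf)) (\<lambda>m. of_real ((1/2) ^ m)))"
      by (rule lp.vnorm_mono(2)[OF gs]) (use E_le in \<open>simp only: seq_scale_def\<close>)
    also have "\<dots> \<le> norm (of_real (4 * \<eta> * nf) :: 'k) * 2"
      by (rule order_trans[OF lp.norm_scale[OF geometric_lp(1)]]) (intro mult_left_mono geometric_lp(2), simp)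
    also have "\<dots> = 8 * \<eta> * nf" using nf(2) \<eta>0 unfolding norm_of_real by simp
    finally have Enorm: "vnorm ?L E \<le> \<delta> / 4 * nf" by (simp add: \<eta>_def)
    have SX: "S (\<upsilon> f) \<in> vecs G" by (rule bounded_map_vecs[OF S\<upsilon> fL])
    have yL: "y \<in> vecs ?L" unfolding y_def by (rule bounded_map_vecs[OF sam SX])
    have "Dg = y - E" using y by (auto simp: fun_eq_iff)
    then have DL: "Dg \<in> vecs ?L" and Dn: "vnorm ?L Dg \<le> vnorm ?L y + vnorm ?L E"
      using lp.vecs_diff[OF yL EL] lp.norm_diff[OF yL EL] by (simp_all only:)
    have f_le: "norm (f m) \<le> norm (seq_scale (of_real (2 / \<delta>)) Dg m)" for m
    proof -
      have "norm (f m) * (\<delta> / 2) \<le> norm (f m) * norm (M m (a m))"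
        by (intro mult_left_mono diag) simp
      also have "\<dots> = norm (Dg m)" by (simp add: Dg_def norm_mult)
      finally have "norm (f m) \<le> 2 / \<delta> * norm (Dg m)" using \<delta> by (simp add: field_simps)
      also have "\<dots> = norm (seq_scale (of_real (2 / \<delta>)) Dg m)"
        using \<delta> unfolding seq_scale_def norm_mult norm_of_real by simp
      finally show ?thesis .
    qed
    have "nf \<le> vnorm ?L (seq_scale (of_real (2 / \<delta>)) Dg)"
      unfolding nf_def by (rule lp.vnorm_mono(2)[OF lp.vecs_scale[OF DL] f_le])
    also have "\<dots> \<le> norm (of_real (2 / \<delta>) :: 'k) * vnorm ?L Dg" by (rule lp.norm_scale[OF DL])
    also have "\<dots> = 2 / \<delta> * vnorm ?L Dg" using \<delta> unfolding norm_of_real by simp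
    finally have "\<delta> / 2 * nf \<le> vnorm ?L Dg" using \<delta> by (simp add: field_simps)
    also have "\<dots> \<le> vnorm ?L y + \<delta> / 4 * nf" using Dn Enorm by simp
    finally have "\<delta> / 4 * nf \<le> vnorm ?L y" by simp
    also have "\<dots> \<le> K' * vnorm G (S (\<upsilon> f))" unfolding y_def by (rule bounded_map_norm[OF sam SX])
    finally show ?thesis using K' unfolding nf_def by (simp add: field_simps)
  qed
  show ?thesis
    by (rule that[OF \<upsilon> _ main]) (use \<delta> K' in auto)
qed

lemma bounded_below_subspace:
  fixes S :: "(nat \<Rightarrow> 'k::{real_normed_field,heine_borel}) \<Rightarrow> nat \<Rightarrow> 'k"
  assumes S: "bounded_map G G C S" and nz: "\<not> (\<lambda>j. S (unit_seq j) j) \<longlonglongrightarrow> 0"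
  obtains H c where "0 < c" "seqs.subspace H" "H \<subseteq> vecs G" "infinite_dim H"
    "\<And>h. h \<in> H \<Longrightarrow> c * vnorm G h \<le> vnorm G (S h)"
proof -
  obtain \<upsilon> c D where \<upsilon>: "bounded_map (lp_gauged p) G D \<upsilon>" and c: "0 < c"
    and low: "\<And>f. finite {l. f l \<noteq> 0} \<Longrightarrow> c * vnorm (lp_gauged p) f \<le> vnorm G (S (\<upsilon> f))"
  proof (rule bounded_below_on_finite_support[OF S nz])
  qed (rule that)
  let ?FS = "{f :: nat \<Rightarrow> 'k. finite {l. f l \<noteq> 0}}"
  have sub: "seqs.subspace ?FS"
    unfolding seqs.subspace_def
  proof (intro conjI ballI allI)
    fix f g :: "nat \<Rightarrow> 'k" assume "f \<in> ?FS" "g \<in> ?FS"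
    then have "finite ({l. f l \<noteq> 0} \<union> {l. g l \<noteq> 0})" by simp
    moreover have "{l. (f + g) l \<noteq> 0} \<subseteq> {l. f l \<noteq> 0} \<union> {l. g l \<noteq> 0}" by auto
    ultimately have "finite {l. (f + g) l \<noteq> 0}" by (rule rev_finite_subset)
    then show "f + g \<in> ?FS" unfolding mem_Collect_eq .
  next
    fix d :: 'k and f :: "nat \<Rightarrow> 'k" assume "f \<in> ?FS"
    then have "finite {l. f l \<noteq> 0}" by (rule CollectD)
    moreover have "{l. seq_scale d f l \<noteq> 0} \<subseteq> {l. f l \<noteq> 0}" by (auto simp: seq_scale_def)
    ultimately have "finite {l. seq_scale d f l \<noteq> 0}" by (rule rev_finite_subset)
    then show "seq_scale d f \<in> ?FS" unfolding mem_Collect_eq .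
  qed simp
  have FSL: "?FS \<subseteq> vecs (lp_gauged p)"
  proof
    fix f assume "f \<in> ?FS"
    then have fin: "finite {l. f l \<noteq> 0}" by (rule CollectD)
    have "suminf (pw p f) = (\<Sum>l | f l \<noteq> 0. pw p f l)" by (rule suminf_finite[OF fin]) (auto simp: pw_def)
    also have "\<dots> < top" unfolding pw_def by (simp only: sum_ennreal powr_ge_zero ennreal_less_top)
    finally show "f \<in> vecs (lp_gauged p)" unfolding lp.vecs_iff .
  qed
  have D: "0 \<le> D" by (rule bounded_map_nonneg[OF \<upsilon>])
  show ?thesis
  proof (rule that[of "c / (D + 1)" "\<upsilon> ` ?FS"])
    show "0 < c / (D + 1)" using c D by simp
    show "seqs.subspace (\<upsilon> ` ?FS)"
      by (rule bounded_map_subspace[OF lp.normed_sequences_axioms \<upsilon> sub FSL])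
    show "\<upsilon> ` ?FS \<subseteq> vecs G" using bounded_map_vecs[OF \<upsilon>] FSL by blast
    show "infinite_dim (\<upsilon> ` ?FS)"
    proof (rule infinite_dim_image[OF lp.normed_sequences_axioms \<upsilon> sub FSL infinite_dim_finite_support])
      fix f assume f: "f \<in> ?FS" and z: "\<upsilon> f = 0"
      have "vnorm G (S (\<upsilon> f)) = 0"
        unfolding z bounded_map_zero[OF normed_sequences_axioms S] by (rule norm_zero)
      then have "c * vnorm (lp_gauged p) f \<le> 0" using low[of f] f by simp
      then have "vnorm (lp_gauged p) f \<le> 0" using c by (simp add: mult_le_0_iff)
      then show "f = 0" using lp.norm_eq_0[of f] f FSL by blast
    qed
    fix h assume "h \<in> \<upsilon> ` ?FS"
    then obtain f where f: "f \<in> ?FS" "h = \<upsilon> f" by blast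
    have fL: "f \<in> vecs (lp_gauged p)" using f(1) FSL by blast
    have "vnorm G h \<le> D * vnorm (lp_gauged p) f" unfolding f(2) by (rule bounded_map_norm[OF \<upsilon> fL])
    also have "\<dots> \<le> (D + 1) * vnorm (lp_gauged p) f" by (intro mult_right_mono) auto
    finally have "c / (D + 1) * vnorm G h \<le> c / (D + 1) * ((D + 1) * vnorm (lp_gauged p) f)"
      using c D by (intro mult_left_mono) auto
    also have "\<dots> = c * vnorm (lp_gauged p) f" using D by simp
    also have "\<dots> \<le> vnorm G (S h)" using low[of f] f by simp
    finally show "c / (D + 1) * vnorm G h \<le> vnorm G (S h)" .
  qed
qed

end

section \<open>Constant blocks in a Lorentz sequence space\<close>

subsection \<open>Values of lists\<close>

lemma list_value_antimono:
  assumes "decseq w" "L \<le> L'"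
  shows "list_value w L' a xs \<le> list_value w L a xs"
  unfolding list_value_conv_sum using assms
  by (intro sum_mono mult_left_mono ennreal_leI) (auto simp: decseq_def)

lemma list_value_filter:
  assumes "decseq w"
  shows "(\<And>x. x \<in> set xs \<Longrightarrow> \<not> Q x \<Longrightarrow> a x = 0) \<Longrightarrow> list_value w L a xs \<le> list_value w L a (filter Q xs)"
proof (induction xs arbitrary: L)
  case (Cons x xs)
  have IH: "list_value w (Suc L) a xs \<le> list_value w (Suc L) a (filter Q xs)"
    using Cons by simp
  show ?case
  proof (cases "Q x")
    case True
    then show ?thesis using IH by (simp add: add_left_mono)
  next
    case False
    then have "a x = 0" using Cons.prems by simp
    then show ?thesis
      using False order_trans[OF IH list_value_antimono[OF assms, of L "Suc L"]] by simp
  qed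
qed simp

lemma weight_sum_add: "weight_sum w (L + n) = weight_sum w L + (\<Sum>i<n. w (L + i))"
  by (induction n) (simp_all add: weight_sum_def add.assoc)

text \<open>
  The weights lost by a shift telescope to at most the sum of the first L weights. Each of them
  is multiplied by an entry, hence the bound c.
\<close>

lemma list_value_shift:
  assumes w: "decseq w" "\<And>n. 0 < w n" and a: "\<And>x. x \<in> set xs \<Longrightarrow> a x \<le> c"
  shows "list_value w 0 a xs \<le> list_value w L a xs + c * ennreal (weight_sum w L)"
proof -
  let ?n = "length xs"
  have d: "0 \<le> w i - w (L + i)" for i using w(1) by (simp add: decseq_def)
  have "list_value w 0 a xs = (\<Sum>i<?n. a (xs ! i) * ennreal (w (L + i) + (w i - w (L + i))))"
    unfolding list_value_conv_sum by simp
  also have "\<dots> = (\<Sum>i<?n. a (xs ! i) * ennreal (w (L + i)) + a (xs ! i) * ennreal (w i - w (L + i)))"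
    using d w(2) by (intro sum.cong refl) (simp only: ennreal_plus less_imp_le distrib_left)
  also have "\<dots> = list_value w L a xs + (\<Sum>i<?n. a (xs ! i) * ennreal (w i - w (L + i)))"
    unfolding list_value_conv_sum by (rule sum.distrib)
  also have "\<dots> \<le> list_value w L a xs + (\<Sum>i<?n. c * ennreal (w i - w (L + i)))"
    by (intro add_left_mono sum_mono mult_right_mono a nth_mem) auto
  also have "(\<Sum>i<?n. c * ennreal (w i - w (L + i))) = c * ennreal (\<Sum>i<?n. w i - w (L + i))"
    using d by (simp add: sum_distrib_left[symmetric] sum_ennreal)
  also have "\<dots> \<le> c * ennreal (weight_sum w L)"
  proof (intro mult_left_mono ennreal_leI)
    have "weight_sum w ?n \<le> weight_sum w (L + ?n)"
      unfolding weight_sum_def using w(2) by (intro sum_mono2) (auto simp: less_imp_le)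
    then show "(\<Sum>i<?n. w i - w (L + i)) \<le> weight_sum w L"
      unfolding weight_sum_add by (simp add: sum_subtractf weight_sum_def)
  qed simp
  finally show ?thesis by (simp add: add_left_mono)
qed

subsection \<open>Partitions of the natural numbers into intervals\<close>

definition interval_index :: "(nat \<Rightarrow> nat) \<Rightarrow> nat \<Rightarrow> nat" where
  "interval_index b n = (LEAST j. n < b (Suc j))"

locale interval_partition =
  fixes b :: "nat \<Rightarrow> nat"
  assumes b0: "b 0 = 0" and strict: "strict_mono b"
begin

lemma interval_index_eq:
  assumes "b j \<le> n" "n < b (Suc j)"
  shows "interval_index b n = j"
  unfolding interval_index_def
proof (rule Least_equality)
  show "n < b (Suc j)" by fact
  fix k assume "n < b (Suc k)"
  then have "b j < b (Suc k)" using assms(1) by simp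
  then show "j \<le> k" using strict_mono_less[OF strict] by simp
qed

lemma interval_index_bounds: "b (interval_index b n) \<le> n" "n < b (Suc (interval_index b n))"
proof -
  have ex: "n < b (Suc n)" using seq_suble[OF strict, of "Suc n"] by simp
  show "n < b (Suc (interval_index b n))"
    unfolding interval_index_def by (rule LeastI[of _ n]) (rule ex)
  show "b (interval_index b n) \<le> n"
  proof (cases "interval_index b n")
    case 0
    then show ?thesis by (simp add: b0)
  next
    case (Suc k)
    then have "\<not> n < b (Suc k)"
      unfolding interval_index_def by (intro not_less_Least) simp
    then show ?thesis using Suc by simp
  qed
qed

lemma interval_index_iff: "interval_index b n = j \<longleftrightarrow> b j \<le> n \<and> n < b (Suc j)"
  using interval_index_eq interval_index_bounds by blast

lemma interval_index_start: "interval_index b (b j) = j"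
  by (rule interval_index_eq) (auto intro: strict_monoD[OF strict])

end

lemma ennreal_quarter_le:
  assumes "r < top" "ennreal (3/4) * r \<le> s + r * ennreal (1/2)"
  shows "r \<le> 4 * s"
proof (cases s)
  case (real y)
  obtain x where x: "r = ennreal x" "0 \<le> x" using assms(1) by (cases r) auto
  have "ennreal (3/4 * x) = ennreal (3/4) * r"
    unfolding x(1) by (rule ennreal_mult) (use x in auto)
  moreover have "ennreal (y + x * (1/2)) = s + r * ennreal (1/2)"
    unfolding x(1) real
    by (subst ennreal_plus, fact real(1), use x(2) in simp, subst ennreal_mult, fact x(2), simp, rule refl)
  ultimately have "ennreal (3/4 * x) \<le> ennreal (y + x * (1/2))" using assms(2) by (simp only:)
  then have "3/4 * x \<le> y + x * (1/2)" using x real by (subst (asm) ennreal_le_iff) auto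
  then have "ennreal x \<le> ennreal (4 * y)" by (intro ennreal_leI) simp
  also have "\<dots> = ennreal 4 * ennreal y" using real by (intro ennreal_mult) auto
  finally show ?thesis unfolding x real by simp
next
  case top
  then show ?thesis by (simp add: ennreal_mult_top)
qed

subsection \<open>The gauge of a sequence of constant blocks\<close>

locale lorentz_blocks = interval_partition b for b +
  fixes w :: "nat \<Rightarrow> real"
  assumes w0: "w 0 = 1" and w_dec: "decseq w" and w_pos: "\<And>n. 0 < w n" and w_div: "\<not> summable w"
    and sizes: "\<And>M. \<exists>J. \<forall>j\<ge>J. M \<le> b (Suc j) - b j"
begin

abbreviation W :: "nat \<Rightarrow> real" where "W \<equiv> weight_sum w"

definition size_of :: "nat \<Rightarrow> nat" where "size_of j = b (Suc j) - b j"

text \<open>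
  A vector with coefficients c in the normalized blocks has the constant value c_j / W(size)^(1/p) on
  block j; these are the p-th powers of its entries in terms of a_j = |c_j|^p.
\<close>

definition spread_values :: "(nat \<Rightarrow> ennreal) \<Rightarrow> nat \<Rightarrow> ennreal" where
  "spread_values a = (\<lambda>n. a (interval_index b n) * ennreal (1 / W (size_of (interval_index b n))))"

definition block_gauge :: "(nat \<Rightarrow> ennreal) \<Rightarrow> ennreal" where
  "block_gauge a = lorentz_gauge w (spread_values a)"

lemma W_mono: "m \<le> n \<Longrightarrow> W m \<le> W n"
  unfolding weight_sum_def using w_pos by (intro sum_mono2) (auto simp: less_imp_le)

lemma W_pos: "0 < n \<Longrightarrow> 0 < W n"
  unfolding weight_sum_def using w_pos by (intro sum_pos) auto

lemma size_pos: "0 < size_of j"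
  unfolding size_of_def using strict_monoD[OF strict, of j "Suc j"] by simp

lemma W_size_pos: "0 < W (size_of j)"
  by (rule W_pos[OF size_pos])

lemma gauge_lorentz_w: "gauge (lorentz_gauge w)"
  by (rule gauge_lorentz[of w, OF w0])

lemma spread_values_at: "b j \<le> n \<Longrightarrow> n < b (Suc j) \<Longrightarrow> spread_values a n = a j * ennreal (1 / W (size_of j))"
  by (simp add: spread_values_def interval_index_eq)

lemma gauge_block_gauge: "gauge block_gauge"
proof
  fix a c :: "nat \<Rightarrow> ennreal" assume "\<And>n. a n \<le> c n"
  then show "block_gauge a \<le> block_gauge c"
    unfolding block_gauge_def spread_values_def
    by (intro gauge.mono[OF gauge_lorentz_w] mult_right_mono) auto
next
  fix a :: "nat \<Rightarrow> nat \<Rightarrow> ennreal"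
  show "block_gauge (\<lambda>n. \<Sum>m. a m n) \<le> (\<Sum>m. block_gauge (a m))"
    unfolding block_gauge_def spread_values_def ennreal_suminf_multc[symmetric]
    by (rule gauge.countably_subadditive[OF gauge_lorentz_w])
next
  fix c :: ennreal and a
  show "block_gauge (\<lambda>n. c * a n) \<le> c * block_gauge a"
    unfolding block_gauge_def spread_values_def mult.assoc
    by (rule gauge.scale[OF gauge_lorentz_w])
next
  fix a j
  have "list_value w 0 (spread_values a) [b j..<b (Suc j)]
      = (\<Sum>i<size_of j. a j * ennreal (1 / W (size_of j)) * ennreal (w i))"
    unfolding list_value_conv_sum length_upt size_of_def[symmetric]
  proof (rule sum.cong[OF refl])
    fix i assume "i \<in> {..<size_of j}"
    then have i: "b j + i < b (Suc j)" by (simp add: size_of_def)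
    then have "[b j..<b (Suc j)] ! i = b j + i" by simp
    then show "spread_values a ([b j..<b (Suc j)] ! i) * ennreal (w (0 + i))
        = a j * ennreal (1 / W (size_of j)) * ennreal (w i)"
      using spread_values_at[of j "b j + i" a] i by (simp only: le_add1 add_0)
  qed
  also have "\<dots> = a j * (ennreal (1 / W (size_of j)) * ennreal (W (size_of j)))"
    using w_pos by (simp add: sum_distrib_left[symmetric] sum_ennreal less_imp_le weight_sum_def mult.assoc)
  also have "ennreal (1 / W (size_of j)) * ennreal (W (size_of j)) = 1"
    using W_size_pos[of j] by (subst ennreal_mult[symmetric]) auto
  finally have "a j = list_value w 0 (spread_values a) [b j..<b (Suc j)]" by simp
  also have "\<dots> \<le> block_gauge a" unfolding block_gauge_def by (rule list_value_le_gauge) simp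
  finally show "a j \<le> block_gauge a" .
qed

text \<open>
  The upper p-estimate: the gauge is countably subadditive, and on a single block of length s the best
  list uses at most the first s weights.
\<close>

lemma block_gauge_le_suminf: "block_gauge a \<le> (\<Sum>j. a j)"
proof -
  let ?v = "\<lambda>j. a j * ennreal (1 / W (size_of j))"
  have "spread_values a n = (\<Sum>j. if interval_index b n = j then ?v j else 0)" for n
  proof -
    have "(\<Sum>j. if interval_index b n = j then ?v j else 0)
        = (\<Sum>j\<in>{interval_index b n}. if interval_index b n = j then ?v j else 0)"
      by (rule suminf_finite) auto
    then show ?thesis by (simp add: spread_values_def)
  qed
  then have "spread_values a = (\<lambda>n. \<Sum>j. if interval_index b n = j then ?v j else 0)" by (rule ext)
  then have "block_gauge a \<le> (\<Sum>j. lorentz_gauge w (\<lambda>n. if interval_index b n = j then ?v j else 0))"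
    unfolding block_gauge_def by (simp only: gauge.countably_subadditive[OF gauge_lorentz_w])
  also have "\<dots> \<le> (\<Sum>j. a j)"
  proof (intro suminf_le lorentz_gauge_le)
    fix j and xs :: "nat list" assume xs: "distinct xs"
    let ?f = "\<lambda>n. if interval_index b n = j then ?v j else 0"
    let ?ys = "filter (\<lambda>n. interval_index b n = j) xs"
    have "set ?ys \<subseteq> {b j..<b (Suc j)}" by (auto simp: interval_index_iff)
    then have "card (set ?ys) \<le> size_of j"
      unfolding size_of_def by (metis card_atLeastLessThan card_mono finite_atLeastLessThan)
    moreover have "card (set ?ys) = length ?ys" by (rule distinct_card) (use xs in simp)
    ultimately have len: "length ?ys \<le> size_of j" by (simp only:)
    have "list_value w 0 ?f xs \<le> list_value w 0 ?f ?ys"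
      by (rule list_value_filter[OF w_dec]) simp
    also have "\<dots> = (\<Sum>i<length ?ys. ?v j * ennreal (w i))"
      unfolding list_value_conv_sum
    proof (rule sum.cong[OF refl])
      fix i assume "i \<in> {..<length ?ys}"
      then have "?ys ! i \<in> set ?ys" by (intro nth_mem) simp
      then have "interval_index b (?ys ! i) = j" by simp
      then show "?f (?ys ! i) * ennreal (w (0 + i)) = ?v j * ennreal (w i)" by simp
    qed
    also have "\<dots> = ?v j * ennreal (W (length ?ys))"
      using w_pos by (simp add: sum_distrib_left[symmetric] sum_ennreal less_imp_le weight_sum_def)
    also have "\<dots> \<le> ?v j * ennreal (W (size_of j))"
      by (intro mult_left_mono ennreal_leI W_mono len) simp
    also have "\<dots> = a j * (ennreal (1 / W (size_of j)) * ennreal (W (size_of j)))" by (simp add: mult.assoc)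
    also have "ennreal (1 / W (size_of j)) * ennreal (W (size_of j)) = 1"
      using W_size_pos[of j] by (subst ennreal_mult[symmetric]) auto
    finally show "list_value w 0 ?f xs \<le> a j" by simp
  qed auto
  finally show ?thesis .
qed

lemma weights_unbounded: "\<exists>n. M \<le> W n"
proof (rule ccontr)
  assume "\<nexists>n. M \<le> W n"
  then have le: "W n \<le> M" for n by (simp add: not_le less_imp_le)
  have "summable w"
  proof (rule bounded_imp_summable)
    show "0 \<le> w n" for n using w_pos[of n] by simp
    show "sum w {..n} \<le> M" for n
      using le[of "Suc n"] by (simp only: weight_sum_def lessThan_Suc_atMost)
  qed
  then show False using w_div by blast
qed

text \<open>
  Every block of group m + 1 is so long that W of its length is at least twice W of the length of the
  whole stretch before group m.
\<close>

lemma sparse_groups: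
  obtains \<kappa> :: "nat \<Rightarrow> nat" where "\<kappa> 0 = 0" "strict_mono \<kappa>"
    "\<And>m j. \<kappa> (Suc m) \<le> j \<Longrightarrow> 2 * W (b (\<kappa> m)) \<le> W (size_of j)"
proof -
  have "\<exists>\<kappa>. \<forall>n. (n = 0 \<longrightarrow> \<kappa> n = 0) \<and>
      (\<kappa> n < \<kappa> (Suc n) \<and> (\<forall>j\<ge>\<kappa> (Suc n). 2 * W (b (\<kappa> n)) \<le> W (size_of j)))"
  proof (rule dependent_nat_choice)
    show "\<exists>x::nat. 0 = (0::nat) \<longrightarrow> x = 0" by blast
  next
    fix x n :: nat
    obtain k where k: "2 * W (b x) \<le> W k" using weights_unbounded by blast
    obtain J where J: "\<And>j. J \<le> j \<Longrightarrow> k \<le> size_of j" using sizes[of k] unfolding size_of_def by blast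
    have "2 * W (b x) \<le> W (size_of j)" if "max J (Suc x) \<le> j" for j
      using k W_mono[OF J[of j]] that by simp
    then show "\<exists>y. (Suc n = 0 \<longrightarrow> y = 0) \<and> (x < y \<and> (\<forall>j\<ge>y. 2 * W (b x) \<le> W (size_of j)))"
      by (intro exI[of _ "max J (Suc x)"]) auto
  qed
  then obtain \<kappa> where k: "\<kappa> (0::nat) = (0::nat)" "\<And>n. \<kappa> n < \<kappa> (Suc n)"
    "\<And>n j. \<kappa> (Suc n) \<le> j \<Longrightarrow> 2 * W (b (\<kappa> n)) \<le> W (size_of j)" by blast
  show ?thesis
    by (rule that[of \<kappa>]) (use k in \<open>auto simp: strict_mono_Suc_iff\<close>)
qed

definition group_part :: "(nat \<Rightarrow> nat) \<Rightarrow> (nat \<Rightarrow> ennreal) \<Rightarrow> nat \<Rightarrow> nat \<Rightarrow> ennreal" where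
  "group_part \<kappa> a m = (\<lambda>j. if interval_index \<kappa> j = m then a j else 0)"

context
  fixes \<kappa> :: "nat \<Rightarrow> nat" and a :: "nat \<Rightarrow> ennreal"
  assumes \<kappa>0: "\<kappa> 0 = 0" and \<kappa>_strict: "strict_mono \<kappa>"
    and \<kappa>_sparse: "\<And>m j. \<kappa> (Suc m) \<le> j \<Longrightarrow> 2 * W (b (\<kappa> m)) \<le> W (size_of j)"
    and finite_gauge: "block_gauge a < top"
begin

interpretation K: interval_partition \<kappa>
  by unfold_locales (rule \<kappa>0, rule \<kappa>_strict)

lemma part_finite: "block_gauge (group_part \<kappa> a m) < top"
proof -
  have "block_gauge (group_part \<kappa> a m) \<le> block_gauge a"
    by (rule gauge.mono[OF gauge_block_gauge]) (simp add: group_part_def)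
  then show ?thesis using finite_gauge by (rule le_less_trans)
qed

lemma spread_part:
  "spread_values (group_part \<kappa> a m) n = (if b (\<kappa> m) \<le> n \<and> n < b (\<kappa> (Suc m)) then spread_values a n else 0)"
proof -
  let ?j = "interval_index b n"
  have "interval_index \<kappa> ?j = m \<longleftrightarrow> b (\<kappa> m) \<le> n \<and> n < b (\<kappa> (Suc m))"
  proof -
    have "\<kappa> m \<le> ?j \<longleftrightarrow> b (\<kappa> m) \<le> n"
      using interval_index_bounds[of n] strict_mono_less_eq[OF strict, of "\<kappa> m" ?j] strict_mono_less[OF strict, of "\<kappa> m" "Suc ?j"]
      by linarith
    moreover have "?j < \<kappa> (Suc m) \<longleftrightarrow> n < b (\<kappa> (Suc m))"
      using interval_index_bounds[of n] strict_mono_less_eq[OF strict, of "Suc ?j" "\<kappa> (Suc m)"] strict_mono_less[OF strict, of ?j "\<kappa> (Suc m)"]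
      by linarith
    ultimately show ?thesis unfolding K.interval_index_iff by blast
  qed
  then show ?thesis by (simp add: spread_values_def group_part_def)
qed

text \<open>
  A nearly optimal list for group m is evaluated with the weights from L on. Since the entries in the
  group are bounded by the gauge divided by the weight sum of a block length, which is at least twice that
  of L, the shift costs at most half of the gauge; 3/4 - 1/2 leaves a quarter. The shift must
  not reach into group m - 1, since the block lengths of group m are not compared with its end.
\<close>

lemma shifted_list_for_part:
  assumes L: "L = 0 \<or> (\<exists>k. m = Suc k \<and> L \<le> b (\<kappa> k))"
  shows "\<exists>xs. distinct xs \<and> set xs \<subseteq> {b (\<kappa> m)..<b (\<kappa> (Suc m))} \<and>
    block_gauge (group_part \<kappa> a m) \<le> 4 * list_value w L (spread_values a) xs"
proof (cases "block_gauge (group_part \<kappa> a m) = 0")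
  case True
  then show ?thesis by (intro exI[of _ "[]"]) simp
next
  case False
  define r where "r = block_gauge (group_part \<kappa> a m)"
  have r: "r < top" "r \<noteq> 0" unfolding r_def using part_finite False by auto
  have "ennreal (3/4) * r < r"
  proof -
    obtain x where x: "r = ennreal x" "0 \<le> x" using r(1) by (cases r) auto
    then have "0 < x" using r(2) by (cases "x = 0") auto
    then have "ennreal (3/4 * x) < ennreal x" by (intro ennreal_lessI) auto
    then show ?thesis unfolding x by (simp only: ennreal_mult x(2) zero_le_divide_iff zero_le_numeral disj_imp simp_thms)
  qed
  then obtain ys where ys: "distinct ys" "ennreal (3/4) * r < list_value w 0 (spread_values (group_part \<kappa> a m)) ys"
    unfolding r_def block_gauge_def lorentz_gauge_def less_SUP_iff by blast
  define Q where "Q n \<longleftrightarrow> b (\<kappa> m) \<le> n \<and> n < b (\<kappa> (Suc m))" for n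
  define xs where "xs = filter Q ys"
  have xs: "distinct xs" "set xs \<subseteq> {b (\<kappa> m)..<b (\<kappa> (Suc m))}"
    using ys(1) by (auto simp: xs_def Q_def)
  have "list_value w 0 (spread_values (group_part \<kappa> a m)) ys \<le> list_value w 0 (spread_values (group_part \<kappa> a m)) xs"
    unfolding xs_def by (rule list_value_filter[OF w_dec]) (auto simp: spread_part Q_def)
  also have "\<dots> \<le> list_value w 0 (spread_values a) xs"
    by (rule list_value_mono) (simp add: spread_part)
  finally have big: "ennreal (3/4) * r \<le> list_value w 0 (spread_values a) xs" using ys(2) by simp
  have "ennreal (3/4) * r \<le> list_value w L (spread_values a) xs + r * ennreal (1/2)"
  proof (cases "L = 0")
    case True
    then show ?thesis using big by (simp add: add_increasing2)
  next
    case False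
    then obtain k where k: "m = Suc k" "L \<le> b (\<kappa> k)" using L by blast
    define c where "c = r * ennreal (1 / (2 * W (b (\<kappa> k))))"
    have WL: "0 < W L" "W L \<le> W (b (\<kappa> k))" using False k(2) W_pos W_mono by auto
    have "spread_values a n \<le> c" if "n \<in> set xs" for n
    proof -
      let ?j = "interval_index b n"
      have n: "b (\<kappa> m) \<le> n" "n < b (\<kappa> (Suc m))" using that xs(2) by auto
      have "\<kappa> m \<le> ?j" 
        using n(1) interval_index_bounds(2)[of n] strict_mono_less[OF strict, of "\<kappa> m" "Suc ?j"] by linarith
      then have "2 * W (b (\<kappa> k)) \<le> W (size_of ?j)" using \<kappa>_sparse[of k ?j] k(1) by simp
      then have v: "1 / W (size_of ?j) \<le> 1 / (2 * W (b (\<kappa> k)))"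
        using WL by (intro divide_left_mono) (auto intro!: mult_pos_pos W_size_pos)
      have "interval_index \<kappa> ?j = m"
        unfolding K.interval_index_iff
        using \<open>\<kappa> m \<le> ?j\<close> n(2) interval_index_bounds(1)[of n] strict_mono_less[OF strict, of ?j "\<kappa> (Suc m)"] by linarith
      then have "a ?j \<le> r"
        using gauge.coordinate_le[OF gauge_block_gauge, of "group_part \<kappa> a m" ?j] by (simp add: group_part_def r_def)
      then show ?thesis
        unfolding spread_values_def c_def by (intro mult_mono ennreal_leI v) auto
    qed
    then have "list_value w 0 (spread_values a) xs \<le> list_value w L (spread_values a) xs + c * ennreal (W L)"
      by (rule list_value_shift[OF w_dec w_pos])
    also have "c * ennreal (W L) \<le> r * ennreal (1/2)"
    proof -
      have "1 / (2 * W (b (\<kappa> k))) * W L \<le> 1 / 2" using WL by (simp add: field_simps)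
      moreover have "ennreal (1 / (2 * W (b (\<kappa> k)))) * ennreal (W L) = ennreal (1 / (2 * W (b (\<kappa> k))) * W L)"
        using WL by (intro ennreal_mult[symmetric]) auto
      ultimately have "ennreal (1 / (2 * W (b (\<kappa> k)))) * ennreal (W L) \<le> ennreal (1/2)"
        by (simp only: ennreal_leI)
      then show ?thesis unfolding c_def mult.assoc by (rule mult_left_mono) simp
    qed
    finally show ?thesis using big by (meson add_left_mono order_trans)
  qed
  then have "r \<le> 4 * list_value w L (spread_values a) xs" by (rule ennreal_quarter_le[OF r(1)])
  then show ?thesis using xs unfolding r_def by blast
qed

text \<open>
  Good lists for every second group are concatenated. Between two of them lies a whole group, so the
  list built so far is short enough for the next shift.
\<close>

lemma alternate_parts:
  "\<exists>ys. distinct ys \<and> set ys \<subseteq> {..<b (\<kappa> (Suc (2 * n + e)))} \<and>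
    (\<Sum>i\<le>n. block_gauge (group_part \<kappa> a (2 * i + e))) \<le> 4 * list_value w 0 (spread_values a) ys"
proof (induction n)
  case 0
  obtain xs where "distinct xs" "set xs \<subseteq> {b (\<kappa> e)..<b (\<kappa> (Suc e))}"
    "block_gauge (group_part \<kappa> a e) \<le> 4 * list_value w 0 (spread_values a) xs"
    using shifted_list_for_part[of 0 e] by blast
  then show ?case by (intro exI[of _ xs]) auto
next
  case (Suc n)
  then obtain ys where ys: "distinct ys" "set ys \<subseteq> {..<b (\<kappa> (Suc (2 * n + e)))}"
    "(\<Sum>i\<le>n. block_gauge (group_part \<kappa> a (2 * i + e))) \<le> 4 * list_value w 0 (spread_values a) ys" by blast
  have "length ys = card (set ys)" using distinct_card[OF ys(1)] by simp
  also have "\<dots> \<le> b (\<kappa> (Suc (2 * n + e)))"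
    using card_mono[OF _ ys(2)] by simp
  finally have len: "length ys \<le> b (\<kappa> (Suc (2 * n + e)))" .
  let ?m = "2 * Suc n + e"
  obtain xs where xs: "distinct xs" "set xs \<subseteq> {b (\<kappa> ?m)..<b (\<kappa> (Suc ?m))}"
    "block_gauge (group_part \<kappa> a ?m) \<le> 4 * list_value w (length ys) (spread_values a) xs"
    using shifted_list_for_part[of "length ys" ?m] len by auto
  have le1: "b (\<kappa> (Suc (2 * n + e))) \<le> b (\<kappa> ?m)" "b (\<kappa> ?m) \<le> b (\<kappa> (Suc ?m))"
    by (auto simp: strict_mono_less_eq[OF strict] strict_mono_less_eq[OF \<kappa>_strict])
  have "set ys \<inter> set xs = {}"
  proof (rule equals0I)
    fix x assume "x \<in> set ys \<inter> set xs"
    then have "x < b (\<kappa> (Suc (2 * n + e)))" "b (\<kappa> ?m) \<le> x" using ys(2) xs(2) by auto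
    then show False using le1 by linarith
  qed
  then have d: "distinct (ys @ xs)" using ys(1) xs(1) by simp
  have s: "set (ys @ xs) \<subseteq> {..<b (\<kappa> (Suc ?m))}"
  proof
    fix x assume "x \<in> set (ys @ xs)"
    then have "x < b (\<kappa> (Suc (2 * n + e))) \<or> x < b (\<kappa> (Suc ?m))" using ys(2) xs(2) by auto
    then show "x \<in> {..<b (\<kappa> (Suc ?m))}" using le1 by auto
  qed
  have "(\<Sum>i\<le>Suc n. block_gauge (group_part \<kappa> a (2 * i + e)))
      \<le> 4 * list_value w 0 (spread_values a) ys + 4 * list_value w (length ys) (spread_values a) xs"
    using add_mono[OF ys(3) xs(3)] by simp
  also have "\<dots> = 4 * list_value w 0 (spread_values a) (ys @ xs)"
    by (simp add: list_value_append distrib_left)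
  finally show ?case using d s by blast
qed

lemma sum_parts_le: "(\<Sum>m. block_gauge (group_part \<kappa> a m)) \<le> ennreal 8 * block_gauge a"
proof (rule suminf_le_const)
  fix n
  have alt: "(\<Sum>i\<le>n. block_gauge (group_part \<kappa> a (2 * i + e))) \<le> 4 * block_gauge a" for e
  proof -
    obtain ys where ys: "distinct ys"
      "(\<Sum>i\<le>n. block_gauge (group_part \<kappa> a (2 * i + e))) \<le> 4 * list_value w 0 (spread_values a) ys"
      using alternate_parts by blast
    note ys(2)
    also have "4 * list_value w 0 (spread_values a) ys \<le> 4 * block_gauge a"
      unfolding block_gauge_def by (intro mult_left_mono list_value_le_gauge ys(1)) simp
    finally show ?thesis .
  qed
  \<comment> \<open>Groups of even and of odd number contribute a factor 4 each.\<close>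
  have "(\<Sum>m<n. block_gauge (group_part \<kappa> a m)) \<le> (\<Sum>m<2 * Suc n. block_gauge (group_part \<kappa> a m))"
    by (intro sum_mono2) auto
  also have "\<dots> = (\<Sum>i\<le>n. block_gauge (group_part \<kappa> a (2 * i + 0))) + (\<Sum>i\<le>n. block_gauge (group_part \<kappa> a (2 * i + 1)))"
    by (induction n) (simp_all add: add_ac)
  also have "\<dots> \<le> 4 * block_gauge a + 4 * block_gauge a" by (intro add_mono alt)
  also have "\<dots> = (4 + 4) * block_gauge a" by (rule distrib_right[symmetric])
  also have "(4 + 4 :: ennreal) = ennreal 8" by simp
  finally show "(\<Sum>m<n. block_gauge (group_part \<kappa> a m)) \<le> ennreal 8 * block_gauge a" .
qed simp

end

lemma block_sum_block_gauge:
  assumes p: "1 \<le> p"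
  obtains grp where "block_sum block_gauge p grp 8"
proof -
  obtain \<kappa> :: "nat \<Rightarrow> nat" where \<kappa>: "\<kappa> 0 = 0" "strict_mono \<kappa>"
    "\<And>m j. \<kappa> (Suc m) \<le> j \<Longrightarrow> 2 * W (b (\<kappa> m)) \<le> W (size_of j)"
  proof (rule sparse_groups)
  qed (rule that)
  interpret K: interval_partition \<kappa> by unfold_locales (rule \<kappa>)+
  have "block_sum block_gauge p (interval_index \<kappa>) 8"
  proof (intro block_sum.intro gauge_p.intro gauge_block_gauge gauge_p_axioms.intro p block_sum_axioms.intro)
    fix m
    have "{n. interval_index \<kappa> n = m} \<subseteq> {..<\<kappa> (Suc m)}" by (auto simp: K.interval_index_iff)
    then show "finite {n. interval_index \<kappa> n = m}" by (rule finite_subset) simp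
  next
    show "surj (interval_index \<kappa>)" by (rule surjI) (rule K.interval_index_start)
  next
    fix a show "block_gauge a \<le> (\<Sum>n. a n)" by (rule block_gauge_le_suminf)
  next
    fix a
    show "(\<Sum>m. block_gauge (\<lambda>n. if interval_index \<kappa> n = m then a n else 0)) \<le> ennreal 8 * block_gauge a"
    proof (cases "block_gauge a < top")
      case True
      have "(\<Sum>m. block_gauge (group_part \<kappa> a m)) \<le> ennreal 8 * block_gauge a"
        by (rule sum_parts_le) (fact \<kappa>(1), fact \<kappa>(2), erule \<kappa>(3), fact True)
      then show ?thesis by (simp only: group_part_def)
    next
      case False
      then have "block_gauge a = top" by (simp add: less_top[symmetric])
      then show ?thesis by (simp add: ennreal_mult_top)
    qed
  qed simp
  then show ?thesis by (rule that)
qed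

end

section \<open>Operators and operator ideals\<close>

context normed_sequences
begin

lemma bounded_map_operators: "T \<in> operators X X \<Longrightarrow> \<exists>C. bounded_map X X C T"
proof -
  assume T: "T \<in> operators X X"
  show ?thesis
  proof (rule operators_bounded_map[OF T normed_sequences_axioms])
  qed (rule exI)
qed

lemma bounded_linear_map_operators: "T \<in> operators X X \<Longrightarrow> bounded_linear_map X X T"
  unfolding bounded_linear_map_def by (rule bounded_map_operators)

lemma operators_off: "T \<in> operators X Y \<Longrightarrow> x \<notin> vecs X \<Longrightarrow> T x = 0"
  by (simp add: operators_def)

lemma operators_if_bounded_linear_map:
  assumes "bounded_linear_map X Y T" "\<And>x. x \<notin> vecs X \<Longrightarrow> T x = 0"
  shows "T \<in> operators X Y"
proof -
  obtain C where "bounded_map X Y C T" using assms(1) unfolding bounded_linear_map_def by (rule exE)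
  then show ?thesis by (rule operators_if_bounded_map) (rule assms(2))
qed

lemma operators_into: "T \<in> operators X X \<Longrightarrow> T x \<in> vecs X"
  using vecs_zero by (cases "x \<in> vecs X") (simp_all add: operators_def)

lemma operators_zero: "T \<in> operators X X \<Longrightarrow> T 0 = 0"
  using bounded_map_zero[OF normed_sequences_axioms] bounded_map_operators by blast

lemma operators_compose:
  assumes "S \<in> operators X X" "T \<in> operators X X"
  shows "S \<circ> T \<in> operators X X"
proof (rule operators_if_bounded_linear_map)
  show "bounded_linear_map X X (S \<circ> T)"
    unfolding comp_def
    by (rule bounded_linear_map_compose[OF bounded_linear_map_operators[OF assms(1)] bounded_linear_map_operators[OF assms(2)]])
  show "(S \<circ> T) x = 0" if "x \<notin> vecs X" for x
    unfolding comp_def operators_off[OF assms(2) that] by (rule operators_zero[OF assms(1)])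
qed

lemma operators_add:
  assumes "S \<in> operators X X" "T \<in> operators X X"
  shows "S + T \<in> operators X X"
proof (rule operators_if_bounded_linear_map)
  show "bounded_linear_map X X (S + T)"
    unfolding plus_fun_def[of S T]
    by (intro bounded_linear_map_add[OF normed_sequences_axioms] bounded_linear_map_operators assms)
  show "(S + T) x = 0" if "x \<notin> vecs X" for x
    unfolding plus_fun_apply[of S T] operators_off[OF assms(1) that] operators_off[OF assms(2) that] by (rule add_0)
qed

lemma operators_diff:
  assumes "S \<in> operators X X" "T \<in> operators X X"
  shows "S - T \<in> operators X X"
proof (rule operators_if_bounded_linear_map)
  show "bounded_linear_map X X (S - T)"
    unfolding fun_diff_def[of S T]
    by (intro bounded_linear_map_diff[OF normed_sequences_axioms] bounded_linear_map_operators assms)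
  show "(S - T) x = 0" if "x \<notin> vecs X" for x
    unfolding minus_apply[of S T] operators_off[OF assms(1) that] operators_off[OF assms(2) that] by (rule diff_self)
qed

lemma op_norm_bound:
  assumes T: "T \<in> operators X X" and x: "x \<in> vecs X"
  shows "vnorm X (T x) \<le> op_norm X X T * vnorm X x"
proof (cases "vnorm X x = 0")
  case True
  then have "x = 0" using norm_eq_0[OF x] by simp
  then have "vnorm X (T x) = 0" by (simp only: operators_zero[OF T] norm_zero)
  then show ?thesis using True by simp
next
  case False
  obtain C where C: "bounded_map X X C T" using bounded_map_operators[OF T] by blast
  define r where "r = vnorm X x"
  have r: "0 < r" using False norm_nonneg[OF x] by (simp add: r_def)
  define y where "y = seq_scale (of_real (1 / r)) x"
  have y: "y \<in> vecs X" unfolding y_def by (rule vecs_scale[OF x])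
  have "vnorm X y \<le> norm (of_real (1 / r) :: 'k) * vnorm X x" unfolding y_def by (rule norm_scale[OF x])
  also have "\<dots> = 1" using r unfolding norm_of_real r_def[symmetric] by simp
  finally have y1: "vnorm X y \<le> 1" .
  have bdd: "bdd_above ((\<lambda>x. vnorm X (T x)) ` {x \<in> vecs X. vnorm X x \<le> 1})"
  proof (rule bdd_aboveI)
    fix t assume "t \<in> (\<lambda>x. vnorm X (T x)) ` {x \<in> vecs X. vnorm X x \<le> 1}"
    then obtain z where z: "z \<in> vecs X" "vnorm X z \<le> 1" "t = vnorm X (T z)" by auto
    have "t \<le> C * vnorm X z" unfolding z(3) by (rule bounded_map_norm[OF C z(1)])
    also have "\<dots> \<le> C * 1" by (rule mult_left_mono[OF z(2) bounded_map_nonneg[OF C]])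
    finally show "t \<le> C" by simp
  qed
  have le: "vnorm X (T y) \<le> op_norm X X T"
    unfolding op_norm_def by (rule cSUP_upper[OF _ bdd]) (use y y1 in simp)
  have "x = seq_scale (of_real r) y"
    unfolding y_def scale_scale of_real_mult[symmetric] using r by (simp add: scale_one)
  then have "T x = seq_scale (of_real r) (T y)" using bounded_map_scale[OF C y] by (simp only:)
  then have "vnorm X (T x) \<le> norm (of_real r :: 'k) * vnorm X (T y)"
    using norm_scale[OF operators_into[OF T]] by (simp only:)
  also have "\<dots> = vnorm X (T y) * r" using r unfolding norm_of_real by simp
  also have "\<dots> \<le> op_norm X X T * r" using le r by (intro mult_right_mono) auto
  finally show ?thesis unfolding r_def .
qed

lemma zero_operator: "0 \<in> operators X X"
  by (rule operators_if_bounded_map[of _ _ 0], rule bounded_mapI)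
     (auto simp: zero_fun_def vecs_zero[unfolded zero_fun_def] norm_zero[unfolded zero_fun_def] seq_scale_def)

lemma op_norm_zero: "op_norm X X 0 = 0"
proof -
  have ne: "{x \<in> vecs X. vnorm X x \<le> 1} \<noteq> {}" using vecs_zero norm_zero by (auto intro!: exI[of _ 0])
  have "vnorm X ((0 :: (nat \<Rightarrow> 'k) \<Rightarrow> nat \<Rightarrow> 'k) x) = 0" for x
    using norm_zero by (simp add: zero_fun_def)
  then show ?thesis unfolding op_norm_def by (simp only: cSUP_const[OF ne])
qed

lemma norm_closure_linear_subspace:
  assumes H: "linear_subspace X H"
  shows "linear_subspace X (norm_closure X H)" "H \<subseteq> norm_closure X H"
    "norm_closure X (norm_closure X H) = norm_closure X H"
proof -
  have HX: "H \<subseteq> vecs X" and sub: "seqs.subspace H" using H by (auto simp: linear_subspace_def)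
  have approx: "\<exists>a\<in>H. vnorm X (x - a) < e" if "x \<in> norm_closure X H" "0 < e" for x e
    using that by (simp add: norm_closure_def)
  have clI: "x \<in> norm_closure X H" if "x \<in> vecs X" "\<And>e. 0 < e \<Longrightarrow> \<exists>a\<in>H. vnorm X (x - a) < e" for x
    using that by (simp add: norm_closure_def)
  have clX: "norm_closure X H \<subseteq> vecs X" by (auto simp: norm_closure_def)
  show sup: "H \<subseteq> norm_closure X H"
  proof
    fix x assume x: "x \<in> H"
    show "x \<in> norm_closure X H"
    proof (rule clI)
      fix e :: real assume "0 < e"
      then show "\<exists>a\<in>H. vnorm X (x - a) < e" using x norm_zero by (intro bexI[of _ x]) simp_all
    qed (use x HX in blast)
  qed
  have "seqs.subspace (norm_closure X H)"
    unfolding seqs.subspace_def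
  proof (intro conjI ballI allI)
    show "0 \<in> norm_closure X H" using sup seqs.subspace_0[OF sub] by blast
  next
    fix x y assume x: "x \<in> norm_closure X H" and y: "y \<in> norm_closure X H"
    show "x + y \<in> norm_closure X H"
    proof (rule clI)
      show "x + y \<in> vecs X" using vecs_add x y clX by blast
      fix e :: real assume e: "0 < e"
      obtain a where a: "a \<in> H" "vnorm X (x - a) < e / 2" using approx[OF x, of "e / 2"] e by auto
      obtain c where c: "c \<in> H" "vnorm X (y - c) < e / 2" using approx[OF y, of "e / 2"] e by auto
      have "(x - a) + (y - c) = x + y - (a + c)" by (rule ext) simp
      moreover have "vnorm X ((x - a) + (y - c)) \<le> vnorm X (x - a) + vnorm X (y - c)"
        using x y a(1) c(1) clX HX by (intro norm_add vecs_diff) auto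
      ultimately have "vnorm X (x + y - (a + c)) < e" using a(2) c(2) by (simp only:)
      then show "\<exists>a\<in>H. vnorm X (x + y - a) < e"
        using seqs.subspace_add[OF sub a(1) c(1)] by (intro bexI[of _ "a + c"])
    qed
  next
    fix d x assume x: "x \<in> norm_closure X H"
    show "seq_scale d x \<in> norm_closure X H"
    proof (rule clI)
      show "seq_scale d x \<in> vecs X" using vecs_scale x clX by blast
      fix e :: real assume e: "0 < e"
      then have "0 < e / (norm d + 1)" by (simp add: add_nonneg_pos)
      then obtain a where a: "a \<in> H" "vnorm X (x - a) < e / (norm d + 1)" using approx[OF x] by blast
      have v: "x - a \<in> vecs X" using x a(1) clX HX by (intro vecs_diff) auto
      have "vnorm X (seq_scale d (x - a)) \<le> norm d * vnorm X (x - a)" by (rule norm_scale[OF v])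
      also have "\<dots> \<le> (norm d + 1) * vnorm X (x - a)" using norm_nonneg[OF v] by (intro mult_right_mono) auto
      also have "\<dots> < (norm d + 1) * (e / (norm d + 1))"
        using a(2) by (intro mult_strict_left_mono) (auto intro: add_nonneg_pos)
      also have "\<dots> = e"
      proof -
        have "norm d + 1 \<noteq> 0" using norm_ge_zero[of d] by linarith
        then show ?thesis by simp
      qed
      finally have "vnorm X (seq_scale d (x - a)) < e" .
      moreover have "seq_scale d (x - a) = seq_scale d x - seq_scale d a"
        by (rule ext) (simp add: seq_scale_def right_diff_distrib)
      ultimately have "vnorm X (seq_scale d x - seq_scale d a) < e" by (simp only:)
      then show "\<exists>a\<in>H. vnorm X (seq_scale d x - a) < e"
        using seqs.subspace_scale[OF sub a(1)] by (intro bexI[of _ "seq_scale d a"])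
    qed
  qed
  then show "linear_subspace X (norm_closure X H)" using clX by (simp add: linear_subspace_def)
  show "norm_closure X (norm_closure X H) = norm_closure X H"
  proof (rule antisym)
    show "norm_closure X H \<subseteq> norm_closure X (norm_closure X H)"
    proof
      fix x assume x: "x \<in> norm_closure X H"
      have "\<exists>a\<in>norm_closure X H. vnorm X (x - a) < e" if "0 < e" for e
        using x that norm_zero by (intro bexI[of _ x]) simp_all
      then show "x \<in> norm_closure X (norm_closure X H)"
        using x clX by (simp add: norm_closure_def[of X "norm_closure X H"] subset_iff)
    qed
    show "norm_closure X (norm_closure X H) \<subseteq> norm_closure X H"
    proof
      fix x assume x: "x \<in> norm_closure X (norm_closure X H)"
      then have xX: "x \<in> vecs X" and ap: "\<And>e. 0 < e \<Longrightarrow> \<exists>a\<in>norm_closure X H. vnorm X (x - a) < e"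
        by (simp_all add: norm_closure_def[of X "norm_closure X H"])
      show "x \<in> norm_closure X H"
      proof (rule clI[OF xX])
        fix e :: real assume e: "0 < e"
        obtain y where y: "y \<in> norm_closure X H" "vnorm X (x - y) < e / 2" using ap[of "e / 2"] e by auto
        obtain a where a: "a \<in> H" "vnorm X (y - a) < e / 2" using approx[OF y(1), of "e / 2"] e by auto
        have "(x - y) + (y - a) = x - a" by (rule ext) simp
        moreover have "vnorm X ((x - y) + (y - a)) \<le> vnorm X (x - y) + vnorm X (y - a)"
          using xX y a(1) clX HX by (intro norm_add vecs_diff) auto
        ultimately have "vnorm X (x - a) < e" using a(2) y(2) by (simp only:)
        then show "\<exists>a\<in>H. vnorm X (x - a) < e" using a(1) by blast
      qed
    qed
  qed
qed

text \<open>
  Closedness of the subspace is no restriction, since lower bounds pass to the closure.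
\<close>

lemma strictly_singular_not_bounded_below:
  assumes R: "R \<in> strictly_singular X" and H: "linear_subspace X H" "infinite_dim H"
  shows "\<not> bounded_below_on X X R H"
proof
  assume "bounded_below_on X X R H"
  then obtain c where c: "0 < c" "\<And>z. z \<in> H \<Longrightarrow> c * vnorm X z \<le> vnorm X (R z)"
    unfolding bounded_below_on_def by blast
  have ops: "R \<in> operators X X" using R by (simp add: strictly_singular_def)
  obtain C where C: "bounded_map X X C R" using bounded_map_operators[OF ops] by blast
  note C0 = bounded_map_nonneg[OF C]
  note cl = norm_closure_linear_subspace[OF H(1)]
  have HX: "H \<subseteq> vecs X" using H(1) by (simp add: linear_subspace_def)
  have "c * vnorm X x \<le> vnorm X (R x)" if x: "x \<in> norm_closure X H" for x
  proof (rule field_le_epsilon)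
    fix e :: real assume e: "0 < e"
    have xX: "x \<in> vecs X" using x by (simp add: norm_closure_def)
    define d where "d = e / (c + C)"
    have d: "0 < d" "(c + C) * d = e" using e c(1) C0 by (auto simp: d_def)
    obtain a where a: "a \<in> H" "vnorm X (x - a) < d" using x d(1) unfolding norm_closure_def by blast
    have aX: "a \<in> vecs X" and v: "x - a \<in> vecs X" using a(1) HX vecs_diff[OF xX] by auto
    have "x = (x - a) + a" by (rule ext) simp
    then have "vnorm X x \<le> vnorm X (x - a) + vnorm X a" using norm_add[OF v aX] by (simp only:)
    then have "c * vnorm X x \<le> c * vnorm X (x - a) + c * vnorm X a"
      using c(1) by (metis distrib_left mult_left_mono less_imp_le)
    also have "c * vnorm X a \<le> vnorm X (R a)" by (rule c(2)[OF a(1)])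
    also have "vnorm X (R a) \<le> vnorm X (R x) + vnorm X (R (x - a))"
    proof -
      have "R a = R x - R (x - a)"
        unfolding bounded_map_diff[OF normed_sequences_axioms C xX aX] by (rule ext) simp
      then show ?thesis using norm_diff[OF operators_into[OF ops] operators_into[OF ops]] by (simp only:)
    qed
    also have "vnorm X (R (x - a)) \<le> C * vnorm X (x - a)" by (rule bounded_map_norm[OF C v])
    finally have "c * vnorm X x \<le> vnorm X (R x) + (c + C) * vnorm X (x - a)"
      unfolding distrib_right by linarith
    also have "\<dots> \<le> vnorm X (R x) + (c + C) * d"
      using a(2) c(1) C0 by (intro add_left_mono mult_left_mono) auto
    finally show "c * vnorm X x \<le> vnorm X (R x) + e" unfolding d(2) .
  qed
  then have "bounded_below_on X X R (norm_closure X H)"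
    unfolding bounded_below_on_def using c(1) by blast
  moreover have "infinite_dim (norm_closure X H)"
    using H(2) cl(2) unfolding infinite_dim_def by (meson order_trans)
  moreover have "closed_subspace X (norm_closure X H)"
    unfolding closed_subspace_def using cl by blast
  ultimately show False using R unfolding strictly_singular_def by blast
qed

end

context block_sum
begin

text \<open>
  The uniform closure of the symbols that factor through l_p; passing to the closure admits null
  sequences and makes the ideal below closed.
\<close>

definition approx_factors :: "(nat \<Rightarrow> 'k::real_normed_field) \<Rightarrow> bool" where
  "approx_factors t \<longleftrightarrow> (\<forall>\<epsilon>>0. \<exists>s. factors s \<and> (\<forall>j. norm (t j - s j) \<le> \<epsilon>))"

lemma approx_factors_if_factors: "factors t \<Longrightarrow> approx_factors t"
  unfolding approx_factors_def by (intro allI impI exI[of _ t]) simp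

lemma approx_factors_add:
  assumes "approx_factors s" "approx_factors t"
  shows "approx_factors (\<lambda>j. s j + t j)"
  unfolding approx_factors_def
proof (intro allI impI)
  fix \<epsilon> :: real assume "0 < \<epsilon>"
  then have e: "0 < \<epsilon> / 2" by simp
  obtain s' where s: "factors s'" "\<And>j. norm (s j - s' j) \<le> \<epsilon> / 2"
    using assms(1) e unfolding approx_factors_def by blast
  obtain t' where t: "factors t'" "\<And>j. norm (t j - t' j) \<le> \<epsilon> / 2"
    using assms(2) e unfolding approx_factors_def by blast
  have "norm (s j + t j - (s' j + t' j)) \<le> \<epsilon>" for j
    using norm_triangle_ineq[of "s j - s' j" "t j - t' j"] s(2)[of j] t(2)[of j] by (simp add: algebra_simps)
  then show "\<exists>u. factors u \<and> (\<forall>j. norm (s j + t j - u j) \<le> \<epsilon>)"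
    using factors_add[OF s(1) t(1)] by (intro exI[of _ "\<lambda>j. s' j + t' j"]) simp
qed

lemma approx_factors_closed:
  assumes "\<And>\<epsilon>. 0 < \<epsilon> \<Longrightarrow> \<exists>s. approx_factors s \<and> (\<forall>j. norm (t j - s j) \<le> \<epsilon>)"
  shows "approx_factors t"
  unfolding approx_factors_def
proof (intro allI impI)
  fix \<epsilon> :: real assume "0 < \<epsilon>"
  then have e: "0 < \<epsilon> / 2" by simp
  obtain s where s: "approx_factors s" "\<And>j. norm (t j - s j) \<le> \<epsilon> / 2" using assms[OF e] by blast
  obtain u where u: "factors u" "\<And>j. norm (s j - u j) \<le> \<epsilon> / 2"
    using s(1) e unfolding approx_factors_def by blast
  have "norm (t j - u j) \<le> \<epsilon>" for j
    using norm_triangle_ineq[of "t j - s j" "s j - u j"] s(2)[of j] u(2)[of j] by simp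
  then show "\<exists>u. factors u \<and> (\<forall>j. norm (t j - u j) \<le> \<epsilon>)" using u(1) by blast
qed

lemma approx_factors_null_sequence:
  fixes t :: "nat \<Rightarrow> 'k::real_normed_field"
  assumes "t \<longlonglongrightarrow> 0"
  shows "approx_factors t"
  unfolding approx_factors_def
proof (intro allI impI)
  fix \<epsilon> :: real assume "0 < \<epsilon>"
  then obtain J where J: "\<And>j. J \<le> j \<Longrightarrow> norm (t j) < \<epsilon>" using LIMSEQ_D[OF assms, of \<epsilon>] by auto
  have "factors (\<lambda>j. if j < J then t j else 0)" by (rule factors_finite_support) simp
  moreover have "norm (t j - (if j < J then t j else 0)) \<le> \<epsilon>" for j
    using J[of j] \<open>0 < \<epsilon>\<close> by (cases "j < J") (auto simp: less_imp_le)
  ultimately show "\<exists>s. factors s \<and> (\<forall>j. norm (t j - s j) \<le> \<epsilon>)" by blast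
qed

end

section \<open>The ideal of operators whose diagonals nearly factor\<close>

context block_sum
begin

text \<open>
  E maps the l_p-sum of blocks into X and Q maps X back to it. The quantifiers over U and V turn
  a linear condition on the diagonal into a two-sided ideal.
\<close>

definition diagonal_ideal ::
    "'k::real_normed_field seq_space \<Rightarrow> ((nat \<Rightarrow> 'k) \<Rightarrow> (nat \<Rightarrow> 'k)) \<Rightarrow> ((nat \<Rightarrow> 'k) \<Rightarrow> (nat \<Rightarrow> 'k))
      \<Rightarrow> ((nat \<Rightarrow> 'k) \<Rightarrow> (nat \<Rightarrow> 'k)) set" where
  "diagonal_ideal X E Q = {T \<in> operators X X. \<forall>U\<in>operators X X. \<forall>V\<in>operators X X.
     approx_factors (\<lambda>j. Q (U (T (V (E (unit_seq j))))) j)}"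

context
  fixes X :: "'k::{real_normed_field,heine_borel} seq_space" and E Q CE CQ
  assumes X: "normed_sequences X" and E: "bounded_map G X CE E" and Q: "bounded_map X G CQ Q"
begin

interpretation X: normed_sequences X by (rule X)

lemma diagonal_idealI:
  assumes "T \<in> operators X X"
    "\<And>U V. U \<in> operators X X \<Longrightarrow> V \<in> operators X X \<Longrightarrow> approx_factors (\<lambda>j. Q (U (T (V (E (unit_seq j))))) j)"
  shows "T \<in> diagonal_ideal X E Q"
  using assms by (simp add: diagonal_ideal_def)

lemma diagonal_idealD:
  assumes "T \<in> diagonal_ideal X E Q"
  shows "T \<in> operators X X"
    "U \<in> operators X X \<Longrightarrow> V \<in> operators X X \<Longrightarrow> approx_factors (\<lambda>j. Q (U (T (V (E (unit_seq j))))) j)"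
  using assms by (simp_all add: diagonal_ideal_def)

lemma compose_diagonal_ideal:
  assumes A: "A \<in> operators X X" and T: "T \<in> diagonal_ideal X E Q"
  shows "A \<circ> T \<in> diagonal_ideal X E Q" "T \<circ> A \<in> diagonal_ideal X E Q"
proof -
  note TX = diagonal_idealD(1)[OF T]
  show "A \<circ> T \<in> diagonal_ideal X E Q"
  proof (rule diagonal_idealI[OF X.operators_compose[OF A TX]])
    fix U V assume U: "U \<in> operators X X" and V: "V \<in> operators X X"
    show "approx_factors (\<lambda>j. Q (U ((A \<circ> T) (V (E (unit_seq j))))) j)"
      using diagonal_idealD(2)[OF T X.operators_compose[OF U A] V] by (simp only: comp_def)
  qed
  show "T \<circ> A \<in> diagonal_ideal X E Q"
  proof (rule diagonal_idealI[OF X.operators_compose[OF TX A]])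
    fix U V assume U: "U \<in> operators X X" and V: "V \<in> operators X X"
    show "approx_factors (\<lambda>j. Q (U ((T \<circ> A) (V (E (unit_seq j))))) j)"
      using diagonal_idealD(2)[OF T U X.operators_compose[OF A V]] by (simp only: comp_def)
  qed
qed

lemma operator_ideal_diagonal_ideal: "operator_ideal X (diagonal_ideal X E Q)"
  unfolding operator_ideal_def
proof (intro conjI ballI allI)
  show "diagonal_ideal X E Q \<subseteq> operators X X" using diagonal_idealD(1) by blast
  show "0 \<in> diagonal_ideal X E Q"
  proof (rule diagonal_idealI[OF X.zero_operator])
    fix U V assume U: "U \<in> operators X X" and V: "V \<in> operators X X"
    have "Q (U ((0 :: (nat \<Rightarrow> 'k) \<Rightarrow> nat \<Rightarrow> 'k) x)) = 0" for x
    proof -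
      have "(0 :: (nat \<Rightarrow> 'k) \<Rightarrow> nat \<Rightarrow> 'k) x = 0" by (simp add: zero_fun_def)
      then show ?thesis by (simp only: X.operators_zero[OF U] bounded_map_zero[OF X Q])
    qed
    then have "(\<lambda>j. Q (U ((0 :: (nat \<Rightarrow> 'k) \<Rightarrow> nat \<Rightarrow> 'k) (V (E (unit_seq j))))) j) = (\<lambda>j. 0)"
      by (simp only: zero_fun_def)
    moreover have "approx_factors (\<lambda>j. 0 :: 'k)"
      by (rule approx_factors_null_sequence) simp
    ultimately show "approx_factors (\<lambda>j. Q (U ((0 :: (nat \<Rightarrow> 'k) \<Rightarrow> nat \<Rightarrow> 'k) (V (E (unit_seq j))))) j)"
      by (simp only:)
  qed
next
  fix S T assume S: "S \<in> diagonal_ideal X E Q" and T: "T \<in> diagonal_ideal X E Q"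
  note ST = diagonal_idealD(1)[OF S] diagonal_idealD(1)[OF T]
  show "S + T \<in> diagonal_ideal X E Q"
  proof (rule diagonal_idealI[OF X.operators_add[OF ST]])
    fix U V assume U: "U \<in> operators X X" and V: "V \<in> operators X X"
    obtain CU where CU: "bounded_map X X CU U" using X.bounded_map_operators[OF U] by (rule exE)
    note QU = bounded_map_compose[OF CU Q]
    have "Q (U ((S + T) x)) = Q (U (S x)) + Q (U (T x))" for x
      unfolding plus_fun_apply[of S T]
      by (rule bounded_map_add[OF QU X.operators_into[OF ST(1)] X.operators_into[OF ST(2)]])
    then have eq: "(\<lambda>j. Q (U ((S + T) (V (E (unit_seq j))))) j)
        = (\<lambda>j. Q (U (S (V (E (unit_seq j))))) j + Q (U (T (V (E (unit_seq j))))) j)"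
      by (simp only: plus_fun_apply[of "Q y" for y])
    show "approx_factors (\<lambda>j. Q (U ((S + T) (V (E (unit_seq j))))) j)"
      unfolding eq by (rule approx_factors_add[OF diagonal_idealD(2)[OF S U V] diagonal_idealD(2)[OF T U V]])
  qed
next
  fix c T assume T: "T \<in> diagonal_ideal X E Q"
  obtain Cc where "bounded_map X X Cc (seq_scale c)"
    using bounded_linear_map_scale[OF X, of c] unfolding bounded_linear_map_def by (rule exE)
  then have "extend_by_zero X (seq_scale c) \<in> operators X X" by (rule extend_by_zero_operators[OF _ X])
  then have "extend_by_zero X (seq_scale c) \<circ> T \<in> diagonal_ideal X E Q" by (rule compose_diagonal_ideal(1)[OF _ T])
  moreover have "extend_by_zero X (seq_scale c) \<circ> T = (\<lambda>x. seq_scale c (T x))"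
    by (rule ext) (simp only: comp_def extend_by_zero_def X.operators_into[OF diagonal_idealD(1)[OF T]] if_True)
  ultimately show "(\<lambda>x. seq_scale c (T x)) \<in> diagonal_ideal X E Q" by (simp only:)
next
  fix A T assume "A \<in> operators X X" "T \<in> diagonal_ideal X E Q"
  then show "A \<circ> T \<in> diagonal_ideal X E Q" "T \<circ> A \<in> diagonal_ideal X E Q"
    by (rule compose_diagonal_ideal(1), rule compose_diagonal_ideal(2))
qed

text \<open>
  Every diagonal entry depends on T with a Lipschitz constant that is the same for all entries.
\<close>

lemma closed_operator_ideal_diagonal_ideal: "closed_operator_ideal X (diagonal_ideal X E Q)"
  unfolding closed_operator_ideal_def
proof (intro conjI operator_ideal_diagonal_ideal antisym subsetI)
  fix T assume "T \<in> op_closure X (diagonal_ideal X E Q)"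
  then have T: "T \<in> operators X X" and
    near: "\<And>\<epsilon>. 0 < \<epsilon> \<Longrightarrow> \<exists>S\<in>diagonal_ideal X E Q. op_norm X X (T - S) < \<epsilon>"
    by (simp_all add: op_closure_def)
  show "T \<in> diagonal_ideal X E Q"
  proof (rule diagonal_idealI[OF T])
    fix U V assume U: "U \<in> operators X X" and V: "V \<in> operators X X"
    obtain CU where CU: "bounded_map X X CU U" using X.bounded_map_operators[OF U] by (rule exE)
    obtain CV where CV: "bounded_map X X CV V" using X.bounded_map_operators[OF V] by (rule exE)
    note QU = bounded_map_compose[OF CU Q]
    note VE = bounded_map_compose[OF E CV]
    define M where "M = (CQ * CU) * (CV * CE)"
    have M: "0 \<le> CQ * CU" "0 \<le> CV * CE" "0 \<le> M"
      unfolding M_def using bounded_map_nonneg[OF QU] bounded_map_nonneg[OF VE] by simp_all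
    show "approx_factors (\<lambda>j. Q (U (T (V (E (unit_seq j))))) j)"
    proof (rule approx_factors_closed)
      fix \<epsilon> :: real assume \<epsilon>: "0 < \<epsilon>"
      then have "0 < \<epsilon> / (M + 1)" using M(3) by simp
      then obtain S where S: "S \<in> diagonal_ideal X E Q" "op_norm X X (T - S) < \<epsilon> / (M + 1)" using near by blast
      note SX = diagonal_idealD(1)[OF S(1)]
      have "norm (Q (U (T (V (E (unit_seq j))))) j - Q (U (S (V (E (unit_seq j))))) j) \<le> \<epsilon>" for j
      proof -
        define x where "x = V (E (unit_seq j))"
        have x: "x \<in> vecs X" unfolding x_def by (rule bounded_map_vecs[OF VE unit_vecs])
        have u1: "vnorm G (unit_seq j :: nat \<Rightarrow> 'k) \<le> 1"
          using vnorm_le_iff[of 1 "unit_seq j :: nat \<Rightarrow> 'k"] F_pw_unit[of j, where 'k = 'k] by simp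
        have "vnorm X x \<le> (CV * CE) * vnorm G (unit_seq j :: nat \<Rightarrow> 'k)"
          unfolding x_def by (rule bounded_map_norm[OF VE unit_vecs])
        also have "\<dots> \<le> (CV * CE) * 1" by (rule mult_left_mono[OF u1 M(2)])
        finally have xn: "vnorm X x \<le> CV * CE" by simp
        have eq: "Q (U (T x)) - Q (U (S x)) = Q (U ((T - S) x))"
          unfolding minus_apply[of T S]
          by (rule bounded_map_diff[OF X QU X.operators_into[OF T] X.operators_into[OF SX], symmetric])
        have D: "(T - S) x \<in> vecs X" by (rule X.operators_into[OF X.operators_diff[OF T SX]])
        have "norm (Q (U (T x)) j - Q (U (S x)) j) = norm ((Q (U (T x)) - Q (U (S x))) j)"
          by (simp only: minus_apply)
        also have "\<dots> = norm (Q (U ((T - S) x)) j)" by (simp only: eq)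
        also have "\<dots> \<le> vnorm G (Q (U ((T - S) x)))" by (rule coordinate[OF bounded_map_vecs[OF QU D]])
        also have "\<dots> \<le> (CQ * CU) * vnorm X ((T - S) x)" by (rule bounded_map_norm[OF QU D])
        also have "\<dots> \<le> (CQ * CU) * (op_norm X X (T - S) * vnorm X x)"
          by (rule mult_left_mono[OF X.op_norm_bound[OF X.operators_diff[OF T SX] x] M(1)])
        also have "\<dots> \<le> (CQ * CU) * (\<epsilon> / (M + 1) * vnorm X x)"
          using S(2) X.norm_nonneg[OF x] by (intro mult_left_mono[OF _ M(1)] mult_right_mono) simp_all
        also have "\<dots> \<le> (CQ * CU) * (\<epsilon> / (M + 1) * (CV * CE))"
          using \<epsilon> M(3) by (intro mult_left_mono[OF _ M(1)] mult_left_mono[OF xn]) simp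
        also have "\<dots> = M / (M + 1) * \<epsilon>" unfolding M_def by simp
        also have "\<dots> \<le> 1 * \<epsilon>" using \<epsilon> M(3) by (intro mult_right_mono) auto
        finally show ?thesis unfolding x_def by simp
      qed
      then show "\<exists>s. approx_factors s \<and> (\<forall>j. norm (Q (U (T (V (E (unit_seq j))))) j - s j) \<le> \<epsilon>)"
        using diagonal_idealD(2)[OF S(1) U V] by (intro exI conjI allI)
    qed
  qed
next
  fix T assume T: "T \<in> diagonal_ideal X E Q"
  have "op_norm X X (T - T) = 0" unfolding diff_self by (rule X.op_norm_zero)
  then show "T \<in> op_closure X (diagonal_ideal X E Q)"
    unfolding op_closure_def using T diagonal_idealD(1)[OF T] by (intro CollectI conjI allI impI bexI[of _ T]) simp_all
qed

lemma factoring_subset_diagonal_ideal: "factoring_through (lp_space p) X \<subseteq> diagonal_ideal X E Q"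
proof
  fix T assume "T \<in> factoring_through (lp_space p) X"
  then obtain A B where T: "T = A \<circ> B" and AB: "A \<in> operators (lp_space p) X" "B \<in> operators X (lp_space p)"
    by (auto simp: factoring_through_def)
  have sX: "same_space X X" by (simp add: same_space_def)
  have A': "A \<in> operators (lp_gauged p) X" using AB(1) same_space_operators[OF same_space_lp[OF p1] sX] by (simp only:)
  have B': "B \<in> operators X (lp_gauged p)" using AB(2) same_space_operators[OF sX same_space_lp[OF p1]] by (simp only:)
  obtain CA where CA: "bounded_map (lp_gauged p) X CA A"
  proof (rule operators_bounded_map[OF A' lp.normed_sequences_axioms])
  qed (rule that)
  obtain CB where CB: "bounded_map X (lp_gauged p) CB B"
  proof (rule operators_bounded_map[OF B' X])
  qed (rule that)
  have "bounded_map X X (CA * CB) T" unfolding T comp_def by (rule bounded_map_compose[OF CB CA])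
  moreover have "T x = 0" if "x \<notin> vecs X" for x
    unfolding T comp_def X.operators_off[OF AB(2) that]
    by (rule bounded_map_zero[OF lp.normed_sequences_axioms CA])
  ultimately have TX: "T \<in> operators X X" by (rule operators_if_bounded_map)
  show "T \<in> diagonal_ideal X E Q"
  proof (rule diagonal_idealI[OF TX])
    fix U V assume U: "U \<in> operators X X" and V: "V \<in> operators X X"
    obtain CU where CU: "bounded_map X X CU U" using X.bounded_map_operators[OF U] by (rule exE)
    obtain CV where CV: "bounded_map X X CV V" using X.bounded_map_operators[OF V] by (rule exE)
    note \<alpha> = power_bounded_if[OF lp.gauge_p_axioms gauge_p_axioms bounded_map_compose[OF CA bounded_map_compose[OF CU Q]]]
    note \<beta> = power_bounded_if[OF gauge_p_axioms lp.gauge_p_axioms bounded_map_compose[OF bounded_map_compose[OF E CV] CB]]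
    show "approx_factors (\<lambda>j. Q (U (T (V (E (unit_seq j))))) j)"
      unfolding T comp_def by (rule approx_factors_if_factors[OF diagonal_factors[OF \<beta> \<alpha>]])
  qed
qed

text \<open>
  If the diagonal of Q U R V E did not tend to 0, this operator would be bounded below on an
  infinite-dimensional subspace H. Then R would be bounded below on the image of H under V E, which is
  again infinite-dimensional because V E is injective on H.
\<close>

lemma strictly_singular_subset_diagonal_ideal: "strictly_singular X \<subseteq> diagonal_ideal X E Q"
proof
  fix R assume R: "R \<in> strictly_singular X"
  then have RX: "R \<in> operators X X" by (simp add: strictly_singular_def)
  show "R \<in> diagonal_ideal X E Q"
  proof (rule diagonal_idealI[OF RX], rule approx_factors_null_sequence, rule ccontr)
    fix U V assume U: "U \<in> operators X X" and V: "V \<in> operators X X"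
    obtain CU where CU: "bounded_map X X CU U" using X.bounded_map_operators[OF U] by (rule exE)
    obtain CV where CV: "bounded_map X X CV V" using X.bounded_map_operators[OF V] by (rule exE)
    obtain CR where CR: "bounded_map X X CR R" using X.bounded_map_operators[OF RX] by (rule exE)
    note QU = bounded_map_compose[OF CU Q]
    note VE = bounded_map_compose[OF E CV]
    note S = bounded_map_compose[OF VE bounded_map_compose[OF CR QU]]
    assume nz: "\<not> (\<lambda>j. Q (U (R (V (E (unit_seq j))))) j) \<longlonglongrightarrow> 0"
    obtain H c where H: "0 < c" "seqs.subspace H" "H \<subseteq> vecs G" "infinite_dim H"
      "\<And>h. h \<in> H \<Longrightarrow> c * vnorm G h \<le> vnorm G (Q (U (R (V (E h)))))"
    proof (rule bounded_below_subspace[OF S nz])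
    qed (rule that)
    let ?H = "(\<lambda>x. V (E x)) ` H"
    have "linear_subspace X ?H"
      unfolding linear_subspace_def
    proof
      show "?H \<subseteq> vecs X" using bounded_map_vecs[OF VE] H(3) by blast
      show "seqs.subspace ?H" by (rule bounded_map_subspace[OF normed_sequences_axioms VE H(2,3)])
    qed
    moreover have "infinite_dim ?H"
    proof (rule infinite_dim_image[OF normed_sequences_axioms VE H(2-4)])
      fix h assume h: "h \<in> H" and z: "V (E h) = 0"
      have "vnorm G (Q (U (R (V (E h))))) = 0"
        unfolding z by (simp only: X.operators_zero[OF RX] bounded_map_zero[OF X QU] norm_zero)
      then have "c * vnorm G h \<le> 0" using H(5)[OF h] by simp
      then have "vnorm G h \<le> 0" using H(1) by (simp add: mult_le_0_iff)
      then show "h = 0" using norm_eq_0[of h] h H(3) by blast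
    qed
    moreover have "bounded_below_on X X R ?H"
      unfolding bounded_below_on_def
    proof (intro exI[of _ "c / ((CQ * CU + 1) * (CV * CE + 1))"] conjI ballI)
      have pos: "0 \<le> CQ * CU" "0 \<le> CV * CE" by (rule bounded_map_nonneg[OF QU], rule bounded_map_nonneg[OF VE])
      then show "0 < c / ((CQ * CU + 1) * (CV * CE + 1))" using H(1) by simp
      fix z assume "z \<in> ?H"
      then obtain h where h: "h \<in> H" "z = V (E h)" by blast
      have hG: "h \<in> vecs G" using h(1) H(3) by blast
      have z: "z \<in> vecs X" unfolding h(2) by (rule bounded_map_vecs[OF VE hG])
      have Rz: "R z \<in> vecs X" by (rule X.operators_into[OF RX])
      have "vnorm X z \<le> (CV * CE) * vnorm G h" unfolding h(2) by (rule bounded_map_norm[OF VE hG])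
      also have "\<dots> \<le> (CV * CE + 1) * vnorm G h" by (intro mult_right_mono) simp_all
      finally have "c * vnorm X z \<le> c * ((CV * CE + 1) * vnorm G h)" using H(1) by (intro mult_left_mono) simp_all
      also have "\<dots> = (CV * CE + 1) * (c * vnorm G h)" by (simp only: mult_ac)
      also have "\<dots> \<le> (CV * CE + 1) * vnorm G (Q (U (R z)))"
        unfolding h(2) using pos by (intro mult_left_mono H(5) h(1)) simp
      also have "\<dots> \<le> (CV * CE + 1) * ((CQ * CU) * vnorm X (R z))"
        using pos by (intro mult_left_mono bounded_map_norm[OF QU Rz]) simp
      also have "\<dots> \<le> (CV * CE + 1) * ((CQ * CU + 1) * vnorm X (R z))"
        using pos X.norm_nonneg[OF Rz] by (intro mult_left_mono mult_right_mono) simp_all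
      finally have le: "c * vnorm X z \<le> vnorm X (R z) * ((CQ * CU + 1) * (CV * CE + 1))" by (simp only: mult_ac)
      have "0 < (CQ * CU + 1) * (CV * CE + 1)" using pos by (intro mult_pos_pos) linarith+
      then show "c / ((CQ * CU + 1) * (CV * CE + 1)) * vnorm X z \<le> vnorm X (R z)"
        using le by (simp add: pos_divide_le_eq)
    qed
    ultimately show False using X.strictly_singular_not_bounded_below[OF R] by blast
  qed
qed

lemma closed_ideal_join_subset_diagonal_ideal:
  "closed_ideal_join X (op_closure X (factoring_through (lp_space p) X)) (strictly_singular X)
    \<subseteq> diagonal_ideal X E Q"
proof -
  have "op_closure X (factoring_through (lp_space p) X) \<subseteq> op_closure X (diagonal_ideal X E Q)"
    unfolding op_closure_def using factoring_subset_diagonal_ideal by blast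
  also have "\<dots> = diagonal_ideal X E Q"
    using closed_operator_ideal_diagonal_ideal unfolding closed_operator_ideal_def by (rule conjunct2)
  finally show ?thesis
    unfolding closed_ideal_join_def
    using closed_operator_ideal_diagonal_ideal strictly_singular_subset_diagonal_ideal by (intro Inter_lower) simp
qed

lemma isomorphic_lp_if_diagonal_one:
  assumes P: "P \<in> diagonal_ideal X E Q" and U: "U \<in> operators X X" and V: "V \<in> operators X X"
    and one: "\<And>j. Q (U (P (V (E (unit_seq j))))) j = 1"
  shows "isomorphic_spaces (G :: 'k seq_space) (lp_gauged p)"
proof -
  have a: "approx_factors (\<lambda>j. Q (U (P (V (E (unit_seq j))))) j)" by (rule diagonal_idealD(2)[OF P U V])
  have "\<exists>s. factors s \<and> (\<forall>j. norm (Q (U (P (V (E (unit_seq j))))) j - s j) \<le> 1 / 2)"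
    by (rule a[unfolded approx_factors_def, rule_format]) simp
  then obtain s :: "nat \<Rightarrow> 'k" where s: "factors s" "\<And>j. norm (1 - s j) \<le> 1 / 2"
    unfolding one by blast
  show ?thesis by (rule isomorphic_lp_if_factors_near_one[OF s])
qed

end

end

section \<open>The span of the blocks\<close>

lemma (in normed_sequences) normed_sequences_restrict:
  assumes "seqs.subspace H" "H \<subseteq> vecs X"
  shows "normed_sequences (restrict_to X H)"
  using assms norm_add norm_scale coordinate
  by unfold_locales (auto simp: restrict_to_def seqs.subspace_0 seqs.subspace_add seqs.subspace_scale subset_iff)

lemma isomorphic_spaces_trans:
  assumes "normed_sequences X" "normed_sequences Y" "normed_sequences Z"
    and "isomorphic_spaces X Y" "isomorphic_spaces Y Z"
  shows "isomorphic_spaces X Z"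
proof -
  obtain T S where TS: "T \<in> operators X Y" "S \<in> operators Y X" and
    ST: "\<And>x. x \<in> vecs X \<Longrightarrow> S (T x) = x" "\<And>y. y \<in> vecs Y \<Longrightarrow> T (S y) = y"
    using assms(4) unfolding isomorphic_spaces_def by blast
  obtain T' S' where TS': "T' \<in> operators Y Z" "S' \<in> operators Z Y" and
    ST': "\<And>x. x \<in> vecs Y \<Longrightarrow> S' (T' x) = x" "\<And>y. y \<in> vecs Z \<Longrightarrow> T' (S' y) = y"
    using assms(5) unfolding isomorphic_spaces_def by blast
  obtain C1 where C1: "bounded_map X Y C1 T"
  proof (rule operators_bounded_map[OF TS(1) assms(1)]) qed (rule that)
  obtain C2 where C2: "bounded_map Y X C2 S"
  proof (rule operators_bounded_map[OF TS(2) assms(2)]) qed (rule that)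
  obtain C3 where C3: "bounded_map Y Z C3 T'"
  proof (rule operators_bounded_map[OF TS'(1) assms(2)]) qed (rule that)
  obtain C4 where C4: "bounded_map Z Y C4 S'"
  proof (rule operators_bounded_map[OF TS'(2) assms(3)]) qed (rule that)
  show ?thesis
  proof (rule isomorphic_spacesI[OF assms(1,3) bounded_map_compose[OF C1 C3] bounded_map_compose[OF C4 C2]])
    show "S (S' (T' (T x))) = x" if "x \<in> vecs X" for x
      by (simp only: ST'(1)[OF bounded_map_vecs[OF C1 that]] ST(1)[OF that])
    show "T' (T (S (S' y))) = y" if "y \<in> vecs Z" for y
      by (simp only: ST(2)[OF bounded_map_vecs[OF C4 that]] ST'(2)[OF that])
  qed
qed

text \<open>
  P restricts to an isomorphism from a subspace where it is bounded below onto a subspace of Y.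
\<close>

lemma projection_singular_for:
  fixes X :: "'k::real_normed_field seq_space"
  assumes X: "normed_sequences X" and P: "projection_onto X Y P"
    and nY: "\<not> contains_isomorph (restrict_to X Y) X"
  shows "P \<in> singular_for X X"
proof -
  interpret X: normed_sequences X by (rule X)
  have ops: "P \<in> operators X X" and YP: "P ` vecs X = Y" using P by (simp_all add: projection_onto_def)
  obtain CP where CP: "bounded_map X X CP P" using X.bounded_map_operators[OF ops] by (rule exE)
  have False if Z: "linear_subspace X Z" and iso: "isomorphic_spaces (restrict_to X Z) X"
    and low: "bounded_below_on X X P Z" for Z
  proof -
    have ZX: "Z \<subseteq> vecs X" and subZ: "seqs.subspace Z" using Z by (auto simp: linear_subspace_def)
    obtain c where c: "0 < c" "\<And>z. z \<in> Z \<Longrightarrow> c * vnorm X z \<le> vnorm X (P z)"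
      using low unfolding bounded_below_on_def by blast
    have inj: "z = z'" if z: "z \<in> Z" "z' \<in> Z" "P z = P z'" for z z'
    proof -
      have d: "z - z' \<in> Z" by (rule seqs.subspace_diff[OF subZ z(1,2)])
      have "P (z - z') = P z - P z'" using z ZX by (intro bounded_map_diff[OF X CP]) auto
      then have "vnorm X (P (z - z')) = 0" by (simp only: z(3) diff_self X.norm_zero)
      then have "c * vnorm X (z - z') \<le> 0" using c(2)[OF d] by simp
      then have "vnorm X (z - z') \<le> 0" using c(1) by (simp add: mult_le_0_iff)
      then have "z - z' = 0" using X.norm_eq_0[of "z - z'"] d ZX by blast
      then show ?thesis by simp
    qed
    define U where "U = P ` Z"
    define g where "g = inv_into Z P"
    have gP: "g (P z) = z" if "z \<in> Z" for z
      unfolding g_def by (rule inv_into_f_f[OF _ that]) (auto intro!: inj_onI inj)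
    have gZ: "g u \<in> Z" "P (g u) = u" if "u \<in> U" for u
      using that gP unfolding U_def by auto
    have subU: "seqs.subspace U" unfolding U_def by (rule bounded_map_subspace[OF X CP subZ ZX])
    have UY: "U \<subseteq> Y" using YP ZX unfolding U_def by blast
    have UX: "U \<subseteq> vecs X" unfolding U_def using X.operators_into[OF ops] by blast
    note rest = X.normed_sequences_restrict
    note nZ = rest[OF subZ ZX] and nU = rest[OF subU UX]
    have vr: "vecs (restrict_to X H) = H" "vnorm (restrict_to X H) = vnorm X" for H
      by (simp_all add: restrict_to_def)
    have Pm: "bounded_map (restrict_to X Z) (restrict_to X U) CP P"
      using CP ZX unfolding bounded_map_def vr U_def by blast
    have gm: "bounded_map (restrict_to X U) (restrict_to X Z) (1 / c) g"
    proof (rule bounded_mapI, simp_all only: vr)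
      show "0 \<le> 1 / c" using c(1) by simp
    next
      fix u assume u: "u \<in> U"
      have "c * vnorm X (g u) \<le> vnorm X u" using c(2)[OF gZ(1)[OF u]] by (simp only: gZ(2)[OF u])
      then show "g u \<in> Z \<and> vnorm X (g u) \<le> 1 / c * vnorm X u"
        using gZ(1)[OF u] c(1) by (simp add: field_simps)
    next
      fix u v assume u: "u \<in> U" and v: "v \<in> U"
      have "P (g u + g v) = u + v"
        using bounded_map_add[OF CP, of "g u" "g v"] gZ[OF u] gZ[OF v] ZX by (auto simp only:)
      then show "g (u + v) = g u + g v"
        using gP[OF seqs.subspace_add[OF subZ gZ(1)[OF u] gZ(1)[OF v]]] by (simp only:)
    next
      fix d u assume u: "u \<in> U"
      have "P (seq_scale d (g u)) = seq_scale d u"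
        using bounded_map_scale[OF CP, of "g u" d] gZ[OF u] ZX by (auto simp only:)
      then show "g (seq_scale d u) = seq_scale d (g u)"
        using gP[OF seqs.subspace_scale[OF subZ gZ(1)[OF u], of d]] by (simp only:)
    qed
    have "isomorphic_spaces (restrict_to X U) (restrict_to X Z)"
      by (rule isomorphic_spacesI[OF nU nZ gm Pm]) (unfold vr, auto simp only: gZ gP)
    then have "isomorphic_spaces (restrict_to X U) X"
      by (rule isomorphic_spaces_trans[OF nU nZ X _ iso])
    moreover have "restrict_to (restrict_to X Y) U = restrict_to X U" by (simp add: restrict_to_def)
    moreover have "linear_subspace (restrict_to X Y) U"
      using subU UY by (simp add: linear_subspace_def vr)
    ultimately have "contains_isomorph (restrict_to X Y) X"
      unfolding contains_isomorph_def by (intro exI[of _ U]) simp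
    then show False using nY by blast
  qed
  then show ?thesis unfolding singular_for_def using ops by blast
qed

context lorentz_blocks
begin

definition block_coeff :: "real \<Rightarrow> nat \<Rightarrow> real" where
  "block_coeff p j = 1 / W (size_of j) powr (1 / p)"

text \<open>
  Defined for arbitrary coefficient sequences, so that the closed span of the blocks is the image of the
  sequences with finite gauge.
\<close>

definition combine_blocks :: "real \<Rightarrow> (nat \<Rightarrow> 'k::real_normed_field) \<Rightarrow> nat \<Rightarrow> 'k" where
  "combine_blocks p c = (\<lambda>n. of_real (block_coeff p (interval_index b n)) * c (interval_index b n))"

definition coefficients :: "real \<Rightarrow> (nat \<Rightarrow> 'k::real_normed_field) \<Rightarrow> nat \<Rightarrow> 'k" where
  "coefficients p x = (\<lambda>j. x (b j) / of_real (block_coeff p j))"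

lemma block_coeff_pos: "0 < block_coeff p j"
  using W_size_pos[of j] by (simp add: block_coeff_def)

lemma coefficients_combine_blocks: "coefficients p (combine_blocks p c) = c"
proof
  fix j
  have "of_real (block_coeff p j) \<noteq> (0 :: 'a)" using block_coeff_pos[of p j] by simp
  then show "coefficients p (combine_blocks p c) j = c j"
    by (simp add: coefficients_def combine_blocks_def interval_index_start)
qed

lemma combine_blocks_add: "combine_blocks p (x + y) = combine_blocks p x + combine_blocks p y"
  by (rule ext) (simp add: combine_blocks_def distrib_left)

lemma combine_blocks_scale: "combine_blocks p (seq_scale d x) = seq_scale d (combine_blocks p x)"
  by (rule ext) (simp add: combine_blocks_def seq_scale_def)

lemma pw_combine_blocks: "pw p (combine_blocks p c) = spread_values (pw p c)" if "1 \<le> p"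
proof
  fix n
  let ?j = "interval_index b n"
  have "block_coeff p ?j powr p = 1 / W (size_of ?j)"
    using that W_size_pos[of ?j] by (simp add: block_coeff_def powr_divide powr_powr)
  then show "pw p (combine_blocks p c) n = spread_values (pw p c) n"
    using block_coeff_pos[of p ?j] W_size_pos[of ?j]
    by (simp add: pw_def combine_blocks_def spread_values_def norm_mult powr_mult mult.commute flip: ennreal_mult)
qed

lemma combine_blocks_unit_seq:
  "combine_blocks p (unit_seq j :: nat \<Rightarrow> 'k::real_normed_field) = seq_scale (of_real (1 / W (size_of j) powr (1 / p))) (\<Sum>n\<in>{b j..<b (Suc j)}. unit_seq n)"
proof
  fix n
  have "(\<Sum>m\<in>{b j..<b (Suc j)}. unit_seq m) n = (\<Sum>m\<in>{b j..<b (Suc j)}. if m = n then 1 else (0 :: 'k))"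
    unfolding sum_fun_at by (rule sum.cong) (auto simp: unit_seq_def)
  also have "\<dots> = (if interval_index b n = j then 1 else 0)"
    by (simp add: interval_index_iff)
  finally have sum: "(\<Sum>m\<in>{b j..<b (Suc j)}. unit_seq m) n = (if interval_index b n = j then 1 else (0 :: 'k))" .
  have unit: "unit_seq j (interval_index b n) = (if interval_index b n = j then 1 else (0 :: 'k))"
    by (simp add: unit_seq_def)
  show "combine_blocks p (unit_seq j :: nat \<Rightarrow> 'k) n
      = seq_scale (of_real (1 / W (size_of j) powr (1 / p))) (\<Sum>n\<in>{b j..<b (Suc j)}. unit_seq n) n"
    unfolding combine_blocks_def seq_scale_def sum unit block_coeff_def by simp
qed

context
  fixes p :: real
  assumes p1: "1 \<le> p"
begin

abbreviation X_space :: "'k::real_normed_field seq_space" where "X_space \<equiv> lorentz_space w p"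
abbreviation Z_space :: "'k::real_normed_field seq_space" where "Z_space \<equiv> gauge_space p block_gauge"

lemma gauge_p_lorentz: "gauge_p (lorentz_gauge w) p"
  by (intro gauge_p.intro gauge_lorentz_w gauge_p_axioms.intro p1)

lemma gauge_p_block: "gauge_p block_gauge p"
  by (intro gauge_p.intro gauge_block_gauge gauge_p_axioms.intro p1)

interpretation LG: gauge_p "lorentz_gauge w" p by (rule gauge_p_lorentz)
interpretation ZG: gauge_p block_gauge p by (rule gauge_p_block)

lemma same_space_X: "same_space (X_space :: 'k::real_normed_field seq_space) (gauge_space p (lorentz_gauge w))"
  by (rule same_space_lorentz[OF p1 w_pos])

lemma normed_sequences_X: "normed_sequences (X_space :: 'k::real_normed_field seq_space)"
  by (rule same_space_normed_sequences[OF same_space_X LG.normed_sequences_axioms])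

lemma combine_blocks_vecs_iff: "combine_blocks p c \<in> vecs X_space \<longleftrightarrow> c \<in> vecs Z_space"
  for c :: "nat \<Rightarrow> 'k::real_normed_field"
  using same_space_X[where 'k = 'k] unfolding same_space_def
  by (simp add: gauge_space_def pw_combine_blocks[OF p1] block_gauge_def)

lemma vnorm_combine_blocks: "c \<in> vecs Z_space \<Longrightarrow> vnorm X_space (combine_blocks p c) = vnorm Z_space c"
  for c :: "nat \<Rightarrow> 'k::real_normed_field"
  using same_space_X[where 'k = 'k] combine_blocks_vecs_iff[of c] unfolding same_space_def
  by (simp add: gauge_space_def pw_combine_blocks[OF p1] block_gauge_def)

interpretation XN: normed_sequences "X_space :: 'k::real_normed_field seq_space"
  by (rule normed_sequences_X)

lemma combine_blocks_map: "bounded_map Z_space X_space 1 (combine_blocks p :: (nat \<Rightarrow> 'k::real_normed_field) \<Rightarrow> _)"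
proof (rule bounded_mapI)
  show "combine_blocks p c \<in> vecs X_space \<and> vnorm X_space (combine_blocks p c) \<le> 1 * vnorm Z_space c"
    if "c \<in> vecs Z_space" for c :: "nat \<Rightarrow> 'k"
    using that by (simp add: combine_blocks_vecs_iff vnorm_combine_blocks)
qed (simp, rule combine_blocks_add, rule combine_blocks_scale)

text \<open>
  Limits of combinations of blocks are constant on every block, since coordinates are continuous. In the
  other direction the partial sums over the first M groups converge: the p-th power of the norm of the
  remainder is at most the tail of a convergent series, by the decomposition into groups.
\<close>

lemma closed_span_blocks:
  "closed_span X_space (range (\<lambda>j. combine_blocks p (unit_seq j :: nat \<Rightarrow> 'k::real_normed_field))) = combine_blocks p ` vecs Z_space"
proof (rule antisym)
  obtain grp where grp: "block_sum block_gauge p grp 8"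
  proof (rule block_sum_block_gauge[OF p1]) qed (rule that)
  interpret B: block_sum block_gauge p grp 8 by (rule grp)
  let ?y = "\<lambda>j. combine_blocks p (unit_seq j :: nat \<Rightarrow> 'k)"
  have sub: "seqs.subspace (combine_blocks p ` vecs (Z_space :: 'k seq_space))"
    by (rule bounded_map_subspace[OF ZG.normed_sequences_axioms combine_blocks_map ZG.subspace order_refl])
  have "range ?y \<subseteq> combine_blocks p ` vecs Z_space" using B.unit_vecs by blast
  then have span: "seqs.span (range ?y) \<subseteq> combine_blocks p ` vecs Z_space"
    using sub by (rule seqs.span_minimal)
  show "closed_span X_space (range ?y) \<subseteq> combine_blocks p ` vecs Z_space"
  proof
    fix x assume "x \<in> closed_span X_space (range ?y)"
    then have x: "x \<in> vecs X_space" and near: "\<And>e. 0 < e \<Longrightarrow> \<exists>a\<in>seqs.span (range ?y). vnorm X_space (x - a) < e"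
      by (simp_all add: closed_span_def norm_closure_def)
    have const: "x n = x (b (interval_index b n))" for n
    proof -
      let ?m = "b (interval_index b n)"
      have "norm (x n - x ?m) \<le> 0 + e" if e: "0 < e" for e
      proof -
        have "0 < e / 2" using e by simp
        then obtain a where a: "a \<in> seqs.span (range ?y)" "vnorm X_space (x - a) < e / 2" using near by blast
        obtain c where c: "c \<in> vecs Z_space" "a = combine_blocks p c" using a(1) span by blast
        have aX: "a \<in> vecs X_space" using c by (simp add: combine_blocks_vecs_iff)
        have "a n = a ?m" unfolding c(2) by (simp add: combine_blocks_def interval_index_start)
        then have "x n - x ?m = (x - a) n - (x - a) ?m" by simp
        then have "norm (x n - x ?m) \<le> norm ((x - a) n) + norm ((x - a) ?m)"
          by (simp only: norm_triangle_ineq4)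
        also have "\<dots> \<le> vnorm X_space (x - a) + vnorm X_space (x - a)"
          by (intro add_mono XN.coordinate XN.vecs_diff x aX)
        finally show ?thesis using a(2) by simp
      qed
      then have "norm (x n - x ?m) \<le> 0" by (rule field_le_epsilon)
      then show ?thesis by simp
    qed
    have "x = combine_blocks p (coefficients p x)"
    proof
      fix n
      have "of_real (block_coeff p (interval_index b n)) \<noteq> (0 :: 'k)"
        using block_coeff_pos[of p "interval_index b n"] by simp
      then show "x n = combine_blocks p (coefficients p x) n"
        using const[of n] by (simp add: combine_blocks_def coefficients_def)
    qed
    moreover from this have "coefficients p x \<in> vecs Z_space" using x combine_blocks_vecs_iff by metis
    ultimately show "x \<in> combine_blocks p ` vecs Z_space" by blast
  qed
  show "combine_blocks p ` vecs Z_space \<subseteq> closed_span X_space (range ?y)"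
  proof
    fix x assume "x \<in> combine_blocks p ` vecs (Z_space :: 'k seq_space)"
    then obtain c :: "nat \<Rightarrow> 'k" where c: "c \<in> vecs Z_space" "x = combine_blocks p c" by blast
    define f where "f m = enn2real (block_gauge (pw p (B.block m c)))" for m
    have f: "ennreal (f m) = block_gauge (pw p (B.block m c))" for m
      using ZG.vecs_iff[of "B.block m c"] B.block_vecs[OF c(1), of m] by (simp add: f_def)
    have "ennreal 8 * block_gauge (pw p c) < top" using c(1) by (simp add: ZG.vecs_iff ennreal_mult_less_top)
    then have "(\<Sum>m. ennreal (f m)) \<noteq> top"
      unfolding f using le_less_trans[OF B.blocks_pw_le[of c]] by auto
    then have summ: "summable f" by (intro summable_suminf_not_top) (auto simp: f_def)
    have "\<exists>a\<in>seqs.span (range ?y). vnorm X_space (x - a) < e" if e: "0 < e" for e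
    proof -
      have "0 < (e / 2) powr p" using e by simp
      then obtain M where M: "norm (\<Sum>i. f (i + M)) < (e / 2) powr p"
        using suminf_exist_split[OF _ summ] by blast
      define h where "h = (\<lambda>j. if grp j < M then c j else 0)"
      define d where "d = (\<lambda>j. if grp j < M then 0 else c j)"
      have fin: "finite {j. grp j < M}"
      proof -
        have "{j. grp j < M} = (\<Union>m<M. {j. grp j = m})" by auto
        then show ?thesis using B.finite_grp by simp
      qed
      have "h = (\<Sum>j | grp j < M. seq_scale (c j) (unit_seq j))"
      proof
        fix n
        have "(\<Sum>j | grp j < M. seq_scale (c j) (unit_seq j)) n = (\<Sum>j | grp j < M. if j = n then c j else 0)"
          unfolding sum_fun_at by (rule sum.cong) (auto simp: seq_scale_def unit_seq_def)
        then show "h n = (\<Sum>j | grp j < M. seq_scale (c j) (unit_seq j)) n" using fin by (simp add: h_def)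
      qed
      then have "combine_blocks p h = combine_blocks p (\<Sum>j | grp j < M. seq_scale (c j) (unit_seq j))" by (simp only:)
      also have "\<dots> = (\<Sum>j | grp j < M. combine_blocks p (seq_scale (c j) (unit_seq j)))"
        by (rule bounded_map_sum[OF ZG.normed_sequences_axioms combine_blocks_map fin]) (intro ZG.vecs_scale B.unit_vecs)
      finally have h_span: "combine_blocks p h \<in> seqs.span (range ?y)"
        unfolding combine_blocks_scale by (simp only:) (intro seqs.span_sum seqs.span_scale seqs.span_base rangeI)
      have "pw p d n = (\<Sum>i. pw p (B.block (i + M) c) n)" for n
      proof (cases "grp n < M")
        case True
        then have "(\<lambda>i. pw p (B.block (i + M) c) n) = (\<lambda>i. 0)" by (intro ext) (auto simp: pw_def)
        then show ?thesis using True by (simp add: d_def pw_def)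
      next
        case False
        have "(\<Sum>i. pw p (B.block (i + M) c) n) = (\<Sum>i\<in>{grp n - M}. pw p (B.block (i + M) c) n)"
          by (rule suminf_finite) (use False in \<open>auto simp: pw_def\<close>)
        then show ?thesis using False by (simp add: d_def pw_def)
      qed
      then have "pw p d = (\<lambda>n. \<Sum>i. pw p (B.block (i + M) c) n)" by (rule ext)
      then have "block_gauge (pw p d) \<le> (\<Sum>i. ennreal (f (i + M)))"
        unfolding f by (simp only: ZG.countably_subadditive)
      also have "\<dots> = ennreal (\<Sum>i. f (i + M))"
      proof (rule suminf_ennreal2)
        show "0 \<le> f (i + M)" for i by (simp add: f_def)
        show "summable (\<lambda>i. f (i + M))" using summ by (simp only: summable_iff_shift)
      qed
      also have "\<dots> \<le> ennreal ((e / 2) powr p)" using M by (intro ennreal_leI) simp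
      finally have d: "d \<in> vecs Z_space" "vnorm Z_space d \<le> e / 2"
        using ZG.vnorm_le_iff[of "e / 2" d] e by auto
      have "x - combine_blocks p h = combine_blocks p d"
        unfolding c(2) by (rule ext) (simp add: combine_blocks_def h_def d_def)
      then have "vnorm X_space (x - combine_blocks p h) = vnorm Z_space d" using vnorm_combine_blocks[OF d(1)] by (simp only:)
      also have "\<dots> < e" using d(2) e by simp
      finally show ?thesis using h_span by blast
    qed
    moreover have "x \<in> vecs X_space" using c by (simp add: combine_blocks_vecs_iff)
    ultimately show "x \<in> closed_span X_space (range ?y)" by (simp add: closed_span_def norm_closure_def)
  qed
qed

text \<open>
  Membership would put P into the diagonal ideal formed with the embedding of the coefficient space and
  with Q = coefficients of P. As P is the identity on Y, its diagonal there is constantly 1.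
\<close>

lemma projection_not_in_join:
  fixes Y :: "(nat \<Rightarrow> 'k::{real_normed_field,heine_borel}) set"
  assumes Y: "Y = closed_span X_space (range (\<lambda>j. combine_blocks p (unit_seq j)))"
    and P: "projection_onto X_space Y P"
    and nY: "\<not> isomorphic_spaces (restrict_to X_space Y) (lp_space p)"
  shows "P \<notin> closed_ideal_join X_space (op_closure X_space (factoring_through (lp_space p) X_space))
    (strictly_singular X_space)"
proof
  let ?X = "X_space :: 'k seq_space" and ?Z = "Z_space :: 'k seq_space"
  assume "P \<in> closed_ideal_join ?X (op_closure ?X (factoring_through (lp_space p) ?X)) (strictly_singular ?X)"
  obtain grp where grp: "block_sum block_gauge p grp 8"
  proof (rule block_sum_block_gauge[OF p1]) qed (rule that)
  interpret B: block_sum block_gauge p grp 8 by (rule grp)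
  have ops: "P \<in> operators ?X ?X" and PP: "P \<circ> P = P" and ran: "P ` vecs ?X = Y"
    using P by (simp_all add: projection_onto_def)
  have Yemb: "Y = combine_blocks p ` vecs ?Z" unfolding Y by (rule closed_span_blocks)
  have P_id: "P y = y" if y: "y \<in> Y" for y
  proof -
    obtain x where "y = P x" using y ran by blast
    then show ?thesis using fun_cong[OF PP, of x] by (simp only: comp_def)
  qed
  obtain CP where CP: "bounded_map ?X ?X CP P" using XN.bounded_map_operators[OF ops] by (rule exE)
  have E_add: "coefficients p (x + y) = coefficients p x + coefficients p y" for x y :: "nat \<Rightarrow> 'k"
    by (rule ext) (simp add: coefficients_def add_divide_distrib)
  have E_scale: "coefficients p (seq_scale d x) = seq_scale d (coefficients p x)" for d and x :: "nat \<Rightarrow> 'k"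
    by (rule ext) (simp add: coefficients_def seq_scale_def)
  have coeff: "coefficients p y \<in> vecs ?Z \<and> vnorm ?Z (coefficients p y) = vnorm ?X y \<and> combine_blocks p (coefficients p y) = y"
    if y: "y \<in> Y" for y
  proof -
    obtain c where c: "c \<in> vecs ?Z" "y = combine_blocks p c" using y Yemb by blast
    then show ?thesis by (simp add: coefficients_combine_blocks vnorm_combine_blocks)
  qed
  define Q where "Q x = coefficients p (P x)" for x
  have Q: "bounded_map ?X ?Z CP Q"
  proof (rule bounded_mapI)
    show "0 \<le> CP" by (rule bounded_map_nonneg[OF CP])
  next
    fix x assume x: "x \<in> vecs ?X"
    then have "P x \<in> Y" using ran by blast
    then show "Q x \<in> vecs ?Z \<and> vnorm ?Z (Q x) \<le> CP * vnorm ?X x"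
      using coeff[of "P x"] bounded_map_norm[OF CP x] by (simp add: Q_def)
  next
    fix x y assume "x \<in> vecs ?X" "y \<in> vecs ?X"
    then show "Q (x + y) = Q x + Q y" unfolding Q_def by (simp only: bounded_map_add[OF CP] E_add)
  next
    fix d x assume "x \<in> vecs ?X"
    then show "Q (seq_scale d x) = seq_scale d (Q x)"
      unfolding Q_def by (simp only: bounded_map_scale[OF CP] E_scale)
  qed
  have PK: "P \<in> B.diagonal_ideal ?X (combine_blocks p) Q"
    using B.closed_ideal_join_subset_diagonal_ideal[OF normed_sequences_X combine_blocks_map Q]
      \<open>P \<in> closed_ideal_join ?X (op_closure ?X (factoring_through (lp_space p) ?X)) (strictly_singular ?X)\<close>
    by blast
  have eY: "combine_blocks p (unit_seq j) \<in> Y" for j unfolding Yemb using B.unit_vecs by blast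
  have "isomorphic_spaces ?Z (lp_gauged p)"
  proof (rule B.isomorphic_lp_if_diagonal_one[OF normed_sequences_X combine_blocks_map Q PK ops ops])
    fix j
    show "Q (P (P (P (combine_blocks p (unit_seq j))))) j = 1"
      unfolding Q_def by (simp only: P_id[OF eY] coefficients_combine_blocks) (simp add: unit_seq_def)
  qed
  then have ZL: "isomorphic_spaces ?Z (lp_space p)"
  proof -
    assume iso: "isomorphic_spaces ?Z (lp_gauged p)"
    have s: "same_space (lp_space p :: 'k seq_space) (lp_gauged p)" by (rule same_space_lp[OF p1])
    have sZ: "same_space ?Z ?Z" by (simp add: same_space_def)
    have "vecs (lp_space p :: 'k seq_space) = vecs (lp_gauged p)" using s by (simp add: same_space_def)
    then show ?thesis
      using iso unfolding isomorphic_spaces_def same_space_operators[OF sZ s] same_space_operators[OF s sZ] by (simp only:)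
  qed
  have YX: "Y \<subseteq> vecs ?X" unfolding Yemb by (auto simp: combine_blocks_vecs_iff)
  have subY: "seqs.subspace Y"
    unfolding Yemb by (rule bounded_map_subspace[OF ZG.normed_sequences_axioms combine_blocks_map ZG.subspace order_refl])
  have vr: "vecs (restrict_to ?X Y) = Y" "vnorm (restrict_to ?X Y) = vnorm ?X"
    by (simp_all add: restrict_to_def)
  have nYX: "normed_sequences (restrict_to ?X Y)"
    by (rule XN.normed_sequences_restrict[OF subY YX])
  have "isomorphic_spaces (restrict_to ?X Y) ?Z"
  proof (rule isomorphic_spacesI[OF nYX ZG.normed_sequences_axioms])
    show "bounded_map (restrict_to ?X Y) ?Z 1 (coefficients p)"
      by (rule bounded_mapI) (simp, simp add: coeff vr, rule E_add, rule E_scale)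
    show "bounded_map ?Z (restrict_to ?X Y) 1 (combine_blocks p)"
    proof (rule bounded_mapI)
      fix c assume "c \<in> vecs ?Z"
      then show "combine_blocks p c \<in> vecs (restrict_to ?X Y) \<and> vnorm (restrict_to ?X Y) (combine_blocks p c) \<le> 1 * vnorm ?Z c"
        by (simp add: restrict_to_def Yemb vnorm_combine_blocks)
    qed (simp, rule combine_blocks_add, rule combine_blocks_scale)
    show "combine_blocks p (coefficients p x) = x" if "x \<in> vecs (restrict_to ?X Y)" for x
      using coeff[of x] that unfolding vr by blast
    show "coefficients p (combine_blocks p y) = y" for y :: "nat \<Rightarrow> 'k" by (rule coefficients_combine_blocks)
  qed
  then have "isomorphic_spaces (restrict_to ?X Y) (lp_space p)"
    by (rule isomorphic_spaces_trans[OF nYX ZG.normed_sequences_axioms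
          same_space_normed_sequences[OF same_space_lp[OF p1] B.lp.normed_sequences_axioms] _ ZL])
  then show False using nY by blast
qed

end

end

section \<open>Enumeration of the blocks\<close>

text \<open>
  The blocks of all families are numbered consecutively; block i of family k has number
  \<open>family_start N k + i\<close> and begins at the position given by \<open>position_bound\<close>.
\<close>

definition family_start :: "(nat \<Rightarrow> nat) \<Rightarrow> nat \<Rightarrow> nat" where
  "family_start N k = (\<Sum>m<k. N m)"

definition position_bound :: "(nat \<Rightarrow> nat) \<Rightarrow> nat \<Rightarrow> nat" where
  "position_bound N j = (\<Sum>i<j. Suc (interval_index (family_start N) i))"

lemma interval_partition_family_start:
  assumes "\<And>k. 0 < N k"
  shows "interval_partition (family_start N)"
  by unfold_locales (use assms in \<open>auto simp: family_start_def strict_mono_Suc_iff\<close>)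

lemma position_bound_family:
  assumes N: "\<And>k. 0 < N k"
  shows "i \<le> N k \<Longrightarrow> position_bound N (family_start N k + i) = block_start N k + i * Suc k"
proof -
  interpret I: interval_partition "family_start N" by (rule interval_partition_family_start[OF N])
  have step: "position_bound N (family_start N k + i) = block_start N k + i * Suc k"
    if "position_bound N (family_start N k) = block_start N k" "i \<le> N k" for k i
    using that(2)
  proof (induction i)
    case 0
    then show ?case using that(1) by simp
  next
    case (Suc i)
    have "interval_index (family_start N) (family_start N k + i) = k"
      by (rule I.interval_index_eq) (use Suc.prems in \<open>simp_all add: family_start_def\<close>)
    moreover have "position_bound N (family_start N k + i) = block_start N k + i * Suc k" using Suc by simp
    ultimately show ?case by (simp add: position_bound_def)
  qed
  have "position_bound N (family_start N k) = block_start N k" for k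
  proof (induction k)
    case 0
    show ?case by (simp add: position_bound_def family_start_def block_start_def)
  next
    case (Suc k)
    have "family_start N (Suc k) = family_start N k + N k" by (simp add: family_start_def)
    moreover have "block_start N (Suc k) = block_start N k + N k * Suc k" by (simp add: block_start_def)
    ultimately show ?case using step[OF Suc order_refl] by (simp only:)
  qed
  then show "i \<le> N k \<Longrightarrow> position_bound N (family_start N k + i) = block_start N k + i * Suc k"
    by (rule step)
qed

lemma lorentz_blocks_position_bound:
  assumes N: "\<And>k. 0 < N k" and w: "w \<in> lorentz_weights"
  shows "lorentz_blocks (position_bound N) w"
proof -
  interpret I: interval_partition "family_start N" by (rule interval_partition_family_start[OF N])
  show ?thesis
  proof unfold_locales
    fix M
    have "M \<le> interval_index (family_start N) j" if "family_start N M \<le> j" for j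
      using that I.interval_index_bounds(2)[of j]
        strict_mono_less[OF I.strict, of M "Suc (interval_index (family_start N) j)"] by linarith
    then have "M \<le> position_bound N (Suc j) - position_bound N j" if "family_start N M \<le> j" for j
      using that by (simp add: position_bound_def le_SucI)
    then show "\<exists>J. \<forall>j\<ge>J. M \<le> position_bound N (Suc j) - position_bound N j" by blast
  qed (use w in \<open>auto simp: lorentz_weights_def position_bound_def strict_mono_Suc_iff\<close>)
qed

lemma block_span_eq_closed_span_range:
  assumes N: "\<And>k. 0 < N k" and w: "w \<in> lorentz_weights"
  shows "block_span w p N = closed_span (lorentz_space w p)
    (range (\<lambda>j. lorentz_blocks.combine_blocks (position_bound N) w p (unit_seq j :: nat \<Rightarrow> 'k::real_normed_field)))"
proof -
  interpret I: interval_partition "family_start N" by (rule interval_partition_family_start[OF N])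
  interpret B: lorentz_blocks "position_bound N" w by (rule lorentz_blocks_position_bound[OF N w])
  have eq: "B.combine_blocks p (unit_seq (family_start N k + i)) = (lorentz_block w p N k i :: nat \<Rightarrow> 'k)"
    if i: "i < N k" for k i
  proof -
    have b: "position_bound N (family_start N k + i) = block_start N k + i * Suc k"
      "position_bound N (Suc (family_start N k + i)) = block_start N k + Suc i * Suc k"
      using position_bound_family[OF N, where i = i and k = k] position_bound_family[OF N, where i = "Suc i" and k = k] i by simp_all
    have "B.size_of (family_start N k + i) = Suc k" unfolding B.size_of_def b by simp
    then show ?thesis unfolding B.combine_blocks_unit_seq lorentz_block_def b by (simp only:)
  qed
  have "{lorentz_block w p N k i |k i. i < N k} = range (\<lambda>j. B.combine_blocks p (unit_seq j) :: nat \<Rightarrow> 'k)"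
  proof (intro antisym subsetI)
    fix x :: "nat \<Rightarrow> 'k" assume "x \<in> {lorentz_block w p N k i |k i. i < N k}"
    then obtain k i where "x = lorentz_block w p N k i" "i < N k" by blast
    then have "x = B.combine_blocks p (unit_seq (family_start N k + i))" by (simp only: eq)
    then show "x \<in> range (\<lambda>j. B.combine_blocks p (unit_seq j))" by (rule range_eqI)
  next
    fix x :: "nat \<Rightarrow> 'k" assume "x \<in> range (\<lambda>j. B.combine_blocks p (unit_seq j))"
    then obtain j where x: "x = B.combine_blocks p (unit_seq j)" by (rule rangeE)
    define k where "k = interval_index (family_start N) j"
    have k: "family_start N k \<le> j" "j < family_start N (Suc k)"
      unfolding k_def by (rule I.interval_index_bounds)+
    then have "j - family_start N k < N k" by (simp add: family_start_def)
    moreover have "x = lorentz_block w p N k (j - family_start N k)"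
      unfolding x using eq[OF calculation] k(1) by simp
    ultimately show "x \<in> {lorentz_block w p N k i |k i. i < N k}" by blast
  qed
  then show ?thesis unfolding block_span_def by (simp only:)
qed

theorem theorem4p3:
  fixes p :: real and w :: "nat \<Rightarrow> real" and N :: "nat \<Rightarrow> nat"
    and X :: "'k::{real_normed_field, heine_borel} seq_space"
    and Y :: "(nat \<Rightarrow> 'k) set"
    and P :: "(nat \<Rightarrow> 'k) \<Rightarrow> (nat \<Rightarrow> 'k)"
  assumes "1 \<le> p"
    and "w \<in> lorentz_weights"
    and "X = lorentz_space w p"
    and "\<And>k. 0 < N k"
    and "incseq N"
    and "Y = block_span w p N"
    and "one_complemented X Y"
    and "\<not> contains_isomorph (restrict_to X Y) X"
    and "\<not> isomorphic_spaces (restrict_to X Y) (lp_space p)"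
    and "projection_onto X Y P"
  shows "P \<in> singular_for X X
           - closed_ideal_join X (op_closure X (factoring_through (lp_space p) X))
               (strictly_singular X)"
proof
  interpret B: lorentz_blocks "position_bound N" w
    by (rule lorentz_blocks_position_bound[OF assms(4,2)])
  have "normed_sequences X" unfolding assms(3) by (rule B.normed_sequences_X[OF assms(1)])
  then show "P \<in> singular_for X X"
    by (rule projection_singular_for[OF _ assms(10,8)])
  have Y: "Y = closed_span (lorentz_space w p) (range (\<lambda>j. B.combine_blocks p (unit_seq j)))"
    unfolding assms(6) by (rule block_span_eq_closed_span_range[OF assms(4,2)])
  show "P \<notin> closed_ideal_join X (op_closure X (factoring_through (lp_space p) X)) (strictly_singular X)"
    unfolding assms(3)
    by (rule B.projection_not_in_join[OF assms(1) Y assms(10)[unfolded assms(3)] assms(9)[unfolded assms(3)]])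
qed

end
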